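(* Let $G$ be a plane graph containing no cycle of length $4$, $7$ or $9$, and no $5$-cycle normally adjacent to a $3$-cycle. Then at least one of the following holds: (a) $\delta(G)\le 2$; (b) $G$ contains a subgraph of one of the following three types (all degrees below are degrees in $G$): (1) a $10$-cycle $v_1v_2\cdots v_{10}v_1$ together with a vertex $w$ not on the cycle adjacent to both $v_3$ and $v_4$, where all eleven vertices $v_1,\dots,v_{10},w$ have degree $3$ in $G$; (2) a $10$-cycle $x_1x_2\cdots x_{10}x_1$ and a $10$-cycle $x_2x_1y_{10}y_9y_8y_7y_6y_5y_4y_3x_2$ (sharing exactly the edge $x_1x_2$, with $y_3,\dots,y_{10}$ distinct and not on the first cycle), together with the edges $x_3y_3$ and $x_{10}y_{10}$, where $x_1,\dots,x_{10},y_4,\dots,y_9$ have degree $3$ in $G$ and $y_3,y_{10}$ have degree $4$ in $G$; (3) an $8$-cycle $v_1v_2\cdots v_8v_1$ together with three vertices $w_1,w_2,w_3$ not on it such that $v_3w_1w_2w_3v_4$ is a path (so $v_3v_4w_3w_2w_1v_3$ is a $5$-cycle sharing exactly the edge $v_3v_4$ with the $8$-cycle), where all eleven vertices $v_1,\dots,v_8,w_1,w_2,w_3$ have degree $3$ in $G$.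
   Context: Graphs are finite and simple; $\delta(G)$ is the minimum degree. Two cycles are normally adjacent if their intersection is isomorphic to $K_2$. In the paper, configuration (1) is drawn as a $10$-face normally adjacent to a $3$-face, (2) as two adjacent $10$-faces, and (3) as an $8$-face normally adjacent to a $5$-face. *)

theory Defs
  imports "HOL-Analysis.Analysis"
begin

type_synonym 'a ugraph = "'a set \<times> 'a set set"

abbreviation verts :: "'a ugraph \<Rightarrow> 'a set" where "verts G \<equiv> fst G"
abbreviation edges :: "'a ugraph \<Rightarrow> 'a set set" where "edges G \<equiv> snd G"

definition simple_graph :: "'a ugraph \<Rightarrow> bool" where
  "simple_graph G \<longleftrightarrow>
     finite (verts G) \<and> (\<forall>e\<in>edges G. e \<subseteq> verts G \<and> card e = 2)"

definition adj :: "'a ugraph \<Rightarrow> 'a \<Rightarrow> 'a \<Rightarrow> bool" where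
  "adj G u v \<longleftrightarrow> {u, v} \<in> edges G"

definition vdeg :: "'a ugraph \<Rightarrow> 'a \<Rightarrow> nat" where
  "vdeg G v = card {e \<in> edges G. v \<in> e}"

(* The null graph gets minimum degree 0 by convention, since Min {} is unspecified. *)
definition min_degree :: "'a ugraph \<Rightarrow> nat" where
  "min_degree G = (if verts G = {} then 0 else Min (vdeg G ` verts G))"

(* A plane graph is a graph together with a drawing in the plane (taken as the type complex):
   p places the vertices, and g e is a simple arc joining the two ends of the edge e whose
   interior meets neither a vertex nor any other edge. *)
definition plane_graph ::
    "'a ugraph \<Rightarrow> ('a \<Rightarrow> complex) \<Rightarrow> ('a set \<Rightarrow> real \<Rightarrow> complex) \<Rightarrow> bool" where
  "plane_graph G p g \<longleftrightarrow>
     simple_graph G \<and>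
     inj_on p (verts G) \<and>
     (\<forall>e\<in>edges G. arc (g e) \<and> {pathstart (g e), pathfinish (g e)} = p ` e) \<and>
     (\<forall>e\<in>edges G. (path_image (g e) - p ` e) \<inter> p ` verts G = {}) \<and>
     (\<forall>e\<in>edges G. \<forall>f\<in>edges G. e \<noteq> f \<longrightarrow>
        (path_image (g e) - p ` e) \<inter> path_image (g f) = {})"

(* Cycles are given by the list of their vertices in cyclic order; cycle_graph is the
   corresponding subgraph. *)
definition cycle_graph :: "'a list \<Rightarrow> 'a ugraph" where
  "cycle_graph c = (set c, {{c ! i, c ! (Suc i mod length c)} | i. i < length c})"

definition is_cycle :: "'a ugraph \<Rightarrow> 'a list \<Rightarrow> bool" where
  "is_cycle G c \<longleftrightarrow>
     3 \<le> length c \<and> distinct c \<and>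
     verts (cycle_graph c) \<subseteq> verts G \<and> edges (cycle_graph c) \<subseteq> edges G"

definition has_cycle_of_length :: "'a ugraph \<Rightarrow> nat \<Rightarrow> bool" where
  "has_cycle_of_length G k \<longleftrightarrow> (\<exists>c. is_cycle G c \<and> length c = k)"

definition graph_inter :: "'a ugraph \<Rightarrow> 'a ugraph \<Rightarrow> 'a ugraph" where
  "graph_inter G H = (verts G \<inter> verts H, edges G \<inter> edges H)"

definition is_K2 :: "'a ugraph \<Rightarrow> bool" where
  "is_K2 H \<longleftrightarrow> (\<exists>u v. u \<noteq> v \<and> H = ({u, v}, {{u, v}}))"

definition normally_adjacent :: "'a list \<Rightarrow> 'a list \<Rightarrow> bool" where
  "normally_adjacent c d \<longleftrightarrow> is_K2 (graph_inter (cycle_graph c) (cycle_graph d))"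

definition config1 :: "'a ugraph \<Rightarrow> bool" where
  "config1 G \<longleftrightarrow>
     (\<exists>v1 v2 v3 v4 v5 v6 v7 v8 v9 v10 w.
        is_cycle G [v1, v2, v3, v4, v5, v6, v7, v8, v9, v10] \<and>
        w \<notin> {v1, v2, v3, v4, v5, v6, v7, v8, v9, v10} \<and>
        adj G w v3 \<and> adj G w v4 \<and>
        (\<forall>z \<in> {v1, v2, v3, v4, v5, v6, v7, v8, v9, v10, w}. vdeg G z = 3))"

definition config2 :: "'a ugraph \<Rightarrow> bool" where
  "config2 G \<longleftrightarrow>
     (\<exists>x1 x2 x3 x4 x5 x6 x7 x8 x9 x10 y3 y4 y5 y6 y7 y8 y9 y10.
        is_cycle G [x1, x2, x3, x4, x5, x6, x7, x8, x9, x10] \<and>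
        is_cycle G [x2, x1, y10, y9, y8, y7, y6, y5, y4, y3] \<and>
        {y3, y4, y5, y6, y7, y8, y9, y10} \<inter> {x1, x2, x3, x4, x5, x6, x7, x8, x9, x10} = {} \<and>
        adj G x3 y3 \<and> adj G x10 y10 \<and>
        (\<forall>z \<in> {x1, x2, x3, x4, x5, x6, x7, x8, x9, x10, y4, y5, y6, y7, y8, y9}. vdeg G z = 3) \<and>
        vdeg G y3 = 4 \<and> vdeg G y10 = 4)"

definition config3 :: "'a ugraph \<Rightarrow> bool" where
  "config3 G \<longleftrightarrow>
     (\<exists>v1 v2 v3 v4 v5 v6 v7 v8 w1 w2 w3.
        is_cycle G [v1, v2, v3, v4, v5, v6, v7, v8] \<and>
        distinct [w1, w2, w3] \<and>
        {w1, w2, w3} \<inter> {v1, v2, v3, v4, v5, v6, v7, v8} = {} \<and>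
        adj G v3 w1 \<and> adj G w1 w2 \<and> adj G w2 w3 \<and> adj G w3 v4 \<and>
        (\<forall>z \<in> {v1, v2, v3, v4, v5, v6, v7, v8, w1, w2, w3}. vdeg G z = 3))"

end

theory Submission
  imports Defs
begin

text \<open>
  Suppose that all degrees are at least 3 and that none of the three configurations occurs. Inside \<open>G\<close> there
  is a 2-connected subgraph (an end block) in which every vertex but one, \<open>v0\<close>, keeps its degree. It is built from a
  cycle by adding ears; each ear splits one face in two (a theta curve argument), so every face is
  bounded by a cycle, every edge lies on two faces, and Euler's formula holds. Give a vertex of degree \<open>d\<close> the
  charge \<open>2d - 6\<close> and a face of length \<open>l\<close> the charge \<open>l - 6\<close>; the total is \<open>-12\<close>.

  The forbidden cycles leave only faces of length 3, 5, 6, 8 and at least 10. A triangle is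
  adjacent to faces of length at least 10 only, and a 5-face to no 6-face. Only triangles and 5-faces are in debt; they are
  paid by their long neighbours and by the vertices of degree at least 4. The faces that cannot afford this are
  an 8-face of cubic vertices next to a cubic 5-face, a 10-face of cubic vertices next to a cubic triangle, and a 10-face
  with two vertices of degree 4 next to a 10-face of cubic vertices in need; these are the three
  configurations. So every charge ends up nonnegative, except that \<open>v0\<close> may end with \<open>-6\<close>, which contradicts the total.
\<close>

section \<open>Theta curves\<close>

text \<open>Why an end block: at a cut vertex a face need not be bounded by a cycle, and then
  neither the list of face lengths nor the local arguments make sense. The price is one vertex of
  unknown degree, which the slack between -6 and -12 absorbs. Two cycles glued along an edge have an
  outer cycle two shorter than their total length: 3 + 3 - 2 = 4, 3 + 6 - 2 = 7, 3 + 8 - 2 = 5 + 6 -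
  2 = 9; three 5-faces around a cubic vertex leave 15 - 6 = 9. This is the source of all
  restrictions on neighbouring faces; the work lies in excluding accidental coincidences of
  vertices. The constants come from tight cases. A triangle lacks 3 and has six pairs of an edge and
  an end, hence 1/2 each. A cubic 5-face lacks 1 and has at least three long neighbours, hence 1/3.
  A cubic 10-face owns 4 and may spend 10 times 1/2 on five triangles; the missing 1 is raised
  through the five edges between them, hence 1/5. Below, a vertex is called heavy if it does not
  satisfy \<open>three\<close>.\<close>

lemma components_eqI:
  fixes X :: "'a::topological_space set"
  assumes "\<And>C. C \<in> \<C> \<Longrightarrow> open C \<and> connected C \<and> C \<noteq> {}"
    and "pairwise disjnt \<C>" and "\<Union>\<C> = X"
  shows "components X = \<C>"
proof -
  have C: "C \<in> components X" if "C \<in> \<C>" for C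
    unfolding in_components_maximal
  proof (intro conjI allI impI)
    show "C \<noteq> {}" "C \<subseteq> X" "connected C" using that assms by auto
    fix D assume D: "D \<noteq> {} \<and> C \<subseteq> D \<and> D \<subseteq> X \<and> connected D"
    have "D \<subseteq> C \<union> \<Union>(\<C> - {C})" using D assms(3) by auto
    moreover have "open (\<Union>(\<C> - {C}))" using assms(1) by auto
    moreover have "C \<inter> \<Union>(\<C> - {C}) = {}"
      using assms(2) that by (auto simp: pairwise_def disjnt_def)
    ultimately have "C \<inter> D = {} \<or> \<Union>(\<C> - {C}) \<inter> D = {}"
      using D assms(1)[OF that] connectedD[of D C "\<Union>(\<C> - {C})"] by blast
    then show "D = C" using D assms(1)[OF that] assms(3) \<open>D \<subseteq> C \<union> \<Union>(\<C> - {C})\<close> by blast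
  qed
  have "K \<in> \<C>" if K: "K \<in> components X" for K
  proof -
    obtain x where "x \<in> K" "x \<in> X" using K in_components_nonempty in_components_subset by blast
    then obtain C where "C \<in> \<C>" "x \<in> C" using assms(3) by blast
    then show ?thesis using C K components_nonoverlap \<open>x \<in> K\<close> by blast
  qed
  then show ?thesis using C by blast
qed

section \<open>Jordan curves and arcs as point sets\<close>

definition jordan_set :: "complex set \<Rightarrow> bool" where
  "jordan_set J \<longleftrightarrow> (\<exists>c. simple_path c \<and> pathfinish c = pathstart c \<and> path_image c = J)"

lemma jordan_set_components:
  assumes "jordan_set J"
  obtains I K where "components (- J) = {I, K}" "I \<noteq> K" "I \<inter> K = {}" "I \<union> K = - J"
    "open I" "open K" "connected I" "connected K" "I \<noteq> {}" "K \<noteq> {}"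
    "frontier I = J" "frontier K = J"
proof -
  obtain c where c: "simple_path c" "pathfinish c = pathstart c" "path_image c = J"
    using assms by (auto simp: jordan_set_def)
  let ?I = "inside J" and ?K = "outside J"
  have *: "?I \<noteq> {}" "open ?I" "connected ?I" "?K \<noteq> {}" "open ?K" "connected ?K" "?I \<inter> ?K = {}"
    "?I \<union> ?K = - J" "frontier ?I = J" "frontier ?K = J"
    using Jordan_inside_outside[OF c(1,2)] c(3) by auto
  have "components (- J) = {?I, ?K}"
    by (rule components_eqI) (use * in \<open>auto simp: pairwise_insert disjnt_def Int_commute\<close>)
  moreover have "?I \<noteq> ?K" using *(1,7) by (metis Int_absorb)
  ultimately show ?thesis using that[of ?I ?K] * by simp
qed

lemma jordan_set_closed: "jordan_set J \<Longrightarrow> closed J"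
  by (metis jordan_set_def closed_path_image simple_path_imp_path)

lemma jordan_set_compact: "jordan_set J \<Longrightarrow> compact J"
  by (metis jordan_set_def compact_path_image simple_path_imp_path)

lemma jordan_set_frontier:
  assumes "jordan_set J" "C \<in> components (- J)"
  shows "frontier C = J"
  by (rule jordan_set_components[OF assms(1)]) (use assms in auto)

definition arc_set :: "complex \<Rightarrow> complex \<Rightarrow> complex set \<Rightarrow> bool" where
  "arc_set x y A \<longleftrightarrow> (\<exists>c. arc c \<and> pathstart c = x \<and> pathfinish c = y \<and> path_image c = A)"

lemma arc_set_sym: "arc_set x y A \<Longrightarrow> arc_set y x A"
  unfolding arc_set_def by (metis arc_reversepath path_image_reversepath pathfinish_reversepath pathstart_reversepath)

lemma arc_set_join:
  assumes "arc_set x y A" "arc_set y z B" "A \<inter> B = {y}"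
  shows "arc_set x z (A \<union> B)"
proof -
  obtain a b where "arc a" "pathstart a = x" "pathfinish a = y" "path_image a = A"
    "arc b" "pathstart b = y" "pathfinish b = z" "path_image b = B"
    using assms by (auto simp: arc_set_def)
  then have "arc (a +++ b)" "path_image (a +++ b) = A \<union> B" using assms(3)
    by (auto intro!: arc_join simp: path_image_join)
  then show ?thesis unfolding arc_set_def
    by (metis \<open>pathfinish b = z\<close> \<open>pathstart a = x\<close> pathfinish_join pathstart_join)
qed

lemma jordan_set_join:
  assumes "arc_set x y A" "arc_set x y B" "A \<inter> B = {x, y}"
  shows "jordan_set (A \<union> B)"
proof -
  obtain a b where "arc a" "pathstart a = x" "pathfinish a = y" "path_image a = A"
    "arc b" "pathstart b = y" "pathfinish b = x" "path_image b = B"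
    using assms arc_set_sym[OF assms(2)] by (auto simp: arc_set_def)
  then have "simple_path (a +++ b)" "path_image (a +++ b) = A \<union> B" using assms(3)
    by (auto intro!: simple_path_join_loop simp: path_image_join)
  then show ?thesis unfolding jordan_set_def
    by (metis \<open>pathfinish b = x\<close> \<open>pathstart a = x\<close> pathfinish_join pathstart_join)
qed

text \<open>The last clause makes the ends of an arc limits of its interior; it is what later puts
  the ends of an ear on the boundary of the face that contains the ear.\<close>

lemma arc_set_interior:
  assumes "arc_set x y A"
  shows "connected (A - {x, y})" "A - {x, y} \<noteq> {}" "connected A" "closed A" "A \<subseteq> closure (A - {x, y})"
proof -
  obtain a where a: "arc a" "pathstart a = x" "pathfinish a = y" "path_image a = A"
    using assms by (auto simp: arc_set_def)
  show 1: "connected (A - {x, y})"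
    using a connected_simple_path_endless[of a] arc_imp_simple_path by metis
  show 2: "connected A" "closed A"
    using a connected_arc_image closed_arc_image by metis+
  have inj: "inj_on a {0..1}" using a(1) by (auto simp: arc_def)
  have "a (1/2) \<noteq> a 0" "a (1/2) \<noteq> a 1" using inj_onD[OF inj, of "1/2" 0] inj_onD[OF inj, of "1/2" 1] by auto
  then have "a (1/2) \<in> A - {x, y}" using a by (auto simp: pathstart_def pathfinish_def path_image_def)
  then show 3: "A - {x, y} \<noteq> {}" by blast
  show "A \<subseteq> closure (A - {x, y})"
  proof -
    have oc: "a ` {0<..<1} = A - {x, y}"
      using a(2-4) simple_path_endless[OF arc_imp_simple_path[OF a(1)]] by auto
    have "a ` closure {0<..<1} \<subseteq> closure (a ` {0<..<1})"
      by (rule image_closure_subset)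
        (use a(1) in \<open>auto simp: arc_def path_def closure_subset intro: closure_subset[THEN subsetD]\<close>)
    then show ?thesis using oc a(4) by (auto simp: path_image_def)
  qed
qed

text \<open>The interior of \<open>A2\<close> is connected and misses the Jordan curve formed by
  \<open>A1\<close> and \<open>A3\<close>, so it lies on one side of it; \<open>C\<close> is the
  other side. The last clause holds because only one side is left outside \<open>C\<close>.\<close>

lemma theta_split_aux:
  assumes a1: "arc_set x y A1" and a2: "arc_set x y A2" and a3: "arc_set x y A3"
    and i12: "A1 \<inter> A2 = {x, y}" and i13: "A1 \<inter> A3 = {x, y}" and i23: "A2 \<inter> A3 = {x, y}"
  obtains C where "C \<in> components (- (A1 \<union> A3))" "C \<inter> A2 = {}"
    "\<And>b. b \<in> - (A1 \<union> A3) \<Longrightarrow> b \<notin> C \<Longrightarrow> \<forall>z. z \<in> - (A1 \<union> A3) \<longrightarrow> z \<notin> C \<longrightarrow> connected_component (- (A1 \<union> A3)) z b"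
proof -
  note thI = that
  obtain I K where IK: "components (- (A1 \<union> A3)) = {I, K}" "I \<inter> K = {}" "I \<union> K = - (A1 \<union> A3)"
      "connected I" "connected K"
    using jordan_set_components[OF jordan_set_join[OF a1 a3 i13]] by metis
  have sub: "A2 - {x, y} \<subseteq> - (A1 \<union> A3)" using i12 i23 by blast
  have xy: "{x, y} \<subseteq> A1" using i12 by blast
  have ic: "connected (A2 - {x, y})" "A2 - {x, y} \<noteq> {}" using arc_set_interior[OF a2] by auto
  have *: ?thesis if "C \<in> {I, K}" "D \<in> {I, K}" "C \<noteq> D" "A2 - {x, y} \<subseteq> D" for C D
  proof (rule thI)
    show "C \<in> components (- (A1 \<union> A3))" using IK(1) that by blast
    show "C \<inter> A2 = {}" using that IK(2,3) xy by blast
  next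
    fix b assume b: "b \<in> - (A1 \<union> A3)" "b \<notin> C"
    then have "b \<in> D" using IK(3) that by blast
    show "\<forall>z. z \<in> - (A1 \<union> A3) \<longrightarrow> z \<notin> C \<longrightarrow> connected_component (- (A1 \<union> A3)) z b"
    proof (intro allI impI)
      fix z assume "z \<in> - (A1 \<union> A3)" "z \<notin> C"
      then have "z \<in> D" using IK(3) that by blast
      then show "connected_component (- (A1 \<union> A3)) z b"
        using \<open>b \<in> D\<close> IK that unfolding connected_component_def by (intro exI[of _ D]) auto
    qed
  qed
  have "A2 - {x, y} \<subseteq> I \<or> A2 - {x, y} \<subseteq> K"
  proof -
    have "\<exists>C. C \<in> components (- (A1 \<union> A3)) \<and> A2 - {x, y} \<subseteq> C"
      by (rule exists_component_superset) (use sub ic in auto)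
    then show ?thesis using IK(1) by auto
  qed
  moreover have "I \<noteq> K" using IK(1,2) in_components_nonempty[of I "- (A1 \<union> A3)"] by auto
  ultimately show ?thesis using *[of K I] *[of I K] by blast
qed

text \<open>Two of the three Jordan curves of a theta curve meet in an arc, so Janiszewski's theorem shows that
  the sides of these two curves already determine the component of the complement.\<close>

lemma theta_split:
  assumes a1: "arc_set x y A1" and a2: "arc_set x y A2" and a3: "arc_set x y A3"
    and i12: "A1 \<inter> A2 = {x, y}" and i13: "A1 \<inter> A3 = {x, y}" and i23: "A2 \<inter> A3 = {x, y}"
    and R: "R \<in> components (- (A1 \<union> A2))" and A3R: "A3 - {x, y} \<subseteq> R"
  obtains R1 R2 where "open R1" "open R2" "connected R1" "connected R2" "R1 \<noteq> {}" "R2 \<noteq> {}"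
    "R1 \<inter> R2 = {}" "R1 \<union> R2 = R - A3" "frontier R1 = A1 \<union> A3" "frontier R2 = A2 \<union> A3"
proof -
  have j12: "jordan_set (A1 \<union> A2)" and j13: "jordan_set (A1 \<union> A3)" and j23: "jordan_set (A2 \<union> A3)"
    using jordan_set_join[OF a1 a2 i12] jordan_set_join[OF a1 a3 i13] jordan_set_join[OF a2 a3 i23] by auto
  obtain R1 where R1: "R1 \<in> components (- (A1 \<union> A3))" "R1 \<inter> A2 = {}"
     "\<And>b z. b \<in> - (A1 \<union> A3) \<Longrightarrow> b \<notin> R1 \<Longrightarrow> z \<in> - (A1 \<union> A3) \<Longrightarrow> z \<notin> R1 \<Longrightarrow> connected_component (- (A1 \<union> A3)) z b"
    by (rule theta_split_aux[OF a1 a2 a3 i12 i13 i23]) blast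
  have i21: "A2 \<inter> A1 = {x, y}" using i12 by auto
  obtain R2 where R2: "R2 \<in> components (- (A2 \<union> A3))" "R2 \<inter> A1 = {}"
    by (rule theta_split_aux[OF a2 a1 a3 i21 i23 i13]) blast
  \<comment> \<open>The side of \<open>A1\<close> and \<open>A2\<close> away from \<open>A3\<close>.
    Each of \<open>R1\<close>, \<open>R2\<close>, \<open>R'\<close> avoids all three arcs.\<close>
  obtain R' where R': "R' \<in> components (- (A1 \<union> A2))" "R' \<inter> A3 = {}" "R \<union> R' = - (A1 \<union> A2)" "R \<inter> R' = {}"
  proof -
    obtain I K where IK: "components (- (A1 \<union> A2)) = {I, K}" "I \<inter> K = {}" "I \<union> K = - (A1 \<union> A2)"
      using jordan_set_components[OF j12] by metis
    have *: ?thesis if K: "K \<in> components (- (A1 \<union> A2))" "R \<inter> K = {}" "R \<union> K = - (A1 \<union> A2)" for K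
    proof (rule \<open>\<And>K. \<lbrakk>K \<in> components (- (A1 \<union> A2)); K \<inter> A3 = {}; R \<union> K = - (A1 \<union> A2); R \<inter> K = {}\<rbrakk> \<Longrightarrow> thesis\<close>)
      have "x \<notin> K" "y \<notin> K" using K(3) i12 by blast+
      then show "K \<inter> A3 = {}" using K(2) A3R by blast
    qed (use K in auto)
    have "R = I \<or> R = K" using R IK(1) by simp
    then show ?thesis using *[of K] *[of I] IK by (metis Int_commute Un_commute insertI1 insertI2)
  qed
  note ne1 = arc_set_interior(2)[OF a1] and ne2 = arc_set_interior(2)[OF a2] and ne3 = arc_set_interior(2)[OF a3]
  have f: "frontier R = A1 \<union> A2" "frontier R' = A1 \<union> A2" "frontier R1 = A1 \<union> A3" "frontier R2 = A2 \<union> A3"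
    using jordan_set_frontier[OF j12 R] jordan_set_frontier[OF j12 R'(1)]
      jordan_set_frontier[OF j13 R1(1)] jordan_set_frontier[OF j23 R2(1)] by auto
  obtain z1 z2 z3 where "z1 \<in> A1 - {x, y}" "z2 \<in> A2 - {x, y}" "z3 \<in> A3 - {x, y}"
    using ne1 ne2 ne3 by blast
  then have "z1 \<in> A1" "z1 \<notin> A2" "z1 \<notin> A3" "z2 \<in> A2" "z2 \<notin> A1" "z2 \<notin> A3"
    using i12 i13 i23 by blast+
  then have d: "A1 \<union> A2 \<noteq> A1 \<union> A3" "A1 \<union> A2 \<noteq> A2 \<union> A3" "A1 \<union> A3 \<noteq> A2 \<union> A3"
    by blast+
  have con: "connected R1" "connected R2" "connected R'" using R1(1) R2(1) R'(1) in_components_connected by auto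
  have nonempty: "R1 \<noteq> {}" "R2 \<noteq> {}" "R' \<noteq> {}" using R1(1) R2(1) R'(1) in_components_nonempty by auto
  have sub: "R1 \<subseteq> - (A1 \<union> A2 \<union> A3)" "R2 \<subseteq> - (A1 \<union> A2 \<union> A3)" "R' \<subseteq> - (A1 \<union> A2 \<union> A3)"
    using R1 R2 R' in_components_subset by blast+
  \<comment> \<open>Two such regions that meet contain each other, both being maximal connected
    sets; but their frontiers differ.\<close>
  have disj: "P \<inter> Q = {}" if "P \<in> components (- X)" "Q \<in> components (- Y)" "P \<subseteq> - Y" "Q \<subseteq> - X"
      "frontier P \<noteq> frontier Q" for P Q X Y :: "complex set"
  proof (rule ccontr)
    assume "P \<inter> Q \<noteq> {}"
    then have "P \<subseteq> Q" using that components_maximal[OF that(2)] in_components_connected[OF that(1)] by blast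
    moreover have "Q \<subseteq> P" using \<open>P \<inter> Q \<noteq> {}\<close> that components_maximal[OF that(1)] in_components_connected[OF that(2)] by blast
    ultimately show False using that(5) subset_antisym by metis
  qed
  have sub': "R1 \<subseteq> - (A1 \<union> A2)" "R1 \<subseteq> - (A2 \<union> A3)" "R2 \<subseteq> - (A1 \<union> A2)" "R2 \<subseteq> - (A1 \<union> A3)"
    "R' \<subseteq> - (A1 \<union> A3)" "R' \<subseteq> - (A2 \<union> A3)"
    using sub by blast+
  have d1: "R1 \<inter> R' = {}" by (rule disj[OF R1(1) R'(1) sub'(1,5)]) (simp_all only: f d d[symmetric] not_False_eq_True)
  have d2: "R2 \<inter> R' = {}" by (rule disj[OF R2(1) R'(1) sub'(3,6)]) (simp_all only: f d d[symmetric] not_False_eq_True)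
  have d3: "R1 \<inter> R2 = {}" by (rule disj[OF R1(1) R2(1) sub'(2,4)]) (simp_all only: f d d[symmetric] not_False_eq_True)
  have in1: "R1 \<subseteq> R - A3" "R2 \<subseteq> R - A3" using d1 d2 sub R'(3) by blast+
  have in2: "R - A3 \<subseteq> R1 \<union> R2"
  proof
    fix z assume z: "z \<in> R - A3"
    have "z \<in> R2" if "z \<notin> R1"
    proof -
      obtain b where b: "b \<in> R2" using nonempty by blast
      have zz: "z \<in> - (A1 \<union> A2)" using z R in_components_subset by blast
      \<comment> \<open>\<open>z\<close> and \<open>b\<close> are joined off one curve inside
        \<open>R\<close>, and off the other outside \<open>R1\<close>. The two curves meet in the
        connected set \<open>A1\<close>.\<close>
      have c12: "connected_component (- (A1 \<union> A2)) z b"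
        unfolding connected_component_def
      proof (intro exI conjI)
        show "connected R" "R \<subseteq> - (A1 \<union> A2)" using R in_components_connected in_components_subset by blast+
        show "z \<in> R" "b \<in> R" using z b in1 by blast+
      qed
      have c13: "connected_component (- (A1 \<union> A3)) z b"
      proof (rule R1(3))
        show "b \<in> - (A1 \<union> A3)" "b \<notin> R1" using b d3 sub(2) by blast+
        show "z \<in> - (A1 \<union> A3)" "z \<notin> R1" using z zz that by blast+
      qed
      have i: "(A1 \<union> A2) \<inter> (A1 \<union> A3) = A1" using i12 i13 i23 by blast
      have "connected ((A1 \<union> A2) \<inter> (A1 \<union> A3))" unfolding i by (rule arc_set_interior(3)[OF a1])
      then have "connected_component (- ((A1 \<union> A2) \<union> (A1 \<union> A3))) z b"
        by (rule Janiszewski[OF jordan_set_compact[OF j12] jordan_set_closed[OF j13] _ c12 c13])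
      then obtain T where T: "connected T" "T \<subseteq> - ((A1 \<union> A2) \<union> (A1 \<union> A3))" "z \<in> T" "b \<in> T"
        unfolding connected_component_def by blast
      have "T \<subseteq> R2" by (rule components_maximal[OF R2(1) T(1)]) (use T b in blast)+
      then show "z \<in> R2" using T by blast
    qed
    then show "z \<in> R1 \<union> R2" by blast
  qed
  have "open (- (A1 \<union> A3))" "open (- (A2 \<union> A3))"
    by (rule open_Compl, rule jordan_set_closed, fact)+
  then have op: "open R1" "open R2"
    using open_components R1(1) R2(1) by blast+
  have "R1 \<union> R2 = R - A3" using in1 in2 by blast
  then show ?thesis by (rule that[OF op con(1,2) nonempty(1,2) d3 _ f(3,4)])
qed

section \<open>Paths and cycles as lists\<close>

fun pedges :: "'a list \<Rightarrow> 'a set set" where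
  "pedges (x # y # r) = insert {x, y} (pedges (y # r))"
| "pedges _ = {}"

abbreviation cedges :: "'a list \<Rightarrow> 'a set set" where
  "cedges c \<equiv> edges (cycle_graph c)"

lemma pedges_nth: "pedges xs = {{xs ! i, xs ! Suc i} | i. Suc i < length xs}"
proof (induction xs rule: pedges.induct)
  case (1 x y r)
  have "{{(x # y # r) ! i, (x # y # r) ! Suc i} | i. Suc i < length (x # y # r)}
      = insert {x, y} {{(y # r) ! i, (y # r) ! Suc i} | i. Suc i < length (y # r)}" (is "?L = ?R")
  proof
    show "?L \<subseteq> ?R"
    proof
      fix e assume "e \<in> ?L"
      then obtain i where i: "e = {(x # y # r) ! i, (x # y # r) ! Suc i}" "Suc i < length (x # y # r)" by blast
      then show "e \<in> ?R" by (cases i) auto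
    qed
    show "?R \<subseteq> ?L"
    proof
      fix e assume "e \<in> ?R"
      then consider "e = {x, y}" | i where "e = {(y # r) ! i, (y # r) ! Suc i}" "Suc i < length (y # r)" by blast
      then show "e \<in> ?L"
      proof cases
        case 1 then show ?thesis by (auto intro!: exI[of _ 0])
      next
        case (2 i) then show ?thesis by (auto intro!: exI[of _ "Suc i"])
      qed
    qed
  qed
  then show ?case using 1 by simp
qed auto

lemma pedges_append: "pedges (xs @ y # ys) = pedges (xs @ [y]) \<union> pedges (y # ys)"
proof (induction xs)
  case (Cons x xs) then show ?case by (cases xs) auto
qed auto

lemma pedges_rev: "pedges (rev xs) = pedges xs"
proof (induction xs rule: pedges.induct)
  case (1 x y r)
  have "pedges (rev (x # y # r)) = pedges (rev r @ [y]) \<union> pedges [y, x]"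
    using pedges_append[of "rev r" y "[x]"] by simp
  then show ?case using 1 by (auto simp: insert_commute)
qed auto

lemma Union_pedges: "\<Union>(pedges xs) = (if length xs \<ge> 2 then set xs else {})"
  by (induction xs rule: pedges.induct) (auto split: if_splits simp: numeral_2_eq_2 Suc_le_eq)

lemma pedges_subset: "e \<in> pedges xs \<Longrightarrow> e \<subseteq> set xs"
  using Union_pedges[of xs] by (auto split: if_splits)

lemma finite_pedges [simp]: "finite (pedges xs)"
  by (induction xs rule: pedges.induct) auto

lemma pedges_card2: "distinct xs \<Longrightarrow> e \<in> pedges xs \<Longrightarrow> card e = 2"
  by (induction xs rule: pedges.induct) (auto simp: card_insert_if)

lemma card_pedges: "distinct xs \<Longrightarrow> card (pedges xs) = length xs - 1"
proof (induction xs rule: pedges.induct)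
  case (1 x y r)
  then have "{x, y} \<notin> pedges (y # r)" using pedges_subset[of "{x, y}" "y # r"] by auto
  then show ?case using 1 by simp
qed auto

lemma pedges_degree:
  assumes "distinct xs" "length xs \<ge> 2"
  shows "card {e \<in> pedges xs. v \<in> e} = (if v \<notin> set xs then 0 else if v = hd xs \<or> v = last xs then 1 else 2)"
  using assms
proof (induction xs rule: pedges.induct)
  case (1 x y r)
  show ?case
  proof (cases r)
    case Nil
    have *: "{e. e = {x, y} \<and> v \<in> e} = (if v \<in> {x, y} then {{x, y}} else {})" by auto
    show ?thesis using 1 Nil by (auto simp: * insert_commute)
  next
    case (Cons z s)
    have n: "{x, y} \<notin> pedges (y # r)" using 1 pedges_subset[of "{x, y}" "y # r"] by auto
    have "{e \<in> pedges (x # y # r). v \<in> e} =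
        (if v \<in> {x, y} then insert {x, y} {e \<in> pedges (y # r). v \<in> e} else {e \<in> pedges (y # r). v \<in> e})"
      by auto
    then have "card {e \<in> pedges (x # y # r). v \<in> e} = (if v \<in> {x, y} then 1 else 0) + card {e \<in> pedges (y # r). v \<in> e}"
      using n by simp
    also have "card {e \<in> pedges (y # r). v \<in> e} =
       (if v \<notin> set (y # r) then 0 else if v = hd (y # r) \<or> v = last (y # r) then 1 else 2)"
      using 1 Cons by simp
    finally have eq: "card {e \<in> pedges (x # y # r). v \<in> e} = (if v \<in> {x, y} then 1 else 0) +
       (if v \<notin> set (y # r) then 0 else if v = hd (y # r) \<or> v = last (y # r) then 1 else 2)" .
    have "last r \<in> set r" "last r \<noteq> x" "last r \<noteq> y" using 1(2) Cons last_in_set[of r] by auto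
    then show ?thesis unfolding eq using 1(2) Cons by auto
  qed
qed auto

text \<open>An end of a path has only one path edge. This keeps a corner shared by two faces away
  from the ends of an ear.\<close>

lemma pedges_two_edges:
  assumes "distinct xs" "e1 \<in> pedges xs" "e2 \<in> pedges xs" "e1 \<noteq> e2" "v \<in> e1" "v \<in> e2"
  shows "v \<in> set xs" "v \<noteq> hd xs" "v \<noteq> last xs"
proof -
  have l: "length xs \<ge> 2" using assms(2) by (cases xs rule: pedges.cases) auto
  have "card {e1, e2} \<le> card {e \<in> pedges xs. v \<in> e}" using assms by (intro card_mono) auto
  then have "2 \<le> card {e \<in> pedges xs. v \<in> e}" using assms by simp
  then show "v \<in> set xs" "v \<noteq> hd xs" "v \<noteq> last xs"
    unfolding pedges_degree[OF assms(1) l] by (auto split: if_splits)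
qed

lemma cedges_eq_pedges: "c \<noteq> [] \<Longrightarrow> cedges c = insert {last c, hd c} (pedges c)"
proof -
  assume c: "c \<noteq> []"
  have "{{c ! i, c ! (Suc i mod length c)} | i. i < length c}
      = insert {last c, hd c} {{c ! i, c ! Suc i} | i. Suc i < length c}" (is "?L = ?R")
  proof
    show "?L \<subseteq> ?R"
    proof
      fix e assume "e \<in> ?L"
      then obtain i where i: "e = {c ! i, c ! (Suc i mod length c)}" "i < length c" by blast
      show "e \<in> ?R"
      proof (cases "Suc i = length c")
        case True
        then have "i = length c - 1" by simp
        then show ?thesis using i c True by (simp add: last_conv_nth hd_conv_nth)
      next
        case False then show ?thesis using i by auto
      qed
    qed
    show "?R \<subseteq> ?L"
    proof
      fix e assume "e \<in> ?R"
      then consider "e = {last c, hd c}" | i where "e = {c ! i, c ! Suc i}" "Suc i < length c" by blast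
      then show "e \<in> ?L"
      proof cases
        case 1 then show ?thesis using c
          by (auto intro!: exI[of _ "length c - 1"] simp: last_conv_nth hd_conv_nth)
      next
        case (2 i) then show ?thesis by (auto intro!: exI[of _ i])
      qed
    qed
  qed
  then show ?thesis by (simp add: cycle_graph_def pedges_nth)
qed

lemma cedges_split: "cedges (a # A @ b # B) = pedges (a # A @ [b]) \<union> pedges (b # B @ [a])"
proof -
  have "cedges (a # A @ b # B) = insert {last (b # B), a} (pedges (a # A @ b # B))"
    by (subst cedges_eq_pedges) auto
  also have "pedges (a # A @ b # B) = pedges (a # A @ [b]) \<union> pedges (b # B)"
    using pedges_append[of "a # A" b B] by simp
  finally have 1: "cedges (a # A @ b # B) = pedges (a # A @ [b]) \<union> insert {last (b # B), a} (pedges (b # B))" by auto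
  have "pedges (b # B @ [a]) = insert {last (b # B), a} (pedges (b # B))"
  proof (cases B rule: rev_cases)
    case (snoc C z)
    then show ?thesis using pedges_append[of "b # C" z "[a]"] by auto
  qed auto
  then show ?thesis using 1 by simp
qed

lemma cedges_Cons: "cedges (a # A) = pedges (a # A @ [a])"
proof (cases A rule: rev_cases)
  case Nil then show ?thesis by (simp add: cedges_eq_pedges)
next
  case (snoc C z)
  then show ?thesis
    using pedges_append[of "a # C" z "[a]"] by (auto simp: cedges_eq_pedges)
qed

lemma finite_cedges [simp]: "finite (cedges c)"
  by (cases c) (auto simp: cedges_Cons, simp add: cycle_graph_def)

lemma cedges_rotate1: "cedges (a # A) = cedges (A @ [a])"
proof (cases A)
  case (Cons b B)
  then show ?thesis using cedges_split[of a "[]" b B] cedges_split[of b B a "[]"] by (simp add: Un_commute)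
qed auto

lemma cedges_rotate: "cedges (A @ B) = cedges (B @ A)"
proof (induction A arbitrary: B)
  case (Cons a A)
  then show ?case using cedges_rotate1[of a "A @ B"] Cons[of "B @ [a]"] by simp
qed auto

lemma cedges_rev: "cedges (rev c) = cedges c"
proof (cases c)
  case (Cons a A)
  have "pedges (rev (a # A @ [a])) = pedges (a # A @ [a])" by (rule pedges_rev)
  then have "cedges (a # rev A) = cedges (a # A)" by (simp add: cedges_Cons)
  then show ?thesis using Cons cedges_rotate1[of a "rev A"] by simp
qed auto

lemma Union_cedges: "\<Union>(cedges c) = set c"
proof (cases c)
  case (Cons a A)
  then show ?thesis using Union_pedges[of "a # A @ [a]"] by (simp add: cedges_Cons)
qed (simp add: cycle_graph_def)

lemma cedges_degree:
  assumes "distinct c" "length c \<ge> 3" "v \<in> set c"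
  shows "card {e \<in> cedges c. v \<in> e} = 2"
proof -
  obtain A B where AB: "c = A @ v # B" using assms(3) split_list by metis
  then have eq: "cedges c = cedges (v # B @ A)" using cedges_rotate[of A "v # B"] by simp
  define D where "D = B @ A"
  have D: "distinct (v # D)" "length D \<ge> 2" using assms AB D_def by auto
  then obtain x y C where DC: "D = x # C @ [y]"
    by (cases D; cases "tl D" rule: rev_cases) auto
  have "cedges c = cedges (v # (x # C) @ y # [])" using eq by (simp only: D_def[symmetric] DC) simp
  also have "\<dots> = insert {v, x} (insert {y, v} (pedges (x # C @ [y])))"
    unfolding cedges_split by auto
  finally have "{e \<in> cedges c. v \<in> e} = {{v, x}, {y, v}} \<union> {e \<in> pedges (x # C @ [y]). v \<in> e}" by auto
  moreover have "{e \<in> pedges (x # C @ [y]). v \<in> e} = {}" using D DC pedges_subset by fastforce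
  moreover have "{v, x} \<noteq> {y, v}" using D DC by (auto simp: doubleton_eq_iff)
  ultimately show ?thesis by simp
qed

lemma card_cedges:
  assumes "distinct c" "length c \<ge> 3"
  shows "card (cedges c) = length c"
proof -
  obtain v x C y where DC: "c = v # x # C @ [y]"
    using assms(2) by (cases c; cases "tl c"; cases "tl (tl c)" rule: rev_cases) auto
  have "cedges c = insert {y, v} (pedges (v # x # C @ [y]))"
    using DC by (simp add: cedges_eq_pedges)
  moreover have "{y, v} \<notin> pedges (v # x # C @ [y])"
  proof
    assume "{y, v} \<in> pedges (v # x # C @ [y])"
    then have "{y, v} \<in> pedges (x # C @ [y]) \<or> {y, v} = {v, x}" by auto
    then show False using pedges_subset[of "{y, v}" "x # C @ [y]"] assms(1) DC by (auto simp: doubleton_eq_iff)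
  qed
  ultimately show ?thesis using card_pedges[of c] assms(1) DC by simp
qed

lemma cedges_card2: "distinct c \<Longrightarrow> length c \<ge> 2 \<Longrightarrow> e \<in> cedges c \<Longrightarrow> card e = 2"
proof -
  assume c: "distinct c" "length c \<ge> 2" "e \<in> cedges c"
  then obtain a x C where "c = a # C @ [x]" by (cases c; cases "tl c" rule: rev_cases) auto
  then show ?thesis using c pedges_card2[of c e] by (auto simp: cedges_eq_pedges card_insert_if)
qed

lemma cycle_at_two:
  assumes "distinct c" "a \<in> set c" "b \<in> set c" "a \<noteq> b"
  obtains A B where "cedges (a # A @ b # B) = cedges c" "distinct (a # A @ b # B)"
    "set (a # A @ b # B) = set c" "length (a # A @ b # B) = length c"
proof -
  obtain X Y where XY: "c = X @ a # Y" using assms(2) split_list by metis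
  then have "b \<in> set (Y @ X)" using assms by auto
  then obtain A B where AB: "Y @ X = A @ b # B" using split_list by metis
  have "cedges (a # A @ b # B) = cedges c" using XY cedges_rotate[of X "a # Y"] AB by simp
  moreover have "mset (a # A @ b # B) = mset c" using XY AB[symmetric] by simp
  ultimately show ?thesis
    using that assms(1) mset_eq_imp_distinct_iff mset_eq_setD mset_eq_length by metis
qed

text \<open>Cutting the cycle at \<open>u\<close> and \<open>v\<close> leaves two arcs. If both had
  inner vertices, \<open>uv\<close> would be a chord and not an edge of the cycle. If the second arc
  is the one without inner vertices, the list is reversed.\<close>

lemma cycle_at_edge:
  assumes "distinct c" "length c \<ge> 3" "{u, v} \<in> cedges c"
  obtains r where "cedges (u # v # r) = cedges c" "distinct (u # v # r)"
    "set (u # v # r) = set c" "length (u # v # r) = length c"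
proof -
  have uv: "u \<noteq> v" using cedges_card2[OF assms(1) _ assms(3)] assms(2) by auto
  have "u \<in> set c" "v \<in> set c" using Union_cedges[of c] assms(3) by auto
  then obtain A B where AB: "cedges (u # A @ v # B) = cedges c" "distinct (u # A @ v # B)"
    "set (u # A @ v # B) = set c" "length (u # A @ v # B) = length c"
    using cycle_at_two[OF assms(1)] uv by metis
  have "A = [] \<or> B = []"
  proof (rule ccontr)
    assume "\<not> ?thesis"
    then obtain x A' y B' where "A = x # A'" "B = y # B'" by (meson neq_Nil_conv)
    then have "{u, v} \<in> pedges (u # x # A' @ [v]) \<union> pedges (v # y # B' @ [u])"
      using assms(3) AB(1) cedges_split[of u A v B] by simp
    then show False using AB(2) \<open>A = x # A'\<close> \<open>B = y # B'\<close>
        pedges_subset[of "{u, v}" "x # A' @ [v]"] pedges_subset[of "{u, v}" "y # B' @ [u]"]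
      by (auto simp: doubleton_eq_iff)
  qed
  then show ?thesis
  proof
    assume "A = []" then show ?thesis using AB that by simp
  next
    assume B: "B = []"
    have "cedges (u # v # rev A) = cedges (rev (u # v # rev A))" by (rule cedges_rev[symmetric])
    also have "rev (u # v # rev A) = (A @ [v]) @ [u]" by simp
    also have "cedges \<dots> = cedges (u # A @ [v])" using cedges_rotate1[of u "A @ [v]"] by simp
    finally show ?thesis using AB B by (intro that[of "rev A"]) auto
  qed
qed

lemma is_cycle_iff:
  "is_cycle G c \<longleftrightarrow> 3 \<le> length c \<and> distinct c \<and> set c \<subseteq> verts G \<and> cedges c \<subseteq> edges G"
  by (simp add: is_cycle_def) (simp add: cycle_graph_def)

lemma is_cycleI:
  assumes "simple_graph G" "3 \<le> length c" "distinct c" "cedges c \<subseteq> edges G"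
  shows "is_cycle G c"
proof -
  have "set c \<subseteq> verts G" using assms Union_cedges[of c] unfolding simple_graph_def by blast
  then show ?thesis using assms by (simp add: is_cycle_iff)
qed

section \<open>Face structures and ears\<close>

text \<open>\<open>R\<close> and the complement of its closure would separate any larger connected
  subset of \<open>X\<close>. It turns a face of the whole drawing into a side of its boundary curve
  alone.\<close>

lemma component_if_frontier:
  fixes R :: "'a::topological_space set"
  assumes "open R" "connected R" "R \<noteq> {}" "R \<subseteq> X" "frontier R \<inter> X = {}"
  shows "R \<in> components X"
  unfolding in_components_maximal
proof (intro conjI allI impI)
  fix D assume D: "D \<noteq> {} \<and> R \<subseteq> D \<and> D \<subseteq> X \<and> connected D"
  have "open (- closure R)" by auto
  moreover have "D \<subseteq> R \<union> - closure R"
    using D assms(1,5) by (auto simp: frontier_def interior_open)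
  moreover have "R \<inter> - closure R \<inter> D = {}" using closure_subset[of R] by auto
  ultimately have "R \<inter> D = {} \<or> - closure R \<inter> D = {}"
    using connectedD[of D R "- closure R"] D assms(1) by auto
  then have "- closure R \<inter> D = {}" using D assms(3) by blast
  then show "D = R" using \<open>D \<subseteq> R \<union> - closure R\<close> D by blast
qed (use assms in auto)

section \<open>Drawings of sets of edges\<close>

locale plane_drawing =
  fixes G :: "'a ugraph" and p :: "'a \<Rightarrow> complex" and g :: "'a set \<Rightarrow> real \<Rightarrow> complex"
  assumes plane: "plane_graph G p g"
begin

lemma simple: "simple_graph G" and p_inj: "inj_on p (verts G)"
  and arc_edge: "e \<in> edges G \<Longrightarrow> arc (g e)"
  and ends_edge: "e \<in> edges G \<Longrightarrow> {pathstart (g e), pathfinish (g e)} = p ` e"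
  and edge_vertex: "e \<in> edges G \<Longrightarrow> (path_image (g e) - p ` e) \<inter> p ` verts G = {}"
  and edge_edge: "e \<in> edges G \<Longrightarrow> f \<in> edges G \<Longrightarrow> e \<noteq> f \<Longrightarrow> (path_image (g e) - p ` e) \<inter> path_image (g f) = {}"
  using plane unfolding plane_graph_def by simp_all

lemma edge_verts: "e \<in> edges G \<Longrightarrow> e \<subseteq> verts G" and edge_card: "e \<in> edges G \<Longrightarrow> card e = 2"
  and finite_verts: "finite (verts G)"
  using simple unfolding simple_graph_def by blast+

lemma finite_edges: "finite (edges G)"
  using edge_verts finite_verts finite_subset[of "edges G" "Pow (verts G)"] by blast

definition draw :: "'a set set \<Rightarrow> complex set" where
  "draw E = (\<Union>e\<in>E. path_image (g e))"

lemma draw_Un: "draw (A \<union> B) = draw A \<union> draw B"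
  by (auto simp: draw_def)

lemma draw_mono: "A \<subseteq> B \<Longrightarrow> draw A \<subseteq> draw B"
  by (auto simp: draw_def)

lemma closed_draw: "E \<subseteq> edges G \<Longrightarrow> closed (draw E)"
  unfolding draw_def using finite_edges finite_subset closed_arc_image arc_edge
  by (intro closed_UN) blast+

lemma p_in_edge: "e \<in> edges G \<Longrightarrow> v \<in> e \<Longrightarrow> p v \<in> path_image (g e)"
  using ends_edge[of e] pathstart_in_path_image[of "g e"] pathfinish_in_path_image[of "g e"]
  by (metis image_eqI insertE singletonD)

lemma p_in_draw:
  assumes "E \<subseteq> edges G" "v \<in> verts G"
  shows "p v \<in> draw E \<longleftrightarrow> v \<in> \<Union>E"
proof
  assume "p v \<in> draw E"
  then obtain e where e: "e \<in> E" "p v \<in> path_image (g e)" by (auto simp: draw_def)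
  then have "p v \<in> p ` e" using edge_vertex[of e] assms by blast
  then obtain w where w: "w \<in> e" "p v = p w" by blast
  then have "w \<in> verts G" using edge_verts[of e] e assms by blast
  then have "v = w" using inj_onD[OF p_inj w(2) assms(2)] by simp
  then show "v \<in> \<Union>E" using w e by blast
next
  assume "v \<in> \<Union>E"
  then show "p v \<in> draw E" using p_in_edge assms by (fastforce simp: draw_def)
qed

text \<open>This reduces the intersections of curves needed below to intersections of vertex
  sets.\<close>

lemma draw_Int:
  assumes "A \<subseteq> edges G" "B \<subseteq> edges G" "A \<inter> B = {}"
  shows "draw A \<inter> draw B = p ` (\<Union>A \<inter> \<Union>B)"
proof
  show "draw A \<inter> draw B \<subseteq> p ` (\<Union>A \<inter> \<Union>B)"
  proof
    fix z assume "z \<in> draw A \<inter> draw B"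
    then obtain e f where ef: "e \<in> A" "f \<in> B" "z \<in> path_image (g e)" "z \<in> path_image (g f)"
      by (auto simp: draw_def)
    then have "z \<in> p ` e" using edge_edge[of e f] assms by blast
    then obtain v where v: "v \<in> e" "z = p v" by blast
    have vv: "v \<in> verts G" using v edge_verts[of e] ef assms by blast
    have "p v \<in> draw B" using ef v by (auto simp: draw_def)
    then have "v \<in> \<Union>B" using p_in_draw[OF assms(2) vv] by blast
    then show "z \<in> p ` (\<Union>A \<inter> \<Union>B)" using v ef by blast
  qed
  show "p ` (\<Union>A \<inter> \<Union>B) \<subseteq> draw A \<inter> draw B"
  proof
    fix z assume "z \<in> p ` (\<Union>A \<inter> \<Union>B)"
    then obtain v e f where v: "z = p v" "v \<in> e" "e \<in> A" "v \<in> f" "f \<in> B" by blast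
    then show "z \<in> draw A \<inter> draw B" using p_in_edge assms unfolding draw_def by blast
  qed
qed

lemma arc_draw:
  assumes "distinct xs" "length xs \<ge> 2" "pedges xs \<subseteq> edges G"
  shows "arc_set (p (hd xs)) (p (last xs)) (draw (pedges xs))"
  using assms
proof (induction xs rule: pedges.induct)
  case (1 x y r)
  have e: "{x, y} \<in> edges G" using 1 by simp
  have *: "arc_set (p x) (p y) (path_image (g {x, y}))"
  proof -
    have "{pathstart (g {x, y}), pathfinish (g {x, y})} = {p x, p y}" using ends_edge[OF e] by simp
    then have "pathstart (g {x, y}) = p x \<and> pathfinish (g {x, y}) = p y
       \<or> pathstart (g {x, y}) = p y \<and> pathfinish (g {x, y}) = p x" by (auto simp: doubleton_eq_iff)
    then show ?thesis using arc_edge[OF e] arc_set_sym unfolding arc_set_def by blast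
  qed
  show ?case
  proof (cases r)
    case Nil then show ?thesis using * by (simp add: draw_def)
  next
    case (Cons z s)
    have n: "{x, y} \<notin> pedges (y # r)" using 1 pedges_subset[of "{x, y}" "y # r"] by auto
    have "draw {{x, y}} \<inter> draw (pedges (y # r)) = p ` (\<Union>{{x, y}} \<inter> \<Union>(pedges (y # r)))"
      by (rule draw_Int) (use 1 n in auto)
    also have "\<Union>{{x, y}} \<inter> \<Union>(pedges (y # r)) = {y}"
      using 1(2) Cons by (auto simp: Union_pedges)
    finally have i: "path_image (g {x, y}) \<inter> draw (pedges (y # r)) = {p y}" by (simp add: draw_def)
    have "arc_set (p y) (p (last (y # r))) (draw (pedges (y # r)))" using 1 Cons by simp
    from arc_set_join[OF * this i] show ?thesis using Cons
      by (simp add: draw_def)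
  qed
qed auto

text \<open>A face is a component of the complement, and \<open>cyc\<close> names the cycle bounding it. The clause on two
  faces sharing two edges at a vertex is the only information about rotations that the discharging needs.\<close>

definition face_struct :: "'a set set \<Rightarrow> complex set set \<Rightarrow> (complex set \<Rightarrow> 'a list) \<Rightarrow> bool" where
  "face_struct E F cyc \<longleftrightarrow>
     E \<subseteq> edges G \<and> F = components (- draw E) \<and> finite F \<and>
     (\<forall>R\<in>F. is_cycle G (cyc R) \<and> cedges (cyc R) \<subseteq> E \<and> frontier R = draw (cedges (cyc R))) \<and>
     (\<forall>e\<in>E. card {R \<in> F. e \<in> cedges (cyc R)} = 2) \<and>
     (\<forall>R\<in>F. \<forall>S\<in>F. R \<noteq> S \<longrightarrow> (\<forall>e1 e2 v. e1 \<noteq> e2 \<longrightarrow> v \<in> e1 \<longrightarrow> v \<in> e2 \<longrightarrow>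
        e1 \<in> cedges (cyc R) \<inter> cedges (cyc S) \<longrightarrow> e2 \<in> cedges (cyc R) \<inter> cedges (cyc S) \<longrightarrow>
        card {e \<in> E. v \<in> e} = 2)) \<and>
     card (\<Union>E) + card F = card E + 2"

text \<open>Inside and outside of the curve are the two faces, both with boundary list
  \<open>c\<close>. Every vertex has degree 2 here, as the clause on shared corners demands.\<close>

lemma face_struct_cycle:
  assumes "is_cycle G c"
  shows "\<exists>F cyc. face_struct (cedges c) F cyc"
proof -
  have c: "3 \<le> length c" "distinct c" "set c \<subseteq> verts G" "cedges c \<subseteq> edges G"
    using assms by (auto simp: is_cycle_iff)
  obtain a b r where abr: "c = a # b # r" "r \<noteq> []" using c(1) by (cases c; cases "tl c"; cases "tl (tl c)") auto
  have s: "cedges c = pedges [a, b] \<union> pedges (b # r @ [a])"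
    using cedges_split[of a "[]" b r] abr by simp
  have arcs: "arc_set (p a) (p b) (draw (pedges [a, b]))" "arc_set (p b) (p a) (draw (pedges (b # r @ [a])))"
    using arc_draw[of "[a, b]"] arc_draw[of "b # r @ [a]"] c s abr by auto
  have "{a, b} \<notin> pedges (b # r @ [a])"
    using pedges_two_edges[of "b # r @ [a]"] c abr
  proof -
    obtain x y where "r = x # y" using abr(2) by (cases r) auto
    then show ?thesis using c abr pedges_subset[of "{a, b}" "x # y @ [a]"] by (auto simp: doubleton_eq_iff)
  qed
  then have "draw (pedges [a, b]) \<inter> draw (pedges (b # r @ [a])) = p ` (\<Union>(pedges [a, b]) \<inter> \<Union>(pedges (b # r @ [a])))"
    by (intro draw_Int) (use c s in auto)
  also have "\<Union>(pedges [a, b]) \<inter> \<Union>(pedges (b # r @ [a])) = {a, b}"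
    by (auto simp: Union_pedges)
  finally have "jordan_set (draw (cedges c))"
    unfolding s draw_Un using arcs by (intro jordan_set_join[of "p a" "p b"] arc_set_sym[of "p b" "p a" "draw (pedges (b # r @ [a]))"]) auto
  then obtain I K where IK: "components (- draw (cedges c)) = {I, K}" "I \<noteq> K"
    "frontier I = draw (cedges c)" "frontier K = draw (cedges c)"
    using jordan_set_components by metis
  have "face_struct (cedges c) {I, K} (\<lambda>_. c)"
    unfolding face_struct_def
  proof (intro conjI ballI impI allI)
    fix e assume "e \<in> cedges c"
    then have "{R \<in> {I, K}. e \<in> cedges c} = {I, K}" by auto
    then show "card {R \<in> {I, K}. e \<in> cedges c} = 2" using IK by simp
  next
    fix e1 v assume "e1 \<in> cedges c \<inter> cedges c" "v \<in> e1"
    then show "card {e \<in> cedges c. v \<in> e} = 2" using cedges_degree[of c v] c Union_cedges[of c] by auto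
  next
    show "card (\<Union>(cedges c)) + card {I, K} = card (cedges c) + 2"
      using Union_cedges[of c] card_cedges[of c] c IK distinct_card[of c] by simp
  qed (use c IK assms in auto)
  then show ?thesis by blast
qed

text \<open>The ear runs inside one face \<open>R\<close>, and its ends cut the boundary cycle of
  \<open>R\<close> into the paths \<open>?A\<close> and \<open>?B\<close>. With the ear as third arc
  this is a theta curve, so \<open>R\<close> is replaced by two faces, bounded by \<open>?A\<close>
  and the ear and by \<open>?B\<close> and the ear. For Euler's formula: \<open>length I\<close> new
  vertices, one more new edge than that, and one more face.\<close>

lemma face_struct_ear:
  assumes fs: "face_struct E F cyc"
    and P: "distinct (a # I @ [b])" "pedges (a # I @ [b]) \<subseteq> edges G - E"
    and ab: "a \<in> \<Union>E" "b \<in> \<Union>E" and I: "set I \<inter> \<Union>E = {}"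
  shows "\<exists>F' cyc'. face_struct (E \<union> pedges (a # I @ [b])) F' cyc'"
proof -
  let ?P = "a # I @ [b]"
  define X where "X = draw (pedges ?P)"
  have E: "E \<subseteq> edges G" "F = components (- draw E)" "finite F"
    and cyc: "\<And>R. R \<in> F \<Longrightarrow> is_cycle G (cyc R) \<and> cedges (cyc R) \<subseteq> E \<and> frontier R = draw (cedges (cyc R))"
    and two: "\<And>e. e \<in> E \<Longrightarrow> card {R \<in> F. e \<in> cedges (cyc R)} = 2"
    and euler: "card (\<Union>E) + card F = card E + 2"
    using fs unfolding face_struct_def by - (elim conjE, (assumption | (erule bspec, assumption)))+
  have rot: "card {e \<in> E. v \<in> e} = 2"
    if "R \<in> F" "S \<in> F" "R \<noteq> S" "e1 \<noteq> e2" "v \<in> e1" "v \<in> e2"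
        "e1 \<in> cedges (cyc R)" "e1 \<in> cedges (cyc S)" "e2 \<in> cedges (cyc R)" "e2 \<in> cedges (cyc S)" for R S e1 e2 v
    using fs that unfolding face_struct_def by (elim conjE) blast
  have PG: "pedges ?P \<subseteq> edges G" "pedges ?P \<inter> E = {}" using P(2) by auto
  have UP: "\<Union>(pedges ?P) = set ?P" by (simp add: Union_pedges)
  have abv: "a \<in> verts G" "b \<in> verts G" using ab E edge_verts by blast+
  have arcX: "arc_set (p a) (p b) X" unfolding X_def using arc_draw[of ?P] P PG by simp
  have "draw E \<inter> X = p ` (\<Union>E \<inter> \<Union>(pedges ?P))" unfolding X_def
    by (rule draw_Int) (use E PG in auto)
  also have "\<Union>E \<inter> \<Union>(pedges ?P) = {a, b}" unfolding UP using ab I by auto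
  finally have EX: "draw E \<inter> X = {p a, p b}" by simp
  have "\<exists>R. R \<in> F \<and> X - {p a, p b} \<subseteq> R" unfolding E(2)
    by (rule exists_component_superset) (use EX arc_set_interior[OF arcX] in auto)
  then obtain R where R: "R \<in> F" "X - {p a, p b} \<subseteq> R" by blast
  have opE: "open (- draw E)" using closed_draw[OF E(1)] by auto
  have Fop: "open S" "connected S" "S \<noteq> {}" "S \<subseteq> - draw E" if "S \<in> F" for S
    using that open_components[OF opE] in_components_connected in_components_nonempty in_components_subset
    unfolding E(2) by blast+
  have Fdisj: "S \<inter> T = {}" if "S \<in> F" "T \<in> F" "S \<noteq> T" for S T
    using that components_nonoverlap unfolding E(2) by blast
  \<comment> \<open>An end of the ear is a limit of the inside of the ear, which lies in
    \<open>R\<close>, but belongs to the drawing itself; so it is on the frontier of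
    \<open>R\<close>.\<close>
  have inR: "v \<in> set (cyc R)" if "p v \<in> X" "p v \<in> draw E" "v \<in> verts G" for v
  proof -
    have "p v \<in> closure R"
      using that arc_set_interior(5)[OF arcX] closure_mono[OF R(2)] by blast
    moreover have "p v \<notin> interior R" using that Fop(4)[OF R(1)] interior_subset[of R] by auto
    ultimately have "p v \<in> draw (cedges (cyc R))" using cyc[OF R(1)] by (auto simp: frontier_def)
    then have "v \<in> \<Union>(cedges (cyc R))" using p_in_draw[of "cedges (cyc R)" v] cyc[OF R(1)] E that by blast
    then show ?thesis using Union_cedges by metis
  qed
  have cR: "3 \<le> length (cyc R)" "distinct (cyc R)" "cedges (cyc R) \<subseteq> E" "frontier R = draw (cedges (cyc R))"
    using cyc[OF R(1)] by (auto simp: is_cycle_iff)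
  have "p a \<in> X" "p b \<in> X" "p a \<in> draw E" "p b \<in> draw E" using EX by auto
  then have "a \<in> set (cyc R)" "b \<in> set (cyc R)" using inR abv by auto
  moreover have "a \<noteq> b" using P(1) by auto
  ultimately obtain A B where AB: "cedges (a # A @ b # B) = cedges (cyc R)" "distinct (a # A @ b # B)"
    "set (a # A @ b # B) = set (cyc R)" "length (a # A @ b # B) = length (cyc R)"
    using cycle_at_two[OF cR(2)] by metis
  let ?A = "a # A @ [b]" and ?B = "b # B @ [a]"
  have spl: "cedges (cyc R) = pedges ?A \<union> pedges ?B" using cedges_split[of a A b B] AB(1) by simp
  have AE: "pedges ?A \<subseteq> E" and BE: "pedges ?B \<subseteq> E" using cR spl by blast+
  have AB0: "A \<noteq> [] \<or> B \<noteq> []" using cR AB by auto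
  have disjAB: "pedges ?A \<inter> pedges ?B = {}"
  proof (rule ccontr)
    assume "\<not> ?thesis"
    then obtain e where e: "e \<in> pedges ?A" "e \<in> pedges ?B" by blast
    have "e \<subseteq> {a, b}" using pedges_subset[OF e(1)] pedges_subset[OF e(2)] AB(2) by auto
    moreover have "card e = 2" using e AE E edge_card by blast
    ultimately have eab: "e = {a, b}" using \<open>a \<noteq> b\<close> by (intro card_seteq) auto
    have no: "{x, y} \<notin> pedges (x # C @ [y])" if "C \<noteq> []" "distinct (x # C @ [y])" for x y C
    proof -
      obtain z D where "C = z # D" using \<open>C \<noteq> []\<close> by (cases C) auto
      then show ?thesis using that(2) pedges_subset[of "{x, y}" "z # D @ [y]"] by (auto simp: doubleton_eq_iff)
    qed
    show False using AB0 no[of A a b] no[of B b a] AB(2) e eab by (auto simp: insert_commute)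
  qed
  have IAB: "set I \<inter> set (cyc R) = {}"
    using I Union_cedges[of "cyc R"] cR(3) by blast
  define A1 where "A1 = draw (pedges ?A)"
  define A2 where "A2 = draw (pedges ?B)"
  have a1: "arc_set (p a) (p b) A1" unfolding A1_def using arc_draw[of ?A] AB(2) AE E by auto
  have "arc_set (p b) (p a) A2" unfolding A2_def using arc_draw[of ?B] AB(2) BE E by auto
  then have a2: "arc_set (p a) (p b) A2" by (rule arc_set_sym)
  have "A1 \<inter> A2 = p ` (\<Union>(pedges ?A) \<inter> \<Union>(pedges ?B))" unfolding A1_def A2_def
    by (rule draw_Int) (use disjAB AE BE E in auto)
  also have "\<Union>(pedges ?A) \<inter> \<Union>(pedges ?B) = {a, b}" using AB(2) by (auto simp: Union_pedges)
  finally have i12: "A1 \<inter> A2 = {p a, p b}" by simp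
  have i13: "A1 \<inter> X = {p a, p b}" using EX draw_mono[OF AE] i12 unfolding A1_def by blast
  have i23: "A2 \<inter> X = {p a, p b}" using EX draw_mono[OF BE] i12 unfolding A2_def by blast
  have fR: "frontier R = A1 \<union> A2" using cR(4) spl draw_Un unfolding A1_def A2_def by simp
  have "A1 \<union> A2 \<subseteq> draw E" using draw_mono AE BE unfolding A1_def A2_def by blast
  then have "R \<in> components (- (A1 \<union> A2))"
    by (intro component_if_frontier) (use Fop[OF R(1)] fR in auto)
  then obtain R1 R2 where R12: "open R1" "open R2" "connected R1" "connected R2" "R1 \<noteq> {}" "R2 \<noteq> {}"
    "R1 \<inter> R2 = {}" "R1 \<union> R2 = R - X" "frontier R1 = A1 \<union> X" "frontier R2 = A2 \<union> X"
    using theta_split[OF a1 a2 arcX i12 i13 i23 _ R(2)] by blast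
  define F' where "F' = insert R1 (insert R2 (F - {R}))"
  define cyc' where "cyc' = cyc(R1 := a # A @ b # rev I, R2 := b # B @ a # I)"
  have R1F: "R1 \<notin> F - {R}" and R2F: "R2 \<notin> F - {R}" and R1R2: "R1 \<noteq> R2"
    using R12(5-8) Fdisj[OF R(1)] by blast+
  have c1: "cyc' R1 = a # A @ b # rev I" and c2: "cyc' R2 = b # B @ a # I"
    and cF: "\<And>S. S \<in> F - {R} \<Longrightarrow> cyc' S = cyc S"
    using R1F R2F R1R2 by (auto simp: cyc'_def)
  have revP: "pedges (b # rev I @ [a]) = pedges ?P" using pedges_rev[of ?P] by simp
  have e1: "cedges (cyc' R1) = pedges ?A \<union> pedges ?P"
    unfolding c1 cedges_split by (simp only: revP)
  have e2: "cedges (cyc' R2) = pedges ?B \<union> pedges ?P"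
    unfolding c2 cedges_split by simp
  have eF: "cedges (cyc' S) = cedges (cyc S)" "cedges (cyc S) \<subseteq> E" if "S \<in> F - {R}" for S
    using that cF cyc by auto
  \<comment> \<open>If both lists were empty, the ear would be an edge \<open>{a, b}\<close> already
    in \<open>E\<close>. This gives the new boundary cycles length at least 3.\<close>
  have AIne: "A \<noteq> [] \<or> I \<noteq> []" "B \<noteq> [] \<or> I \<noteq> []" using AE BE PG(2) by (auto simp: insert_commute)
  have comp: "components (- draw (E \<union> pedges ?P)) = F'"
  proof (rule components_eqI)
    show "open C \<and> connected C \<and> C \<noteq> {}" if "C \<in> F'" for C
      using that Fop R12 unfolding F'_def by auto
    show "pairwise disjnt F'"
    proof -
      have "disjnt R1 R2" using R12(7) by (simp add: disjnt_def)
      moreover have "disjnt R1 S" "disjnt R2 S" if "S \<in> F - {R}" for S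
        using that Fdisj[OF R(1), of S] R12(8) by (auto simp: disjnt_def)
      moreover have "pairwise disjnt (F - {R})" using Fdisj by (auto simp: pairwise_def disjnt_def)
      ultimately show ?thesis unfolding F'_def pairwise_insert by (metis disjnt_sym insert_iff)
    qed
    have UF: "\<Union>F = - draw E" unfolding E(2) by (rule Union_components)
    have "\<Union>F' = (R - X) \<union> \<Union>(F - {R})" unfolding F'_def using R12(8) by auto
    also have "\<dots> = - draw E - X"
    proof -
      have "S \<inter> X = {}" if "S \<in> F - {R}" for S
        using that Fdisj[OF R(1), of S] R(2) Fop(4)[of S] EX by blast
      then show ?thesis using UF R(1) by blast
    qed
    finally show "\<Union>F' = - draw (E \<union> pedges ?P)" unfolding draw_Un X_def by blast
  qed
  have newface: "card {S \<in> F'. e \<in> cedges (cyc' S)} =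
      (if e \<in> pedges ?A \<union> pedges ?P then 1 else 0) + (if e \<in> pedges ?B \<union> pedges ?P then 1 else 0)
       + card {S \<in> F - {R}. e \<in> cedges (cyc S)}" for e
  proof -
    have "{S \<in> F'. e \<in> cedges (cyc' S)} = (if e \<in> pedges ?A \<union> pedges ?P then {R1} else {})
      \<union> ((if e \<in> pedges ?B \<union> pedges ?P then {R2} else {}) \<union> {S \<in> F - {R}. e \<in> cedges (cyc S)})"
      unfolding F'_def using e1 e2 eF by auto
    moreover have "finite {S \<in> F - {R}. e \<in> cedges (cyc S)}" using E(3) by auto
    ultimately show ?thesis using R1F R2F R1R2 by (auto simp: card_insert_if)
  qed
  have deg: "card {e \<in> E \<union> pedges ?P. v \<in> e} = card {e \<in> E. v \<in> e}" if "v \<in> \<Union>E" "v \<noteq> a" "v \<noteq> b" for v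
  proof -
    have "v \<notin> set ?P" using that I by auto
    then have "{e \<in> E \<union> pedges ?P. v \<in> e} = {e \<in> E. v \<in> e}" using UP by blast
    then show ?thesis by simp
  qed
  have finE: "finite E" using E(1) finite_edges finite_subset by blast
  have oneR: "card {S \<in> F - {R}. e \<in> cedges (cyc S)} = 1" if "e \<in> cedges (cyc R)" for e
  proof -
    have "{S \<in> F. e \<in> cedges (cyc S)} = insert R {S \<in> F - {R}. e \<in> cedges (cyc S)}" using R(1) that by auto
    then show ?thesis using two[of e] that cR(3) E(3) by auto
  qed
  have rotFR: "card {e \<in> E. v \<in> e} = 2 \<and> v \<noteq> a \<and> v \<noteq> b"
    if "S \<in> F - {R}" "f1 \<noteq> f2" "v \<in> f1" "v \<in> f2" "f1 \<in> cedges (cyc S)" "f2 \<in> cedges (cyc S)"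
      "f1 \<in> pedges Q" "f2 \<in> pedges Q" "Q = ?A \<or> Q = ?B" for S f1 f2 v Q
  proof -
    have "f1 \<in> cedges (cyc R)" "f2 \<in> cedges (cyc R)" using that spl by auto
    then have "card {e \<in> E. v \<in> e} = 2" using rot[of S R f1 f2 v] that R(1) by auto
    moreover have "distinct Q" using that(9) AB(2) by auto
    then have "v \<noteq> hd Q" "v \<noteq> last Q" using pedges_two_edges[of Q f1 f2 v] that by auto
    ultimately show ?thesis using that(9) by auto
  qed
  \<comment> \<open>Among the old vertices only \<open>a\<close> and \<open>b\<close> gain edges, so
    an old shared corner must be shown to avoid them. A corner of an old and a new face is inner to
    \<open>?A\<close> or \<open>?B\<close>; a corner of the two new faces is inner to the ear and
    has degree 2 there.\<close>
  have rot': "card {e \<in> E \<union> pedges ?P. v \<in> e} = 2"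
    if ST: "S \<in> F'" "T \<in> F'" "S \<noteq> T" and f: "f1 \<noteq> f2" "v \<in> f1" "v \<in> f2"
      "f1 \<in> cedges (cyc' S)" "f1 \<in> cedges (cyc' T)" "f2 \<in> cedges (cyc' S)" "f2 \<in> cedges (cyc' T)" for S T f1 f2 v
  proof -
    have vE: "v \<in> \<Union>E" if "f1 \<in> cedges (cyc S)" "S \<in> F" for S
      using that f(2) cyc by blast
    have FR: ?thesis if "S \<in> F - {R}" "f1 \<in> cedges (cyc S)" "f2 \<in> cedges (cyc S)"
        "f1 \<in> pedges Q" "f2 \<in> pedges Q" "Q = ?A \<or> Q = ?B" for S Q
      using rotFR[OF that(1) f(1-3) that(2-6)] deg[OF vE[OF that(2)]] that(1) by simp
    have notP: "f1 \<notin> pedges ?P" "f2 \<notin> pedges ?P" if "f1 \<in> cedges (cyc S)" "f2 \<in> cedges (cyc S)" "S \<in> F" for S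
      using that cyc PG(2) by blast+
    have "S = R1 \<or> S = R2 \<or> S \<in> F - {R}" "T = R1 \<or> T = R2 \<or> T \<in> F - {R}"
      using ST(1,2) unfolding F'_def by (simp_all only: insert_iff)
    then consider "S \<in> F - {R}" "T \<in> F - {R}" | "S \<in> F - {R}" "T \<in> {R1, R2}" | "S \<in> {R1, R2}" "T \<in> F - {R}"
      | "S = R1 \<and> T = R2 \<or> S = R2 \<and> T = R1"
      using ST(3) by (metis insertI1 insertI2)
    then show ?thesis
    proof cases
      case 1
      have f1: "f1 \<in> cedges (cyc S)" "f1 \<in> cedges (cyc T)" "f2 \<in> cedges (cyc S)" "f2 \<in> cedges (cyc T)"
        using f 1 eF by auto
      then have d: "card {e \<in> E. v \<in> e} = 2" using rot[of S T f1 f2 v] 1 ST f by auto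
      have inE: "f1 \<in> E" "f2 \<in> E" using f1 1 eF by blast+
      have "{f1, f2} \<subseteq> {e \<in> E. v \<in> e}" using inE f by auto
      moreover have "card {e \<in> E. v \<in> e} \<le> card {f1, f2}" using d f(1) by simp
      ultimately have eq: "{f1, f2} = {e \<in> E. v \<in> e}" using finE by (intro card_seteq) auto
      \<comment> \<open>As \<open>v\<close> has degree 2, the boundary of \<open>R\<close> could
        pass through \<open>v\<close> only along \<open>f1\<close> and \<open>f2\<close>; then
        \<open>f1\<close> would lie on the three faces \<open>R\<close>, \<open>S\<close> and
        \<open>T\<close>.\<close>
      have "v \<notin> set (cyc R)"
      proof
        assume "v \<in> set (cyc R)"
        then have "card {e \<in> cedges (cyc R). v \<in> e} = 2" by (rule cedges_degree[OF cR(2,1)])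
        moreover have "{e \<in> cedges (cyc R). v \<in> e} \<subseteq> {f1, f2}" unfolding eq
          by (rule Collect_mono) (use cR(3) in auto)
        moreover have "card {f1, f2} = 2" using f(1) by simp
        ultimately have "{e \<in> cedges (cyc R). v \<in> e} = {f1, f2}" by (intro card_seteq) auto
        then have f1R: "f1 \<in> cedges (cyc R)" by blast
        have "{R, S, T} \<subseteq> {R \<in> F. f1 \<in> cedges (cyc R)}" using f1R f1 1 R(1) by auto
        then have "card {R, S, T} \<le> 2" using two[OF inE(1)] card_mono[of "{R \<in> F. f1 \<in> cedges (cyc R)}" "{R, S, T}"] E(3) by simp
        moreover have "S \<noteq> R" "T \<noteq> R" using 1 by simp_all
        ultimately show False using ST(3) by (simp add: card_insert_if eq_commute[of R])
      qed
      then have "v \<noteq> a" "v \<noteq> b" using AB(3) by auto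
      then show ?thesis using deg[OF vE[OF f1(1)]] d 1 by simp
    next
      case 2
      then show ?thesis using FR[of S ?A] FR[of S ?B] notP[of S] f e1 e2 eF by auto
    next
      case 3
      then show ?thesis using FR[of T ?A] FR[of T ?B] notP[of T] f e1 e2 eF by auto
    next
      case 4
      have i: "cedges (cyc' R1) \<inter> cedges (cyc' R2) = pedges ?P"
        unfolding e1 e2 using disjAB AE BE PG(2) by blast
      then have "f1 \<in> pedges ?P" "f2 \<in> pedges ?P" using 4 f by auto
      then have v: "v \<in> set ?P" "v \<noteq> a" "v \<noteq> b" using pedges_two_edges[OF P(1), of f1 f2 v] f by auto
      then have "v \<notin> \<Union>E" using I by auto
      then have "{e \<in> E \<union> pedges ?P. v \<in> e} = {e \<in> pedges ?P. v \<in> e}" by blast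
      then show ?thesis using pedges_degree[OF P(1), of v] v by simp
    qed
  qed
  have "face_struct (E \<union> pedges ?P) F' cyc'"
    unfolding face_struct_def
  proof (intro conjI ballI impI allI)
    show "E \<union> pedges ?P \<subseteq> edges G" using E PG by auto
    show "F' = components (- draw (E \<union> pedges ?P))" using comp by simp
    show "finite F'" unfolding F'_def using E by simp
  next
    fix S assume S: "S \<in> F'"
    then have "S = R1 \<or> S = R2 \<or> S \<in> F - {R}" unfolding F'_def by (simp only: insert_iff)
    then consider "S = R1" | "S = R2" | "S \<in> F - {R}" by (elim disjE)
    then show "is_cycle G (cyc' S)"
    proof cases
      case 1
      have "is_cycle G (cyc' R1)"
        by (rule is_cycleI[OF simple])
          (use e1 AE E PG AB(2,3) P(1) IAB AIne in \<open>auto simp: c1 Suc_le_eq\<close>)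
      then show ?thesis using 1 by simp
    next
      case 2
      have "is_cycle G (cyc' R2)"
        by (rule is_cycleI[OF simple])
          (use e2 BE E PG AB(2,3) P(1) IAB AIne in \<open>auto simp: c2 Suc_le_eq\<close>)
      then show ?thesis using 2 by simp
    next
      case 3 then show ?thesis using cF cyc by simp
    qed
    show "cedges (cyc' S) \<subseteq> E \<union> pedges ?P"
    proof -
      have "S = R1 \<or> S = R2 \<or> S \<in> F - {R}" using S unfolding F'_def by (simp only: insert_iff)
      then show ?thesis using e1 e2 eF[of S] AE BE by (elim disjE) blast+
    qed
    show "frontier S = draw (cedges (cyc' S))"
    proof -
      have "frontier R1 = draw (cedges (cyc' R1))" "frontier R2 = draw (cedges (cyc' R2))"
        unfolding R12(9,10) e1 e2 draw_Un A1_def A2_def X_def by (rule refl)+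
      moreover have "frontier S = draw (cedges (cyc' S))" if "S \<in> F - {R}"
        using that cF cyc by simp
      moreover have "S = R1 \<or> S = R2 \<or> S \<in> F - {R}" using S unfolding F'_def by (simp only: insert_iff)
      ultimately show ?thesis by metis
    qed
  next
    fix e assume e: "e \<in> E \<union> pedges ?P"
    show "card {S \<in> F'. e \<in> cedges (cyc' S)} = 2"
    proof (cases "e \<in> pedges ?P")
      case True
      then have "e \<notin> E" using PG by auto
      then have e0: "{S \<in> F - {R}. e \<in> cedges (cyc S)} = {}" using eF by blast
      show ?thesis unfolding newface e0 using True by simp
    next
      case False
      then have eE: "e \<in> E" using e by simp
      show ?thesis
      proof (cases "e \<in> cedges (cyc R)")
        case True
        then show ?thesis unfolding newface oneR[OF True] using False spl disjAB by auto
      next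
        case False2: False
        then have e0: "{S \<in> F - {R}. e \<in> cedges (cyc S)} = {S \<in> F. e \<in> cedges (cyc S)}" by auto
        show ?thesis unfolding newface e0 two[OF eE] using False False2 spl by auto
      qed
    qed
  next
    fix S T f1 f2 v
    assume "S \<in> F'" "T \<in> F'" "S \<noteq> T" "f1 \<noteq> f2" "v \<in> f1" "v \<in> f2"
      "f1 \<in> cedges (cyc' S) \<inter> cedges (cyc' T)" "f2 \<in> cedges (cyc' S) \<inter> cedges (cyc' T)"
    then show "card {e \<in> E \<union> pedges ?P. v \<in> e} = 2" using rot'[of S T f1 f2 v] by blast
  next
    have "\<Union>E \<subseteq> verts G" using E(1) edge_verts by (meson Union_least subsetD)
    then have finUE: "finite (\<Union>E)" by (rule finite_subset[OF _ finite_verts])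
    have "\<Union>(E \<union> pedges ?P) = \<Union>E \<union> set I"
      unfolding Union_Un_distrib UP using ab by (simp add: insert_absorb)
    moreover have "card (\<Union>E \<union> set I) = card (\<Union>E) + length I"
      using I P(1) finUE by (subst card_Un_disjoint) (auto simp: distinct_card)
    moreover have "card (E \<union> pedges ?P) = card E + (length I + 1)"
      using finE PG(2) card_pedges[OF P(1)] by (subst card_Un_disjoint) auto
    moreover have "card F' = card F + 1"
    proof -
      have "card F = Suc (card (F - {R}))" by (rule card_Suc_Diff1[OF E(3) R(1), symmetric])
      then show ?thesis unfolding F'_def using R1F R2F R1R2 E(3) by simp
    qed
    ultimately show "card (\<Union>(E \<union> pedges ?P)) + card F' = card (E \<union> pedges ?P) + 2"
      using euler by simp
  qed
  then show ?thesis by blast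
qed

end

section \<open>An end block\<close>

definition nbhd :: "'a ugraph \<Rightarrow> 'a set \<Rightarrow> 'a set" where
  "nbhd G S = {y. \<exists>s\<in>S. adj G s y} - S"

context plane_drawing
begin

lemma adj_sym: "adj G u v \<Longrightarrow> adj G v u"
  by (simp add: adj_def insert_commute)

lemma adj_verts: "adj G u v \<Longrightarrow> u \<in> verts G \<and> v \<in> verts G"
  using edge_verts unfolding adj_def by blast

lemma adj_neq: "adj G u v \<Longrightarrow> u \<noteq> v"
  using edge_card[of "{u, v}"] by (auto simp: adj_def)

lemma edge_at:
  assumes "e \<in> edges G" "v \<in> e"
  obtains y where "e = {v, y}" "adj G v y" "y \<noteq> v"
proof -
  obtain a b where "e = {a, b}" "a \<noteq> b" using edge_card[OF assms(1)] by (auto simp: card_2_iff)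
  then have "e = {v, if v = a then b else a}" "(if v = a then b else a) \<noteq> v" using assms(2) by auto
  then show ?thesis using that assms(1) unfolding adj_def by metis
qed

lemma card_neighbours: "card {y. adj G v y} = vdeg G v"
proof -
  have "bij_betw (\<lambda>y. {v, y}) {y. adj G v y} {e \<in> edges G. v \<in> e}"
    unfolding bij_betw_def
  proof
    show "inj_on (\<lambda>y. {v, y}) {y. adj G v y}" by (auto simp: inj_on_def doubleton_eq_iff)
    show "(\<lambda>y. {v, y}) ` {y. adj G v y} = {e \<in> edges G. v \<in> e}"
    proof
      show "{e \<in> edges G. v \<in> e} \<subseteq> (\<lambda>y. {v, y}) ` {y. adj G v y}"
      proof
        fix e assume "e \<in> {e \<in> edges G. v \<in> e}"
        then obtain y where "e = {v, y}" "adj G v y" using edge_at by blast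
        then show "e \<in> (\<lambda>y. {v, y}) ` {y. adj G v y}" by blast
      qed
    qed (auto simp: adj_def)
  qed
  then show ?thesis unfolding vdeg_def by (rule bij_betw_same_card)
qed

text \<open>Take a longest path in \<open>?W\<close> that starts in \<open>S\<close>. The neighbours
  of its first vertex lie on the path or equal \<open>v0\<close>; degree 3 leaves one that is
  neither \<open>v0\<close> nor the second vertex of the path, and it closes a cycle. The start has
  to be in \<open>S\<close>, since nothing is known about the neighbours of \<open>v0\<close> in
  \<open>?W\<close>.\<close>

lemma cycle_in_closed_set:
  assumes S: "S \<noteq> {}" "S \<subseteq> verts G" and N: "nbhd G S \<subseteq> {v0}"
    and deg: "\<And>v. v \<in> S \<Longrightarrow> 3 \<le> vdeg G v"
  shows "\<exists>c. is_cycle G c \<and> set c \<subseteq> S \<union> nbhd G S"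
proof -
  let ?W = "S \<union> nbhd G S"
  define Q where "Q xs \<longleftrightarrow> xs \<noteq> [] \<and> distinct xs \<and> set xs \<subseteq> ?W \<and> pedges xs \<subseteq> edges G \<and> hd xs \<in> S" for xs
  obtain s where "s \<in> S" using S by blast
  then have "Q [s]" by (auto simp: Q_def)
  have finW: "finite ?W" using finite_subset[OF S(2) finite_verts] N by (auto intro: finite_subset)
  have "length xs < Suc (card ?W)" if "Q xs" for xs
    using that card_mono[OF finW, of "set xs"] distinct_card[of xs] by (auto simp: Q_def)
  then obtain xs where xs: "Q xs" "\<And>ys. Q ys \<Longrightarrow> length ys \<le> length xs"
    using ex_has_greatest_nat[of Q "[s]" length "Suc (card ?W)"] \<open>Q [s]\<close> by blast
  obtain x r where xr: "xs = x # r" using xs(1) by (cases xs) (auto simp: Q_def)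
  have x: "x \<in> S" using xs(1) xr by (simp add: Q_def)
  have out: "y = v0 \<and> y \<in> nbhd G S" if "adj G x y" "y \<notin> set xs" for y
  proof -
    have "y \<in> nbhd G S"
    proof (rule ccontr)
      assume "y \<notin> nbhd G S"
      then have "y \<in> S" using that x by (auto simp: nbhd_def)
      moreover have "{y, x} \<in> edges G" using that by (simp add: adj_def insert_commute)
      ultimately have "Q (y # xs)" using xs(1) xr that by (simp add: Q_def)
      then show False using xs(2) by fastforce
    qed
    then show ?thesis using N by blast
  qed
  have "\<not> {y. adj G x y} \<subseteq> {v0, hd r}"
  proof
    assume "{y. adj G x y} \<subseteq> {v0, hd r}"
    then have "card {y. adj G x y} \<le> card {v0, hd r}" by (intro card_mono) auto
    also have "\<dots> \<le> 2" by (simp add: card_insert_if)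
    finally show False using deg[OF x] by (simp add: card_neighbours)
  qed
  then obtain y where y: "adj G x y" "y \<noteq> v0" "y \<noteq> hd r" by blast
  then have "y \<in> set r" using out[OF y(1)] xr adj_neq by auto
  then obtain A B where AB: "r = A @ y # B" by (meson split_list)
  then obtain z C where C: "A = z # C" using y(3) by (cases A) auto
  let ?c = "x # A @ [y]"
  have sub: "set ?c \<subseteq> ?W" "distinct ?c" using xs(1) xr AB by (auto simp: Q_def)
  have "pedges xs = pedges ?c \<union> pedges (y # B)" unfolding xr AB using pedges_append[of "x # A" y B] by simp
  moreover have "{y, x} \<in> edges G" using y by (simp add: adj_def insert_commute)
  ultimately have "cedges ?c \<subseteq> edges G" using xs(1) by (simp add: cedges_eq_pedges Q_def)
  then have "is_cycle G ?c" using sub(2) C by (intro is_cycleI[OF simple]) auto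
  then show ?thesis using sub by blast
qed

lemma reach_path:
  assumes "(y, z) \<in> {(u, v). u \<in> U \<and> v \<in> U \<and> adj G u v}\<^sup>*" "y \<in> U"
  shows "\<exists>xs. xs \<noteq> [] \<and> distinct xs \<and> hd xs = y \<and> last xs = z \<and>
      set xs \<subseteq> U \<and> pedges xs \<subseteq> edges G"
  using assms(1)
proof (induction rule: rtrancl_induct)
  case base
  show ?case by (rule exI[of _ "[y]"]) (use assms(2) in auto)
next
  case (step z w)
  then obtain xs where xs: "xs \<noteq> []" "distinct xs" "hd xs = y" "last xs = z" "set xs \<subseteq> U" "pedges xs \<subseteq> edges G" by blast
  show ?case
  proof (cases "w \<in> set xs")
    case True
    then obtain A B where AB: "xs = A @ w # B" by (meson split_list)
    have "pedges (A @ [w]) \<subseteq> pedges xs" unfolding AB by (subst (2) pedges_append) auto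
    then show ?thesis using xs AB
      by (intro exI[of _ "A @ [w]"]) (auto simp: hd_append split: if_splits)
  next
    case False
    obtain A where A: "xs = A @ [z]" using xs by (metis append_butlast_last_id)
    have "pedges (xs @ [w]) = pedges xs \<union> {{z, w}}" unfolding A using pedges_append[of A z "[w]"] by simp
    then show ?thesis using xs step(2) False
      by (intro exI[of _ "xs @ [w]"]) (auto simp: adj_def)
  qed
qed

lemma pedges_two_paths: "xs \<noteq> [] \<Longrightarrow> pedges (a # xs @ [b]) = insert {a, hd xs} (insert {last xs, b} (pedges xs))"
proof -
  assume "xs \<noteq> []"
  then obtain A z where A: "xs = A @ [z]" by (metis append_butlast_last_id)
  then show ?thesis using pedges_append[of "a # A" z "[b]"] \<open>xs \<noteq> []\<close> by (cases A) auto
qed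

text \<open>Take \<open>S\<close> minimal among the nonempty vertex sets with at most one outside neighbour, and a maximal
  subgraph with a face structure inside \<open>S\<close> and its neighbour. A part left uncovered can be attached
  at one vertex only, as there is no ear, and then it or the covered part contradicts the minimality of \<open>S\<close>.\<close>

theorem end_block:
  assumes ne: "verts G \<noteq> {}" and deg: "\<And>v. v \<in> verts G \<Longrightarrow> 3 \<le> vdeg G v"
  shows "\<exists>E F cyc v0. face_struct E F cyc \<and> E \<noteq> {} \<and> (\<forall>v\<in>\<Union>E. v \<noteq> v0 \<longrightarrow> {e \<in> edges G. v \<in> e} \<subseteq> E)"
proof -
  define good where "good S \<longleftrightarrow> S \<noteq> {} \<and> S \<subseteq> verts G \<and> (\<exists>v. nbhd G S \<subseteq> {v})" for S
  have "nbhd G (verts G) = {}" using adj_verts by (auto simp: nbhd_def)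
  then have "good (verts G)" using ne by (auto simp: good_def)
  then obtain S where S: "good S" "\<And>S'. good S' \<Longrightarrow> card S \<le> card S'"
    using ex_has_least_nat[of good "verts G" card] by blast
  obtain v0 where v0: "nbhd G S \<subseteq> {v0}" using S(1) by (auto simp: good_def)
  have S': "S \<noteq> {}" "S \<subseteq> verts G" "finite S"
    using S(1) finite_verts finite_subset by (auto simp: good_def)
  define W where "W = S \<union> nbhd G S"
  have nb: "y \<in> W" if "s \<in> S" "adj G s y" for s y
    using that by (auto simp: W_def nbhd_def)
  have nbv0: "v0 \<notin> S" if "v0 \<in> nbhd G S" using that by (auto simp: nbhd_def)
  obtain c where c: "is_cycle G c" "set c \<subseteq> W"
    using cycle_in_closed_set[OF S'(1,2) v0] deg S' W_def by blast
  define Q where "Q E \<longleftrightarrow> (\<exists>F cyc. face_struct E F cyc) \<and> E \<noteq> {} \<and> \<Union>E \<subseteq> W" for E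
  have "cedges c \<noteq> {}" using c(1) card_cedges[of c] by (auto simp: is_cycle_iff)
  then have Qc: "Q (cedges c)" using face_struct_cycle[OF c(1)] c(2) Union_cedges[of c] by (simp add: Q_def)
  have "card E < Suc (card (edges G))" if "Q E" for E
    using that card_mono[OF finite_edges, of E] by (auto simp: Q_def face_struct_def)
  then obtain E where E: "Q E" "\<And>E'. Q E' \<Longrightarrow> card E' \<le> card E"
    using ex_has_greatest_nat[of Q "cedges c" card "Suc (card (edges G))"] Qc by blast
  obtain F cyc where fs: "face_struct E F cyc" using E(1) by (auto simp: Q_def)
  define H where "H = \<Union>E"
  have EG: "E \<subseteq> edges G" "finite E" using fs finite_edges finite_subset by (auto simp: face_struct_def)
  have HW: "H \<subseteq> W" using E(1) by (simp add: Q_def H_def)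
  have no_ear: False if "distinct (a # I @ [b])" "pedges (a # I @ [b]) \<subseteq> edges G - E" "a \<in> H" "b \<in> H"
      "set I \<inter> H = {}" "set I \<subseteq> W" for a b I
  proof -
    have "Q (E \<union> pedges (a # I @ [b]))"
      using face_struct_ear[OF fs that(1,2)] that(3-6) HW by (auto simp: Q_def H_def Union_pedges)
    then have "card (E \<union> pedges (a # I @ [b])) \<le> card E" by (rule E(2))
    moreover have "card (E \<union> pedges (a # I @ [b])) = card E + (length I + 1)"
      using EG that(2) card_pedges[OF that(1)] by (subst card_Un_disjoint) auto
    ultimately show False by simp
  qed
  obtain h1 h2 where h: "h1 \<in> H" "h2 \<in> H" "h1 \<noteq> h2"
  proof -
    obtain e where e: "e \<in> E" using E(1) by (auto simp: Q_def)
    then have "card e = 2" using edge_card EG(1) by blast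
    then obtain x y where "e = {x, y}" "x \<noteq> y" by (auto simp: card_2_iff)
    then show ?thesis using e that[of x y] unfolding H_def by blast
  qed
  have "h1 \<in> S \<or> h2 \<in> S" using h HW v0 by (auto simp: W_def)
  then have HS: "H \<inter> S \<noteq> {}" using h by blast
  define r where "r = {(u, v). u \<in> W - H \<and> v \<in> W - H \<and> adj G u v}"
  define K where "K x = {z. (x, z) \<in> r\<^sup>*}" for x
  have symr: "sym (r\<^sup>*)" by (rule sym_rtrancl) (auto simp: r_def sym_def adj_sym)
  have KW: "K x \<subseteq> W - H" if "x \<in> W - H" for x
  proof
    fix z assume "z \<in> K x"
    then have "(x, z) \<in> r\<^sup>*" by (simp add: K_def)
    then show "z \<in> W - H" by (induction rule: rtrancl_induct) (use that in \<open>auto simp: r_def\<close>)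
  qed
  have Kstep: "z \<in> K x" if "y \<in> K x" "adj G y z" "z \<in> W - H" "x \<in> W - H" for x y z
  proof -
    have "(y, z) \<in> r" using that KW by (auto simp: r_def)
    then show ?thesis using that(1) by (simp add: K_def)
  qed
  have attach: "u1 = u2" if x: "x \<in> W - H" and k: "k1 \<in> K x" "k2 \<in> K x" "adj G k1 u1" "adj G k2 u2" "u1 \<in> H" "u2 \<in> H"
    for x k1 k2 u1 u2
  proof (rule ccontr)
    assume ne: "u1 \<noteq> u2"
    have "(k1, x) \<in> r\<^sup>*" using k(1) symD[OF symr] by (simp add: K_def)
    then have "(k1, k2) \<in> r\<^sup>*" using k(2) by (auto simp: K_def intro: rtrancl_trans)
    then obtain xs where xs: "xs \<noteq> []" "distinct xs" "hd xs = k1" "last xs = k2" "set xs \<subseteq> W - H" "pedges xs \<subseteq> edges G"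
      using reach_path[of k1 k2 "W - H"] KW[OF x] k(1) unfolding r_def by blast
    have "pedges (u1 # xs @ [u2]) \<subseteq> edges G"
      using pedges_two_paths[OF xs(1)] xs k(3,4) by (simp add: adj_def insert_commute)
    moreover have "e \<notin> E" if e: "e \<in> pedges (u1 # xs @ [u2])" for e
    proof
      assume "e \<in> E"
      then have "e \<subseteq> H" by (auto simp: H_def)
      have "card e = 2" using \<open>e \<in> E\<close> EG edge_card by blast
      have "k1 \<notin> H" "k2 \<notin> H" using xs hd_in_set[OF xs(1)] last_in_set[OF xs(1)] by auto
      then have "e \<in> pedges xs" using e \<open>e \<subseteq> H\<close> unfolding pedges_two_paths[OF xs(1)] xs(3,4) by auto
      then have "e \<subseteq> W - H" using pedges_subset xs(5) by blast
      then have "e = {}" using \<open>e \<subseteq> H\<close> by blast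
      then show False using \<open>card e = 2\<close> by simp
    qed
    ultimately show False using no_ear[of u1 xs u2] xs k(5,6) ne by auto
  qed
  \<comment> \<open>An uncovered part without \<open>v0\<close> lies in \<open>S\<close>, and its
    outside neighbours are covered, hence at most one. By minimality the part is all of
    \<open>S\<close>, although \<open>H\<close> meets \<open>S\<close>.\<close>
  have Kv0: "v0 \<in> K x \<and> v0 \<in> nbhd G S" if x: "x \<in> W - H" for x
  proof (rule ccontr)
    assume "\<not> ?thesis"
    then have KS: "K x \<subseteq> S" using KW[OF x] v0 by (auto simp: W_def)
    have nK: "y \<in> H \<and> (\<exists>k\<in>K x. adj G k y)" if "y \<in> nbhd G (K x)" for y
    proof -
      obtain k where k: "k \<in> K x" "adj G k y" "y \<notin> K x" using \<open>y \<in> nbhd G (K x)\<close> by (auto simp: nbhd_def)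
      have "y \<in> W" using k KS nb by blast
      then show ?thesis using k Kstep[OF k(1,2) _ x] by blast
    qed
    have "\<exists>v. nbhd G (K x) \<subseteq> {v}"
    proof (cases "nbhd G (K x) = {}")
      case False
      then obtain y where "y \<in> nbhd G (K x)" by blast
      then have "nbhd G (K x) \<subseteq> {y}" using nK attach[OF x] by blast
      then show ?thesis by blast
    qed auto
    moreover have "K x \<noteq> {}" by (auto simp: K_def)
    ultimately have "good (K x)" using KS S' by (auto simp: good_def)
    then have "card S \<le> card (K x)" by (rule S(2))
    then have "K x = S" using KS S'(3) by (simp add: card_seteq)
    then show False using KW[OF x] HS by blast
  qed
  have WH: "W = H"
  proof (rule ccontr)
    assume "W \<noteq> H"
    then obtain x where x: "x \<in> W - H" using HW by blast
    note kx = Kv0[OF x]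
    have HS': "H \<subseteq> S" using HW v0 kx KW[OF x] by (auto simp: W_def)
    have Kall: "y \<in> K x" if y: "y \<in> W - H" for y
    proof -
      have "(y, v0) \<in> r\<^sup>*" using Kv0[OF y] by (simp add: K_def)
      then have "(v0, y) \<in> r\<^sup>*" using symD[OF symr] by blast
      then show ?thesis using kx by (auto simp: K_def intro: rtrancl_trans)
    qed
    obtain u where u: "u \<in> H" "\<And>k y. k \<in> K x \<Longrightarrow> adj G k y \<Longrightarrow> y \<in> H \<Longrightarrow> y = u"
    proof (cases "\<exists>k y. k \<in> K x \<and> adj G k y \<and> y \<in> H")
      case True
      then show ?thesis using that attach[OF x] by metis
    next
      case False
      then show ?thesis using that h(1) by blast
    qed
    \<comment> \<open>Every uncovered part contains \<open>v0\<close>, so there is only one, and it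
      is attached at most at \<open>u\<close>. Thus \<open>H\<close> without \<open>u\<close> has no
      outside neighbour but \<open>u\<close>, and it is smaller than \<open>S\<close>.\<close>
    have "nbhd G (H - {u}) \<subseteq> {u}"
    proof
      fix y assume "y \<in> nbhd G (H - {u})"
      then obtain s where s: "s \<in> H" "s \<noteq> u" "adj G s y" "y \<notin> H - {u}" by (auto simp: nbhd_def)
      have "y \<in> W" using nb s HS' by blast
      have "y \<in> H"
      proof (rule ccontr)
        assume "y \<notin> H"
        then show False using u(2)[OF Kall[of y] adj_sym[OF s(3)] s(1)] s(2) \<open>y \<in> W\<close> by blast
      qed
      then show "y \<in> {u}" using s by blast
    qed
    moreover have "H - {u} \<noteq> {}" using h by blast
    ultimately have "good (H - {u})" using HS' S' by (auto simp: good_def)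
    then have "card S \<le> card (H - {u})" by (rule S(2))
    moreover have "card (H - {u}) < card S"
      using u(1) HS' by (intro psubset_card_mono S') auto
    ultimately show False by simp
  qed
  have "{e \<in> edges G. v \<in> e} \<subseteq> E" if v: "v \<in> \<Union>E" "v \<noteq> v0" for v
  proof
    fix e assume e: "e \<in> {e \<in> edges G. v \<in> e}"
    then obtain y where y: "e = {v, y}" "adj G v y" "y \<noteq> v" using edge_at by blast
    have "v \<in> S" using v HW v0 by (auto simp: W_def H_def)
    then have "y \<in> H" using nb[OF _ y(2)] WH by simp
    \<comment> \<open>A missing edge between covered vertices would be an ear without inner
      vertices.\<close>
    show "e \<in> E"
    proof (rule ccontr)
      assume "e \<notin> E"
      then show False using no_ear[of v "[]" y] e y v \<open>y \<in> H\<close> by (simp add: H_def)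
    qed
  qed
  then show ?thesis using fs E(1) unfolding Q_def by blast
qed

end

section \<open>Short cycles\<close>

locale short_cycle_free =
  fixes G :: "'a ugraph"
  assumes simple_G: "simple_graph G"
    and no4: "\<not> has_cycle_of_length G 4"
    and no7: "\<not> has_cycle_of_length G 7"
    and no9: "\<not> has_cycle_of_length G 9"
    and no53: "\<not> (\<exists>c d. is_cycle G c \<and> length c = 5 \<and> is_cycle G d \<and> length d = 3 \<and> normally_adjacent c d)"
begin

lemma G_adj_sym: "adj G u v \<longleftrightarrow> adj G v u"
  by (simp add: adj_def insert_commute)

lemma G_edge: "e \<in> edges G \<Longrightarrow> e \<subseteq> verts G \<and> card e = 2"
  using simple_G unfolding simple_graph_def by blast

lemma G_adj_neq: "adj G u v \<Longrightarrow> u \<noteq> v"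
  using G_edge[of "{u, v}"] by (auto simp: adj_def)

lemma G_finite_edges: "finite (edges G)"
  using simple_G unfolding simple_graph_def
  by (meson Pow_iff finite_Pow_iff finite_subset subsetI)

lemma is_cycle_pedges: "c \<noteq> [] \<Longrightarrow> is_cycle G c \<longleftrightarrow> 3 \<le> length c \<and> distinct c \<and> adj G (last c) (hd c) \<and> pedges c \<subseteq> edges G"
  using is_cycleI[OF simple_G, of c] by (auto simp: is_cycle_iff cedges_eq_pedges adj_def)

lemma cycle3D: "is_cycle G [a0, a1, a2] \<Longrightarrow> distinct [a0, a1, a2] \<and> adj G a0 a1 \<and>
    adj G a1 a0 \<and> adj G a1 a2 \<and> adj G a2 a1 \<and> adj G a2 a0 \<and> adj G a0 a2"
  by (simp add: is_cycle_pedges adj_def insert_commute)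

lemma cycle5D: "is_cycle G [a0, a1, a2, a3, a4] \<Longrightarrow> distinct [a0, a1, a2, a3, a4] \<and>
    adj G a0 a1 \<and> adj G a1 a0 \<and> adj G a1 a2 \<and> adj G a2 a1 \<and> adj G a2 a3 \<and> adj G a3 a2 \<and>
    adj G a3 a4 \<and> adj G a4 a3 \<and> adj G a4 a0 \<and> adj G a0 a4"
  by (simp add: is_cycle_pedges adj_def insert_commute)

lemma cycle6D: "is_cycle G [a0, a1, a2, a3, a4, a5] \<Longrightarrow> distinct [a0, a1, a2, a3, a4, a5] \<and>
    adj G a0 a1 \<and> adj G a1 a0 \<and> adj G a1 a2 \<and> adj G a2 a1 \<and> adj G a2 a3 \<and> adj G a3 a2 \<and>
    adj G a3 a4 \<and> adj G a4 a3 \<and> adj G a4 a5 \<and> adj G a5 a4 \<and> adj G a5 a0 \<and>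
    adj G a0 a5"
  by (simp add: is_cycle_pedges adj_def insert_commute)

lemma cycle8D: "is_cycle G [a0, a1, a2, a3, a4, a5, a6, a7] \<Longrightarrow> distinct [a0, a1, a2, a3, a4, a5, a6, a7] \<and>
    adj G a0 a1 \<and> adj G a1 a0 \<and> adj G a1 a2 \<and> adj G a2 a1 \<and> adj G a2 a3 \<and> adj G a3 a2 \<and>
    adj G a3 a4 \<and> adj G a4 a3 \<and> adj G a4 a5 \<and> adj G a5 a4 \<and> adj G a5 a6 \<and> adj G a6 a5 \<and>
    adj G a6 a7 \<and> adj G a7 a6 \<and> adj G a7 a0 \<and> adj G a0 a7"
  by (simp add: is_cycle_pedges adj_def insert_commute)

lemma cycle10D: "is_cycle G [a0, a1, a2, a3, a4, a5, a6, a7, a8, a9] \<Longrightarrow> distinct [a0, a1, a2, a3, a4, a5, a6, a7, a8, a9] \<and>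
    adj G a0 a1 \<and> adj G a1 a0 \<and> adj G a1 a2 \<and> adj G a2 a1 \<and> adj G a2 a3 \<and> adj G a3 a2 \<and>
    adj G a3 a4 \<and> adj G a4 a3 \<and> adj G a4 a5 \<and> adj G a5 a4 \<and> adj G a5 a6 \<and> adj G a6 a5 \<and>
    adj G a6 a7 \<and> adj G a7 a6 \<and> adj G a7 a8 \<and> adj G a8 a7 \<and> adj G a8 a9 \<and> adj G a9 a8 \<and>
    adj G a9 a0 \<and> adj G a0 a9"
  by (simp add: is_cycle_pedges adj_def insert_commute)

lemma no_C4: "distinct [a, b, c, d] \<Longrightarrow> adj G a b \<Longrightarrow> adj G b c \<Longrightarrow>
    adj G c d \<Longrightarrow> adj G d a \<Longrightarrow> False"
  using no4 is_cycle_pedges[of "[a, b, c, d]"] unfolding has_cycle_of_length_def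
  by (auto simp: adj_def dest!: spec[of _ "[a, b, c, d]"])

lemma no_C7: "distinct [a, b, c, d, e, f, g] \<Longrightarrow> adj G a b \<Longrightarrow> adj G b c \<Longrightarrow>
    adj G c d \<Longrightarrow> adj G d e \<Longrightarrow> adj G e f \<Longrightarrow> adj G f g \<Longrightarrow>
    adj G g a \<Longrightarrow> False"
  using no7 is_cycle_pedges[of "[a, b, c, d, e, f, g]"] unfolding has_cycle_of_length_def
  by (auto simp: adj_def dest!: spec[of _ "[a, b, c, d, e, f, g]"])

lemma no_C9: "distinct [a, b, c, d, e, f, g, h, i] \<Longrightarrow> adj G a b \<Longrightarrow> adj G b c \<Longrightarrow>
    adj G c d \<Longrightarrow> adj G d e \<Longrightarrow> adj G e f \<Longrightarrow> adj G f g \<Longrightarrow>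
    adj G g h \<Longrightarrow> adj G h i \<Longrightarrow> adj G i a \<Longrightarrow> False"
  using no9 is_cycle_pedges[of "[a, b, c, d, e, f, g, h, i]"] unfolding has_cycle_of_length_def
  by (auto simp: adj_def dest!: spec[of _ "[a, b, c, d, e, f, g, h, i]"])

lemma no_C5_C3:
  assumes "distinct [a, b, c, d, e, w]" "adj G a b" "adj G b c" "adj G c d" "adj G d e" "adj G e a"
    "adj G a w" "adj G b w"
  shows False
proof -
  have 1: "is_cycle G [a, b, c, d, e]" "is_cycle G [a, b, w]"
    using assms by (auto simp: is_cycle_pedges adj_def insert_commute)
  have "graph_inter (cycle_graph [a, b, c, d, e]) (cycle_graph [a, b, w])
     = (set [a, b, c, d, e] \<inter> set [a, b, w], cedges [a, b, c, d, e] \<inter> cedges [a, b, w])"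
    by (simp add: graph_inter_def cycle_graph_def)
  also have "\<dots> = ({a, b}, {{a, b}})"
  proof -
    have "set [a, b, c, d, e] \<inter> set [a, b, w] = {a, b}" using assms(1) by auto
    moreover have "cedges [a, b, c, d, e] = {{a, b}, {b, c}, {c, d}, {d, e}, {e, a}}"
      "cedges [a, b, w] = {{a, b}, {b, w}, {w, a}}" by (auto simp: cedges_eq_pedges)
    moreover have "{{a, b}, {b, c}, {c, d}, {d, e}, {e, a}} \<inter> {{a, b}, {b, w}, {w, a}} = {{a, b}}"
      using assms(1) by (simp add: doubleton_eq_iff)
    ultimately show ?thesis by simp
  qed
  finally have "normally_adjacent [a, b, c, d, e] [a, b, w]"
    unfolding normally_adjacent_def is_K2_def
    by (intro exI[of _ a] exI[of _ b] conjI) (use assms(1) in simp)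
  moreover have "length [a, b, c, d, e] = 5" "length [a, b, w] = 3" by simp_all
  ultimately show False using no53 1 by blast
qed

text \<open>In the following lemmas every identification of vertices of the given cycles is refuted by a short
  forbidden cycle (or a triangle normally adjacent to a 5-cycle) in the union of the cycles.\<close>

lemma no_triangle_beside_5:
  assumes h1a: "is_cycle G [u, v, c2, c3, c4]"
    and h2a: "is_cycle G [u, v, w]"
  shows False
proof -
  note c1 = cycle5D[OF h1a]
  note c2 = cycle3D[OF h2a]
  have n1: "c2 \<noteq> w" using no_C4[of c2 c3 c4 u] c1 c2 by auto
  have n2: "c3 \<noteq> w" using no_C4[of c2 c3 u v] c1 c2 by auto
  have n3: "c4 \<noteq> w" using no_C4[of c2 c3 c4 v] c1 c2 by auto
  show False using no_C5_C3[of u v c2 c3 c4 w] c1 c2 n1 n2 n3 by auto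
qed

text \<open>The outer cycle has length 6 + 3 - 2 = 7 once the apex is off the 6-cycle.\<close>

lemma no_triangle_beside_6:
  assumes h1a: "is_cycle G [u, v, c2, c3, c4, c5]"
    and h2a: "is_cycle G [u, v, w]"
  shows False
proof -
  note c1 = cycle6D[OF h1a]
  note c2 = cycle3D[OF h2a]
  have n1: "c2 \<noteq> w" using no_C5_C3[of u c2 c3 c4 c5 v] c1 c2 by auto
  have n2: "c3 \<noteq> w" using no_C4[of c2 c3 u v] c1 c2 by auto
  have n3: "c4 \<noteq> w" using no_C4[of c2 c3 c4 v] c1 c2 by auto
  have n4: "c5 \<noteq> w" using no_C5_C3[of c5 v c2 c3 c4 u] c1 c2 by auto
  show False using no_C7[of c2 c3 c4 c5 u w v] c1 c2 n1 n2 n3 n4 by auto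
qed

text \<open>The outer cycle has length 8 + 3 - 2 = 9 once the apex is off the 8-cycle.\<close>

lemma no_triangle_beside_8:
  assumes h1a: "is_cycle G [u, v, c2, c3, c4, c5, c6, c7]"
    and h2a: "is_cycle G [u, v, w]"
  shows False
proof -
  note c1 = cycle8D[OF h1a]
  note c2 = cycle3D[OF h2a]
  have n1: "c2 \<noteq> w" using no_C7[of c2 c3 c4 c5 c6 c7 u] c1 c2 by auto
  have n2: "c3 \<noteq> w" using no_C4[of c2 c3 u v] c1 c2 by auto
  have n3: "c4 \<noteq> w" using no_C4[of c2 c3 c4 v] c1 c2 by auto
  have n4: "c5 \<noteq> w" using no_C4[of c5 c6 c7 u] c1 c2 by auto
  have n5: "c6 \<noteq> w" using no_C4[of c6 c7 u v] c1 c2 by auto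
  have n6: "c7 \<noteq> w" using no_C7[of c2 c3 c4 c5 c6 c7 v] c1 c2 by auto
  show False using no_C9[of c2 c3 c4 c5 c6 c7 u w v] c1 c2 n1 n2 n3 n4 n5 n6 by auto
qed

text \<open>The outer cycle would have length 11, which is allowed; the point is only to obtain the
  shape of configuration (1).\<close>

lemma apex_off_ten_cycle:
  assumes h1a: "is_cycle G [u, v, c2, c3, c4, c5, c6, c7, c8, c9]"
    and h2a: "is_cycle G [u, v, w]"
  shows "w \<notin> {u, v, c2, c3, c4, c5, c6, c7, c8, c9}"
proof -
  note c1 = cycle10D[OF h1a]
  note c2 = cycle3D[OF h2a]
  have n1: "c2 \<noteq> w" using no_C9[of c2 c3 c4 c5 c6 c7 c8 c9 u] c1 c2 by auto
  have n2: "c3 \<noteq> w" using no_C4[of c2 c3 u v] c1 c2 by auto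
  have n3: "c4 \<noteq> w" using no_C4[of c2 c3 c4 v] c1 c2 by auto
  have n4: "c5 \<noteq> w" using no_C7[of c5 c6 c7 c8 c9 u v] c1 c2 by auto
  have n5: "c6 \<noteq> w" using no_C7[of c2 c3 c4 c5 c6 u v] c1 c2 by auto
  have n6: "c7 \<noteq> w" using no_C4[of c7 c8 c9 u] c1 c2 by auto
  have n7: "c8 \<noteq> w" using no_C4[of c8 c9 u v] c1 c2 by auto
  have n8: "c9 \<noteq> w" using no_C9[of c2 c3 c4 c5 c6 c7 c8 c9 v] c1 c2 by auto
  show ?thesis using c2 n1 n2 n3 n4 n5 n6 n7 n8 by auto
qed

text \<open>The outer cycle has length 5 + 6 - 2 = 9. If the two cycles had a path of three edges
  around \<open>uv\<close> in common, no forbidden cycle need arise; \<open>h1\<close> and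
  \<open>h2\<close> exclude this, here and in the variant below.\<close>

lemma five_six_a:
  assumes h1a: "is_cycle G [u, v, a2, a3, a4]"
    and h2a: "is_cycle G [u, v, b2, b3, b4, b5]"
    and h1: "a2 \<noteq> b2"
    and h2: "a3 \<noteq> b4"
  shows False
proof -
  note c1 = cycle5D[OF h1a]
  note c2 = cycle6D[OF h2a]
  have n1: "a2 \<noteq> b3" using no_C5_C3[of v a2 b4 b5 u b2] c1 c2 by auto
  have n2: "a2 \<noteq> b4" using no_C4[of a2 b3 b2 v] c1 c2 by auto
  have n3: "a2 \<noteq> b5" using no_C4[of a2 a3 a4 u] c1 c2 by auto
  have n4: "a3 \<noteq> b2" using no_C4[of a3 a4 u v] c1 c2 by auto
  have n5: "a3 \<noteq> b3" using no_C4[of a2 a3 b2 v] c1 c2 h1 by auto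
  have n6: "a3 \<noteq> b5" using no_C4[of a2 a3 u v] c1 c2 by auto
  have n7: "a4 \<noteq> b2" using no_C4[of a2 a3 a4 v] c1 c2 by auto
  have n8: "a4 \<noteq> b3" using no_C4[of a4 b2 v u] c1 c2 by auto
  have n9: "a4 \<noteq> b4" using no_C5_C3[of a4 u v a2 a3 b5] c1 c2 n3 n6 by auto
  have n10: "a4 \<noteq> b5" using no_C7[of a2 a3 a4 b4 b3 b2 v] c1 c2 h1 h2 n1 n2 n4 n5 by auto
  show False using no_C9[of a2 a3 a4 u b5 b4 b3 b2 v] c1 c2 h1 h2 n1 n10 n2 n3 n4 n5 n6 n7 n8 n9 by auto
qed

lemma five_six_b:
  assumes h1a: "is_cycle G [u, v, a2, a3, a4]"
    and h2a: "is_cycle G [u, v, b2, b3, b4, b5]"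
    and h1: "a2 \<noteq> b2"
    and h2: "a4 \<noteq> b5"
  shows False
proof -
  note c1 = cycle5D[OF h1a]
  note c2 = cycle6D[OF h2a]
  have n1: "a2 \<noteq> b3" using no_C5_C3[of v a2 b4 b5 u b2] c1 c2 by auto
  have n2: "a2 \<noteq> b4" using no_C4[of a2 b3 b2 v] c1 c2 by auto
  have n3: "a2 \<noteq> b5" using no_C4[of a2 a3 a4 u] c1 c2 by auto
  have n4: "a3 \<noteq> b2" using no_C4[of a3 a4 u v] c1 c2 by auto
  have n5: "a3 \<noteq> b3" using no_C4[of a2 a3 b2 v] c1 c2 h1 by auto
  have n6: "a3 \<noteq> b4" using no_C4[of a3 a4 u b5] c1 c2 h2 by auto
  have n7: "a3 \<noteq> b5" using no_C4[of a2 a3 u v] c1 c2 by auto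
  have n8: "a4 \<noteq> b2" using no_C4[of a2 a3 a4 v] c1 c2 by auto
  have n9: "a4 \<noteq> b3" using no_C4[of a4 b2 v u] c1 c2 by auto
  have n10: "a4 \<noteq> b4" using no_C5_C3[of a4 u v a2 a3 b5] c1 c2 n3 n7 by auto
  show False using no_C9[of a2 a3 a4 u b5 b4 b3 b2 v] c1 c2 h1 h2 n1 n10 n2 n3 n4 n5 n6 n7 n8 n9 by auto
qed

text \<open>Three 5-cycles around \<open>v\<close> have an outer cycle of length 15 - 6 = 9. Of the
  three coincidences at the far ends of the spokes, two are excluded by hypothesis; the third
  (\<open>n17\<close>) then leaves a 7-cycle.\<close>

lemma three_fives_normal:
  assumes h1a: "is_cycle G [v, a, x1, x2, b]"
    and h2a: "is_cycle G [v, b, y1, y2, c]"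
    and h3a: "is_cycle G [v, c, z1, z2, a]"
    and h1: "x2 \<noteq> y1"
    and h2: "y2 \<noteq> z1"
  shows False
proof -
  note c1 = cycle5D[OF h1a]
  note c2 = cycle5D[OF h2a]
  note c3 = cycle5D[OF h3a]
  have n1: "a \<noteq> y1" using no_C4[of a v c y2] c1 c2 by auto
  have n2: "a \<noteq> y2" using no_C4[of a c z1 z2] c2 c3 by auto
  have n3: "x1 \<noteq> y1" using no_C4[of a v b x1] c1 c2 by auto
  have n4: "x1 \<noteq> y2" using no_C4[of a v c x1] c1 c2 c3 by auto
  have n5: "x1 \<noteq> c" using no_C4[of a x1 z1 z2] c1 c3 by auto
  have n6: "x1 \<noteq> z1" using no_C4[of a v c x1] c1 c2 c3 by auto
  have n8: "x2 \<noteq> y2" using no_C4[of b v c x2] c1 c2 by auto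
  have n9: "x2 \<noteq> c" using no_C4[of a v x2 x1] c1 c2 by auto
  have n10: "x2 \<noteq> z1" using no_C4[of b v c x2] c1 c2 c3 by auto
  have n11: "x2 \<noteq> z2" using no_C4[of a v b x2] c1 c3 by auto
  have n12: "b \<noteq> z1" using no_C4[of a v b z2] c1 c3 by auto
  have n13: "b \<noteq> z2" using no_C4[of a b x2 x1] c1 c3 by auto
  have n14: "y1 \<noteq> z1" using no_C4[of b v c y1] c1 c2 c3 by auto
  have n15: "y1 \<noteq> z2" using no_C4[of a v b y1] c1 c2 c3 by auto
  have n16: "y2 \<noteq> z2" using no_C4[of a v c y2] c1 c2 c3 by auto
  have n17: "x1 \<noteq> z2" using no_C7[of b x2 x1 z1 c y2 y1] c1 c2 c3 h1 h2 n10 n12 n14 n3 n4 n8 n9 by auto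
  show False using no_C9[of a x1 x2 b y1 y2 c z1 z2] c1 c2 c3 h1 h2 n1 n10 n11 n12 n13 n14 n15 n16 n17 n2 n3 n4 n5 n6 n8 n9 by auto
qed

section \<open>Disjointness in configurations (2) and (3)\<close>

lemma cubic_neighbours:
  assumes "vdeg G v = 3" "distinct [a, b, c, d]" "adj G v a" "adj G v b" "adj G v c" "adj G v d"
  shows False
proof -
  have "{{v, a}, {v, b}, {v, c}, {v, d}} \<subseteq> {e \<in> edges G. v \<in> e}"
    using assms by (auto simp: adj_def)
  then have "card {{v, a}, {v, b}, {v, c}, {v, d}} \<le> vdeg G v"
    unfolding vdeg_def by (intro card_mono) (auto simp: G_finite_edges)
  moreover have "card {{v, a}, {v, b}, {v, c}, {v, d}} = 4"
    using assms(2) by (auto simp: card_insert_if doubleton_eq_iff)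
  ultimately show False using assms(1) by simp
qed

text \<open>Short cycles do not suffice here: the coincidences \<open>v7 = w1\<close> and
  \<open>v8 = w3\<close> are finally refuted by a fourth neighbour of a cubic vertex.
  \<open>h1\<close> and \<open>h2\<close> say that the cycles do not continue together beyond
  \<open>v3\<close> and \<open>v4\<close>.\<close>

lemma eight_five_disjoint:
  assumes h1a: "is_cycle G [v1, v2, v3, v4, v5, v6, v7, v8]"
    and h2a: "is_cycle G [v3, w1, w2, w3, v4]"
    and d: "\<forall>z \<in> {v1, v2, v3, v4, v5, v6, v7, v8, w1, w2, w3}. vdeg G z = 3"
    and h1: "v2 \<noteq> w1"
    and h2: "v5 \<noteq> w3"
  shows "{w1, w2, w3} \<inter> {v1, v2, v3, v4, v5, v6, v7, v8} = {}"
proof -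
  note c1 = cycle8D[OF h1a]
  note c2 = cycle5D[OF h2a]
  have dv7: "vdeg G v7 = 3" and dv8: "vdeg G v8 = 3" using d by auto
  note Dv7 = cubic_neighbours[OF dv7]
  note Dv8 = cubic_neighbours[OF dv8]
  have n1: "v1 \<noteq> w1" using no_C7[of v1 v3 v4 v5 v6 v7 v8] c1 c2 by auto
  have n2: "v1 \<noteq> w2" using no_C4[of v1 v2 v3 w1] c1 c2 h1 by auto
  have n3: "v1 \<noteq> w3" using no_C4[of v1 v2 v3 v4] c1 c2 by auto
  have n4: "v2 \<noteq> w2" using no_C4[of v2 v3 v4 w3] c1 c2 by auto
  have n5: "v2 \<noteq> w3" using no_C4[of v2 v3 w1 w2] c1 c2 by auto
  have n6: "v5 \<noteq> w1" using no_C4[of v4 v5 w2 w3] c1 c2 by auto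
  have n7: "v5 \<noteq> w2" using no_C4[of v3 v4 v5 w1] c1 c2 by auto
  have n8: "v6 \<noteq> w1" using no_C4[of v3 v4 v5 v6] c1 c2 by auto
  have n9: "v6 \<noteq> w2" using no_C4[of v4 v5 v6 w3] c1 c2 h2 by auto
  have n10: "v6 \<noteq> w3" using no_C7[of v1 v2 v3 v4 v6 v7 v8] c1 c2 by auto
  have n13: "v7 \<noteq> w3" using no_C4[of v4 v5 v6 v7] c1 c2 by auto
  have n14: "v8 \<noteq> w1" using no_C4[of v1 v2 v3 v8] c1 c2 by auto
  have n21: "v7 \<noteq> w1"
  proof
    assume e21: "v7 = w1"
    have n22: "v8 \<noteq> w2" using no_C9[of v1 v2 v3 v7 v6 v5 v4 w3 v8] c1 c2 h2 n10 n3 n5 e21 by auto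
    show False using Dv7[of v3 v6 v8 w2] c1 c2 n22 n9 e21 by auto
  qed
  have n24: "v8 \<noteq> w2" using no_C7[of v3 v4 v5 v6 v7 v8 w1] c1 c2 n21 n6 n8 by auto
  have n28: "v7 \<noteq> w2"
  proof
    assume e28: "v7 = w2"
    have n29: "v8 \<noteq> w3" using no_C9[of v1 v2 v3 w1 v7 v6 v5 v4 v8] c1 c2 h1 n1 n6 n8 e28 by auto
    show False using no_C7[of v1 v2 v3 v4 w3 v7 v8] c1 c2 n29 n3 n5 e28 by auto
  qed
  have n30: "v8 \<noteq> w3" using Dv8[of v1 v4 v7 w2] c1 c2 n2 n28 by auto
  show ?thesis using n1 h1 c2 n6 n8 n21 n14 n2 n4 n7 n9 n28 n24 n3 n5 h2 n10 n13 n30 by auto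
qed

text \<open>The two extra edges create the triangles \<open>x2 x3 y3\<close> and
  \<open>x1 x10 y10\<close>. A detour over one of them changes the length of a cycle by one, so each
  coincidence can be steered to length 4, 7 or 9, or to a 5-cycle beside a triangle.\<close>

lemma two_tens_disjoint:
  assumes h1a: "is_cycle G [x1, x2, x3, x4, x5, x6, x7, x8, x9, x10]"
    and h2a: "is_cycle G [x2, x1, y10, y9, y8, y7, y6, y5, y4, y3]"
    and h4: "adj G x3 y3"
    and h5: "adj G x10 y10"
  shows "{y3, y4, y5, y6, y7, y8, y9, y10} \<inter> {x1, x2, x3, x4, x5, x6, x7, x8, x9, x10} = {}"
proof -
  note c1 = cycle10D[OF h1a]
  note c2 = cycle10D[OF h2a]
  note x1 = h4 h4[THEN G_adj_sym[THEN iffD1]] G_adj_neq[OF h4]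
  note x2 = h5 h5[THEN G_adj_sym[THEN iffD1]] G_adj_neq[OF h5]
  have n1: "x3 \<noteq> y10" using no_C4[of x1 x2 y3 x3] c1 c2 x1 by auto
  have n2: "x3 \<noteq> y9" using no_C4[of x1 x2 x3 y10] c1 c2 by auto
  have n3: "x3 \<noteq> y8" using no_C7[of x2 x3 y7 y6 y5 y4 y3] c1 c2 by auto
  have n4: "x3 \<noteq> y7" using no_C7[of x1 x2 y3 x3 y8 y9 y10] c1 c2 x1 by auto
  have n5: "x3 \<noteq> y6" using no_C4[of x3 y3 y4 y5] c2 x1 by auto
  have n6: "x3 \<noteq> y5" using no_C4[of x2 x3 y4 y3] c1 c2 by auto
  have n7: "x3 \<noteq> y4" using no_C9[of x1 x2 x3 y5 y6 y7 y8 y9 y10] c1 c2 by auto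
  have n8: "x4 \<noteq> y10" using no_C4[of x1 x2 x3 x4] c1 c2 by auto
  have n9: "x4 \<noteq> y9" using no_C9[of x2 x3 x4 y8 y7 y6 y5 y4 y3] c1 c2 n3 n4 n5 n6 n7 x1 by auto
  have n10: "x4 \<noteq> y8" using no_C7[of x1 x2 y3 x3 x4 y9 y10] c1 c2 n1 n2 x1 by auto
  have n11: "x4 \<noteq> y7" using no_C7[of x1 x2 x3 x4 y8 y9 y10] c1 c2 n1 n2 n3 by auto
  have n12: "x4 \<noteq> y6" using no_C9[of x1 x2 y3 x3 x4 y7 y8 y9 y10] c1 c2 n1 n2 n3 n4 x1 by auto
  have n13: "x4 \<noteq> y5" using no_C4[of x3 x4 y4 y3] c1 c2 n7 x1 by auto
  have n14: "x4 \<noteq> y4" using no_C4[of x2 x3 x4 y3] c1 c2 x1 by auto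
  have n15: "x4 \<noteq> y3" using no_C9[of x1 x10 x9 x8 x7 x6 x5 x4 x2] c1 c2 by auto
  have n16: "x5 \<noteq> y10" using no_C7[of x1 x10 x9 x8 x7 x6 x5] c1 c2 by auto
  have n17: "x5 \<noteq> y9" using no_C7[of x1 x2 y3 x3 x4 x5 y10] c1 c2 n1 n15 n8 x1 by auto
  have n18: "x5 \<noteq> y8" using no_C7[of x1 x2 x3 x4 x5 y9 y10] c1 c2 n1 n2 n8 n9 by auto
  have n19: "x5 \<noteq> y7" using no_C7[of x3 x4 x5 y6 y5 y4 y3] c1 c2 n12 n13 n14 n15 n5 n6 n7 x1 by auto
  have n20: "x5 \<noteq> y6" using no_C7[of x2 x3 x4 x5 y5 y4 y3] c1 c2 n13 n14 n15 n6 n7 x1 by auto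
  have n21: "x5 \<noteq> y5" using no_C5_C3[of y3 x3 x4 x5 y4 x2] c1 c2 n14 n15 n7 x1 by auto
  have n22: "x5 \<noteq> y4" using no_C4[of x3 x4 x5 y3] c1 c2 n15 x1 by auto
  have n23: "x5 \<noteq> y3" using no_C4[of x2 x3 x4 x5] c1 c2 by auto
  have n24: "x6 \<noteq> y10" using no_C7[of x1 x2 y3 x3 x4 x5 x6] c1 c2 n15 n23 x1 by auto
  have n25: "x6 \<noteq> y9" using no_C7[of x1 x2 x3 x4 x5 x6 y10] c1 c2 n1 n16 n8 by auto
  have n26: "x6 \<noteq> y8" using no_C9[of x1 x2 y3 x3 x4 x5 x6 y9 y10] c1 c2 n1 n15 n16 n17 n2 n23 n8 n9 x1 by auto
  have n27: "x6 \<noteq> y7" using no_C9[of x1 x2 x3 x4 x5 x6 y8 y9 y10] c1 c2 n1 n10 n16 n17 n18 n2 n3 n8 n9 by auto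
  have n28: "x6 \<noteq> y6" using no_C7[of x3 x4 x5 x6 y5 y4 y3] c1 c2 n13 n14 n15 n21 n22 n23 n6 n7 x1 by auto
  have n29: "x6 \<noteq> y5" using no_C7[of x2 x3 x4 x5 x6 y4 y3] c1 c2 n14 n15 n22 n23 n7 x1 by auto
  have n30: "x6 \<noteq> y4" using no_C5_C3[of y3 x3 x4 x5 x6 x2] c1 c2 n15 n23 x1 by auto
  have n31: "x6 \<noteq> y3" using no_C4[of x3 x4 x5 x6] c1 x1 by auto
  have n32: "x7 \<noteq> y10" using no_C4[of x10 x7 x8 x9] c1 x2 by auto
  have n33: "x7 \<noteq> y9" using no_C9[of x1 x2 y3 x3 x4 x5 x6 x7 y10] c1 c2 n1 n15 n16 n23 n24 n31 n8 x1 by auto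
  have n34: "x7 \<noteq> y8" using no_C9[of x1 x2 x3 x4 x5 x6 x7 y9 y10] c1 c2 n1 n16 n17 n2 n24 n25 n8 n9 by auto
  have n35: "x7 \<noteq> y7" using no_C9[of x3 x4 x5 x6 x7 y6 y5 y4 y3] c1 c2 n12 n13 n14 n15 n20 n21 n22 n23 n28 n29 n30 n31 n5 n6 n7 x1 by auto
  have n36: "x7 \<noteq> y6" using no_C9[of x2 x3 x4 x5 x6 x7 y5 y4 y3] c1 c2 n13 n14 n15 n21 n22 n23 n29 n30 n31 n6 n7 x1 by auto
  have n37: "x7 \<noteq> y5" using no_C7[of x3 x4 x5 x6 x7 y4 y3] c1 c2 n14 n15 n22 n23 n30 n31 n7 x1 by auto
  have n38: "x7 \<noteq> y4" using no_C7[of x2 x3 x4 x5 x6 x7 y3] c1 c2 n15 n23 n31 x1 by auto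
  have n39: "x7 \<noteq> y3" using no_C7[of x1 x10 x9 x8 x7 x3 x2] c1 x1 by auto
  have n40: "x8 \<noteq> y10" using no_C4[of x1 x10 x9 x8] c1 c2 by auto
  have n41: "x8 \<noteq> y9" using no_C9[of x1 x2 x3 x4 x5 x6 x7 x8 y10] c1 c2 n1 n16 n24 n32 n8 by auto
  have n44: "x8 \<noteq> y6" using no_C9[of x3 x4 x5 x6 x7 x8 y5 y4 y3] c1 c2 n13 n14 n15 n21 n22 n23 n29 n30 n31 n37 n38 n39 n6 n7 x1 by auto
  have n45: "x8 \<noteq> y5" using no_C9[of x2 x3 x4 x5 x6 x7 x8 y4 y3] c1 c2 n14 n15 n22 n23 n30 n31 n38 n39 n7 x1 by auto
  have n46: "x8 \<noteq> y4" using no_C7[of x3 x4 x5 x6 x7 x8 y3] c1 c2 n15 n23 n31 n39 x1 by auto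
  have n47: "x8 \<noteq> y3" using no_C7[of x2 x3 x4 x5 x6 x7 x8] c1 c2 by auto
  have n48: "x9 \<noteq> y10" using no_C9[of x1 x2 x3 x4 x5 x6 x7 x8 x9] c1 c2 by auto
  have n49: "x9 \<noteq> y9" using no_C4[of x1 x10 x9 y10] c1 c2 x2 by auto
  have n53: "x9 \<noteq> y5" using no_C9[of x3 x4 x5 x6 x7 x8 x9 y4 y3] c1 c2 n14 n15 n22 n23 n30 n31 n38 n39 n46 n47 n7 x1 by auto
  have n54: "x9 \<noteq> y4" using no_C9[of x2 x3 x4 x5 x6 x7 x8 x9 y3] c1 c2 n15 n23 n31 n39 n47 x1 by auto
  have n55: "x9 \<noteq> y3" using no_C4[of x1 x10 x9 x2] c1 c2 by auto
  have n56: "x10 \<noteq> y9" using no_C9[of x1 x10 y8 y7 y6 y5 y4 y3 x2] c1 c2 by auto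
  have n57: "x10 \<noteq> y8" using no_C4[of x1 x10 y9 y10] c1 c2 by auto
  have n58: "x10 \<noteq> y7" using no_C4[of x10 y10 y9 y8] c2 x2 by auto
  have n59: "x10 \<noteq> y6" using no_C7[of x1 x2 y3 y4 y5 x10 y10] c1 c2 x2 by auto
  have n60: "x10 \<noteq> y5" using no_C7[of x1 x2 x3 y3 y4 x10 y10] c1 c2 n1 n7 x1 x2 by auto
  have n61: "x10 \<noteq> y4" using no_C4[of x1 x10 y3 x2] c1 c2 by auto
  have n62: "x10 \<noteq> y3" using no_C4[of x1 x2 x10 y10] c1 c2 x2 by auto
  have n63: "x8 \<noteq> y8" using no_C5_C3[of y10 x10 x9 x8 y9 x1] c1 c2 n48 n49 n56 x2 by auto
  have n65: "x9 \<noteq> y8" using no_C4[of x10 x9 y9 y10] c1 c2 n56 x2 by auto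
  have n66: "x9 \<noteq> y7" using no_C9[of x1 x2 y3 y4 y5 y6 x9 x10 y10] c1 c2 n59 n60 n61 n62 x2 by auto
  have n67: "x9 \<noteq> y6" using no_C7[of x1 x10 x9 y5 y4 y3 x2] c1 c2 n60 n61 n62 by auto
  have n68: "x8 \<noteq> y7" using no_C7[of x1 x10 x9 x8 y8 y9 y10] c1 c2 n48 n49 n56 n57 n65 x2 by auto
  show ?thesis using c2 x1 n7 n6 n5 n4 n3 n2 n1 n15 n14 n13 n12 n11 n10 n9 n8 n23 n22 n21 n20 n19 n18 n17 n16 n31 n30 n29 n28 n27 n26 n25 n24 n39 n38 n37 n36 n35 n34 n33 n32 n47 n46 n45 n44 n68 n63 n41 n40 n55 n54 n53 n67 n66 n65 n49 n48 n62 n61 n60 n59 n58 n57 n56 x2 by auto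
qed

end

section \<open>Adjacent faces of the block\<close>

text \<open>The plane is left behind here: faces are elements of an arbitrary type, known only
  through their boundary cycles, the two faces at each edge, the clause \<open>share\<close> on
  common corners, and Euler's formula.\<close>

locale charged_block = short_cycle_free G for G :: "'a ugraph" +
  fixes E :: "'a set set" and F :: "'f set" and cyc :: "'f \<Rightarrow> 'a list" and v0 :: 'a
  assumes E_G: "E \<subseteq> edges G"
    and finite_F: "finite F"
    and face_cycle: "f \<in> F \<Longrightarrow> is_cycle G (cyc f)"
    and face_E: "f \<in> F \<Longrightarrow> cedges (cyc f) \<subseteq> E"
    and two_faces: "e \<in> E \<Longrightarrow> card {f \<in> F. e \<in> cedges (cyc f)} = 2"
    and share: "\<lbrakk>f \<in> F; f' \<in> F; f \<noteq> f'; e1 \<noteq> e2; v \<in> e1; v \<in> e2; e1 \<in> cedges (cyc f); e1 \<in> cedges (cyc f');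
       e2 \<in> cedges (cyc f); e2 \<in> cedges (cyc f')\<rbrakk> \<Longrightarrow> card {e \<in> E. v \<in> e} = 2"
    and euler: "card (\<Union>E) + card F = card E + 2"
    and full: "v \<in> \<Union>E \<Longrightarrow> v \<noteq> v0 \<Longrightarrow> {e \<in> edges G. v \<in> e} \<subseteq> E"
    and deg3: "v \<in> verts G \<Longrightarrow> 3 \<le> vdeg G v"
    and not1: "\<not> config1 G" and not2: "\<not> config2 G" and not3: "\<not> config3 G"
begin

abbreviation bd :: "'f \<Rightarrow> 'a set set" where "bd f \<equiv> cedges (cyc f)"
abbreviation len :: "'f \<Rightarrow> nat" where "len f \<equiv> length (cyc f)"

text \<open>The vertex \<open>v0\<close> counts neither as \<open>three\<close> nor as
  \<open>four\<close>: some of its edges may lie outside the block, so its degree in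
  \<open>G\<close> says nothing about the faces around it.\<close>

definition three :: "'a \<Rightarrow> bool" where "three v \<longleftrightarrow> v \<noteq> v0 \<and> vdeg G v = 3"

abbreviation all_three :: "'f \<Rightarrow> bool" where "all_three f \<equiv> \<forall>v\<in>set (cyc f). three v"

definition four :: "'a \<Rightarrow> bool" where "four v \<longleftrightarrow> v \<noteq> v0 \<and> vdeg G v = 4"

lemma three_not_four: "three v \<Longrightarrow> \<not> four v" by (simp add: three_def four_def)

lemma finite_E: "finite E" using E_G G_finite_edges finite_subset by blast

lemma E_card2: "e \<in> E \<Longrightarrow> card e = 2" using E_G G_edge by blast

lemma E_vdeg: "v \<in> \<Union>E \<Longrightarrow> v \<noteq> v0 \<Longrightarrow> card {e \<in> E. v \<in> e} = vdeg G v"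
proof -
  assume "v \<in> \<Union>E" "v \<noteq> v0"
  then have "{e \<in> E. v \<in> e} = {e \<in> edges G. v \<in> e}" using full E_G by blast
  then show ?thesis by (simp add: vdeg_def)
qed

lemma V_verts: "v \<in> \<Union>E \<Longrightarrow> v \<in> verts G" using E_G G_edge by blast

lemma face_props:
  assumes "f \<in> F"
  shows "distinct (cyc f)" "3 \<le> len f" "len f \<noteq> 4" "len f \<noteq> 7" "len f \<noteq> 9" "bd f \<subseteq> edges G"
    "card (bd f) = len f" "set (cyc f) \<subseteq> \<Union>E"
proof -
  have c: "is_cycle G (cyc f)" by (rule face_cycle[OF assms])
  then show d: "distinct (cyc f)" "3 \<le> len f" "bd f \<subseteq> edges G" by (auto simp: is_cycle_iff)
  show "len f \<noteq> 4" "len f \<noteq> 7" "len f \<noteq> 9" using no4 no7 no9 c unfolding has_cycle_of_length_def by blast+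
  show "card (bd f) = len f" by (rule card_cedges[OF d(1,2)])
  show "set (cyc f) \<subseteq> \<Union>E" using Union_cedges[of "cyc f"] face_E[OF assms] by blast
qed

lemma face_vertex: "e \<in> bd f \<Longrightarrow> v \<in> e \<Longrightarrow> v \<in> set (cyc f)"
  using Union_cedges[of "cyc f"] by blast

text \<open>\<open>share\<close> forces degree 2 in the block, whereas every vertex other than
  \<open>v0\<close> keeps its degree of at least 3. This stands in for the cyclic order of the edges
  at a vertex.\<close>

lemma share_v0:
  assumes "f \<in> F" "f' \<in> F" "f \<noteq> f'" "e1 \<noteq> e2" "v \<in> e1" "v \<in> e2" "e1 \<in> bd f" "e1 \<in> bd f'" "e2 \<in> bd f" "e2 \<in> bd f'"
  shows "v = v0"
proof (rule ccontr)
  assume "v \<noteq> v0"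
  have v: "v \<in> \<Union>E" using assms face_E by blast
  then have "3 \<le> card {e \<in> E. v \<in> e}" using E_vdeg[OF v \<open>v \<noteq> v0\<close>] deg3[OF V_verts[OF v]] by simp
  then show False using share[OF assms] by simp
qed

definition oth :: "'f \<Rightarrow> 'a set \<Rightarrow> 'f" where
  "oth f e = (THE g. g \<in> F \<and> g \<noteq> f \<and> e \<in> bd g)"

lemma oth_ex1: "f \<in> F \<Longrightarrow> e \<in> bd f \<Longrightarrow> \<exists>!g. g \<in> F \<and> g \<noteq> f \<and> e \<in> bd g"
proof -
  assume f: "f \<in> F" "e \<in> bd f"
  then have "card {f \<in> F. e \<in> bd f} = 2" using two_faces face_E by blast
  then obtain a b where ab: "{f \<in> F. e \<in> bd f} = {a, b}" "a \<noteq> b" by (auto simp: card_2_iff)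
  then have "f \<in> {a, b}" using f by blast
  then show ?thesis
  proof
    assume "f = a" then show ?thesis using ab by (intro ex1I[of _ b]) blast+
  next
    assume "f \<in> {b}" then show ?thesis using ab by (intro ex1I[of _ a]) blast+
  qed
qed

lemma oth: "f \<in> F \<Longrightarrow> e \<in> bd f \<Longrightarrow> oth f e \<in> F \<and> oth f e \<noteq> f \<and> e \<in> bd (oth f e)"
  unfolding oth_def by (rule theI') (rule oth_ex1)

lemma oth_eqI: "f \<in> F \<Longrightarrow> e \<in> bd f \<Longrightarrow> g \<in> F \<Longrightarrow>
    g \<noteq> f \<Longrightarrow> e \<in> bd g \<Longrightarrow> oth f e = g"
  using oth_ex1 oth by blast

lemma oth_oth: "f \<in> F \<Longrightarrow> e \<in> bd f \<Longrightarrow> oth (oth f e) e = f"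
  using oth by (metis oth_eqI)

lemma face_list:
  assumes "f \<in> F" "{u, v} \<in> bd f"
  obtains r where "is_cycle G (u # v # r)" "bd f = cedges (u # v # r)" "set (cyc f) = set (u # v # r)"
    "length (u # v # r) = len f"
proof -
  have p: "distinct (cyc f)" "3 \<le> len f" using face_props[OF assms(1)] by auto
  obtain r where r: "cedges (u # v # r) = bd f" "distinct (u # v # r)" "set (u # v # r) = set (cyc f)" "length (u # v # r) = len f"
    by (rule cycle_at_edge[OF p assms(2)])
  have "is_cycle G (u # v # r)"
    by (rule is_cycleI[OF simple_G _ r(2)]) (simp_all only: r(1,4) p(2) face_props(6)[OF assms(1)])
  then show ?thesis using that[of r] r by metis
qed

lemma edge_ends:
  assumes "f \<in> F" "e \<in> bd f"
  obtains u v where "e = {u, v}" "u \<noteq> v"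
proof -
  have "card e = 2" using E_card2 face_E assms by blast
  then show ?thesis using that by (auto simp: card_2_iff)
qed

lemma edge_ends_at:
  assumes "f \<in> F" "e \<in> bd f" "v \<in> e"
  obtains u where "e = {v, u}" "u \<noteq> v"
proof -
  obtain a b where "e = {a, b}" "a \<noteq> b" by (rule edge_ends[OF assms(1,2)])
  then show ?thesis using that[of a] that[of b] assms(3) by (auto simp: insert_commute)
qed

lemma two_at: "f \<in> F \<Longrightarrow> v \<in> set (cyc f) \<Longrightarrow> card {e \<in> bd f. v \<in> e} = 2"
  by (intro cedges_degree face_props)

lemma not_three_at:
  assumes "f \<in> F" "a \<in> bd f" "b \<in> bd f" "c \<in> bd f" "v \<in> a" "v \<in> b" "v \<in> c" "a \<noteq> b"
  shows "c = a \<or> c = b"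
proof (rule ccontr)
  assume "\<not> ?thesis"
  then have "a \<noteq> c" "b \<noteq> c" by metis+
  then have "card {a, b, c} = 3" using assms(8) by simp
  moreover have "card {a, b, c} \<le> card {e \<in> bd f. v \<in> e}" using assms by (intro card_mono) auto
  ultimately show False using two_at[OF assms(1) face_vertex[OF assms(2,5)]] by simp
qed

lemma other_at:
  assumes "f \<in> F" "a \<in> bd f" "v \<in> a"
  obtains b where "b \<in> bd f" "v \<in> b" "b \<noteq> a"
proof -
  have "card {e \<in> bd f. v \<in> e} = 2" using two_at[OF assms(1) face_vertex[OF assms(2,3)]] .
  then obtain x y where xy: "{e \<in> bd f. v \<in> e} = {x, y}" "x \<noteq> y" by (auto simp: card_2_iff)
  then have "x \<in> bd f" "v \<in> x" "y \<in> bd f" "v \<in> y" by blast+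
  then show ?thesis using that xy(2) by metis
qed

section \<open>Neighbours of triangles and of 5-faces\<close>

lemma tri_len:
  assumes f: "f \<in> F" "e \<in> bd f" "len (oth f e) = 3"
  shows "10 \<le> len f"
proof (rule ccontr)
  assume n: "\<not> ?thesis"
  let ?g = "oth f e"
  have g: "?g \<in> F" "?g \<noteq> f" "e \<in> bd ?g" using oth f by auto
  obtain u v where e: "e = {u, v}" "u \<noteq> v" by (rule edge_ends[OF f(1,2)])
  obtain r where r: "is_cycle G (u # v # r)" "bd ?g = cedges (u # v # r)" "length (u # v # r) = len ?g"
    using face_list[of ?g u v] g e by metis
  then obtain w where w: "r = [w]" using f(3) by (auto simp: length_Suc_conv)
  note tc = r(1)[unfolded w]
  obtain s where s: "is_cycle G (u # v # s)" "bd f = cedges (u # v # s)" "length (u # v # s) = len f"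
    using face_list[of f u v] f e by metis
  have "len f = 3 \<or> len f = 5 \<or> len f = 6 \<or> len f = 8"
    using face_props(2-5)[OF f(1)] n by linarith
  then consider "length s = 1" | "length s = 3" | "length s = 4" | "length s = 6" using s(3) by force
  then show False
  proof cases
    case 1
    then obtain x where x: "s = [x]" by (auto simp: length_Suc_conv)
    note cs = cycle3D[OF tc] cycle3D[OF s(1)[unfolded x]]
    show False
    proof (cases "x = w")
      case True
      \<comment> \<open>Two triangles with a common apex share a corner at \<open>u\<close> and
        another one at \<open>v\<close>, and these cannot both be \<open>v0\<close>.\<close>
      have "bd f = bd ?g" using s r x w True by simp
      then have "u = v0" "v = v0"
        using share_v0[OF g(1) f(1) g(2), of "{u, v}" "{w, u}" u] share_v0[OF g(1) f(1) g(2), of "{u, v}" "{v, w}" v] cs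
        by (auto simp: r(2) w cedges_eq_pedges doubleton_eq_iff)
      then show False using e by simp
    next
      case False
      then show False using no_C4[of u w v x] cs by auto
    qed
  next
    case 2
    then obtain x y z where "s = [x, y, z]" by (auto simp: length_Suc_conv numeral_3_eq_3)
    then show False using no_triangle_beside_5 s(1) tc by blast
  next
    case 3
    then obtain x y z t where "s = [x, y, z, t]" by (auto simp: length_Suc_conv eval_nat_numeral)
    then show False using no_triangle_beside_6 s(1) tc by blast
  next
    case 4
    then obtain x y z t p q where "s = [x, y, z, t, p, q]" by (auto simp: length_Suc_conv eval_nat_numeral)
    then show False using no_triangle_beside_8 s(1) tc by blast
  qed
qed

definition tri :: "'a set \<Rightarrow> bool" where
  "tri e \<longleftrightarrow> (\<exists>g\<in>F. e \<in> bd g \<and> len g = 3)"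

lemma tri_iff: "f \<in> F \<Longrightarrow> e \<in> bd f \<Longrightarrow> tri e \<longleftrightarrow> len f = 3 \<or> len (oth f e) = 3"
  unfolding tri_def using oth oth_eqI by metis

lemma tri_len': "f \<in> F \<Longrightarrow> e \<in> bd f \<Longrightarrow> tri e \<Longrightarrow> len f = 3 \<or> 10 \<le> len f"
  using tri_iff tri_len by blast

lemma tri_oth: "f \<in> F \<Longrightarrow> e \<in> bd f \<Longrightarrow> len f = 3 \<Longrightarrow> 10 \<le> len (oth f e)"
  using tri_len[of "oth f e" e] oth oth_oth by metis

text \<open>The face across \<open>a\<close> has two of the three edges at \<open>v\<close>, and
  \<open>b\<close> is not among them by \<open>share_v0\<close>; so it has \<open>c\<close>. The
  same holds with \<open>a\<close> and \<open>b\<close> exchanged.\<close>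

lemma corner:
  assumes v: "three v" and f: "f \<in> F" and ab: "a \<in> bd f" "b \<in> bd f" "a \<noteq> b" "v \<in> a" "v \<in> b"
  obtains c where "c \<in> E" "v \<in> c" "c \<noteq> a" "c \<noteq> b" "c \<in> bd (oth f a)" "c \<in> bd (oth f b)" "oth f a \<noteq> oth f b"
    "{e \<in> E. v \<in> e} = {a, b, c}"
proof -
  have vE: "v \<in> \<Union>E" using face_E[OF f] ab by blast
  have "card {e \<in> E. v \<in> e} = 3" using E_vdeg[OF vE] v by (simp add: three_def)
  moreover have "{a, b} \<subseteq> {e \<in> E. v \<in> e}" using face_E[OF f] ab by blast
  ultimately have "card ({e \<in> E. v \<in> e} - {a, b}) = 1" using ab finite_E by (subst card_Diff_subset) auto
  then obtain c where "{e \<in> E. v \<in> e} - {a, b} = {c}" by (auto simp: card_1_singleton_iff)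
  then have c: "{e \<in> E. v \<in> e} = {a, b, c}" "c \<noteq> a" "c \<noteq> b" using \<open>{a, b} \<subseteq> _\<close> by auto
  have *: "c \<in> bd (oth f x) \<and> y \<notin> bd (oth f x)" if xy: "x = a \<and> y = b \<or> x = b \<and> y = a" for x y
  proof -
    have x: "x \<in> bd f" "y \<in> bd f" "x \<noteq> y" "v \<in> x" "v \<in> y" using xy ab by auto
    have g: "oth f x \<in> F" "oth f x \<noteq> f" "x \<in> bd (oth f x)" using oth f x by auto
    have y: "y \<notin> bd (oth f x)"
      using share_v0[OF g(1) f g(2) x(3-5) g(3) x(1)] x v by (auto simp: three_def)
    obtain d where d: "d \<in> bd (oth f x)" "v \<in> d" "d \<noteq> x" by (rule other_at[OF g(1,3) x(4)])
    then have "d \<in> {a, b, c}" using c(1) face_E[OF g(1)] by blast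
    then have "d = c" using d y xy by blast
    then show ?thesis using d y by simp
  qed
  have "oth f a \<noteq> oth f b" using *[of a b] oth[OF f ab(2)] by auto
  then show ?thesis using that[of c] c * by blast
qed

text \<open>The triangle across \<open>a\<close> also has the third edge at \<open>v\<close>, and
  there it borders on the face across \<open>b\<close>, which is therefore long.\<close>

lemma tri_corner:
  assumes v: "three v" and f: "f \<in> F" and ab: "a \<in> bd f" "b \<in> bd f" "a \<noteq> b" "v \<in> a" "v \<in> b"
    and t: "len (oth f a) = 3"
  shows "10 \<le> len (oth f b)" "\<not> tri b"
proof -
  obtain c where c: "c \<in> bd (oth f a)" "c \<in> bd (oth f b)" "oth f a \<noteq> oth f b"
    by (rule corner[OF v f ab])
  have "oth (oth f b) c = oth f a" using oth_eqI c oth f ab by metis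
  then show l: "10 \<le> len (oth f b)" using tri_len[of "oth f b" c] c oth f ab t by simp
  have "10 \<le> len f" using tri_len[OF f ab(1) t] .
  then show "\<not> tri b" using tri_iff[OF f ab(2)] l by auto
qed

lemma short_face_not_tri: "f \<in> F \<Longrightarrow> e \<in> bd f \<Longrightarrow> len f \<noteq> 3 \<Longrightarrow> len f < 10 \<Longrightarrow> \<not> tri e"
  using tri_len' by force

lemma five_six:
  assumes f: "f \<in> F" "e \<in> bd f" "len f = 5" "len (oth f e) = 6"
  shows False
proof -
  let ?g = "oth f e"
  have g: "?g \<in> F" "?g \<noteq> f" "e \<in> bd ?g" using oth f by auto
  obtain u v where e: "e = {u, v}" "u \<noteq> v" by (rule edge_ends[OF f(1,2)])
  obtain r where r: "is_cycle G (u # v # r)" "bd f = cedges (u # v # r)" "length (u # v # r) = len f"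
    using face_list[of f u v] f e by metis
  obtain a2 a3 a4 where a: "r = [a2, a3, a4]" using r(3) f(3) by (auto simp: length_Suc_conv eval_nat_numeral)
  obtain s where s: "is_cycle G (u # v # s)" "bd ?g = cedges (u # v # s)" "length (u # v # s) = len ?g"
    using face_list[of ?g u v] g e by metis
  obtain b2 b3 b4 b5 where b: "s = [b2, b3, b4, b5]" using s(3) f(4) by (auto simp: length_Suc_conv eval_nat_numeral)
  note c1 = r(1)[unfolded a] and c2 = s(1)[unfolded b]
  note d1 = cycle5D[OF c1] and d2 = cycle6D[OF c2]
  have c1r: "is_cycle G [v, u, a4, a3, a2]" and c2r: "is_cycle G [v, u, b5, b4, b3, b2]"
    using d1 d2 by (auto simp: is_cycle_pedges adj_def)
  have bf: "bd f = {{u, v}, {v, a2}, {a2, a3}, {a3, a4}, {a4, u}}" unfolding r(2) a by (auto simp: cedges_eq_pedges)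
  have bg: "bd ?g = {{u, v}, {v, b2}, {b2, b3}, {b3, b4}, {b4, b5}, {b5, u}}" unfolding s(2) b by (auto simp: cedges_eq_pedges)
  have sh: "x = v0" if "e1 \<noteq> e2" "x \<in> e1" "x \<in> e2" "e1 \<in> bd f" "e1 \<in> bd ?g" "e2 \<in> bd f" "e2 \<in> bd ?g" for x e1 e2
    using share_v0[OF f(1) g(1) g(2)[symmetric] that(1-5)] that(6,7) by simp
  \<comment> \<open>Each coincidence creates a shared corner, which must be \<open>v0\<close>. Two
    different corners cannot both be \<open>v0\<close>, so one form of the 9-cycle argument applies,
    possibly to the mirrored cycles.\<close>
  have A: "v = v0" if "a2 = b2" by (rule sh[of "{u, v}" "{v, a2}"]) (use that bf bg d1 in \<open>auto simp: doubleton_eq_iff\<close>)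
  have B: "u = v0" if "a4 = b5" by (rule sh[of "{u, v}" "{a4, u}"]) (use that bf bg d1 in \<open>auto simp: doubleton_eq_iff\<close>)
  have C: "a2 = v0" if "a2 = b2" "a3 = b3" by (rule sh[of "{v, a2}" "{a2, a3}"]) (use that bf bg d1 in \<open>auto simp: doubleton_eq_iff\<close>)
  have D: "a4 = v0" if "a3 = b4" "a4 = b5" by (rule sh[of "{a3, a4}" "{a4, u}"]) (use that bf bg d1 in \<open>auto simp: doubleton_eq_iff\<close>)
  show False
  proof (cases "a2 = b2")
    case True
    then have "a4 \<noteq> b5" "a3 \<noteq> b3" using A B C d1 by auto
    then show False using five_six_a[OF c1r c2r] by blast
  next
    case False
    show False
    proof (cases "a3 = b4")
      case True
      then have "a4 \<noteq> b5" using B D d1 by auto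
      then show False using five_six_b[OF c1 c2 False] by blast
    next
      case ne: False
      show False by (rule five_six_a[OF c1 c2 False ne])
    qed
  qed
qed

lemma five_list_at:
  assumes "f \<in> F" "len f = 5" "{v, x} \<in> bd f" "{v, y} \<in> bd f" "x \<noteq> y"
  obtains p q where "is_cycle G [v, x, p, q, y]" "bd f = {{v, x}, {x, p}, {p, q}, {q, y}, {y, v}}"
proof -
  obtain r where r: "is_cycle G (v # x # r)" "bd f = cedges (v # x # r)" "length (v # x # r) = len f"
    using face_list[of f v x] assms by metis
  obtain p q y' where a: "r = [p, q, y']" using r(3) assms(2) by (auto simp: length_Suc_conv eval_nat_numeral)
  have b: "bd f = {{v, x}, {x, p}, {p, q}, {q, y'}, {y', v}}" unfolding r(2) a by (auto simp: cedges_eq_pedges)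
  have "y' = y" using assms(4,5) cycle5D[OF r(1)[unfolded a]] unfolding b by (auto simp: doubleton_eq_iff)
  then show ?thesis using that r(1) a b by simp
qed

lemma three_fives:
  assumes v: "three v" and f: "f \<in> F" and ab: "a \<in> bd f" "b \<in> bd f" "a \<noteq> b" "v \<in> a" "v \<in> b"
    and l: "len f = 5" "len (oth f a) = 5" "len (oth f b) = 5"
  shows False
proof -
  obtain c where c: "c \<in> E" "v \<in> c" "c \<noteq> a" "c \<noteq> b" "c \<in> bd (oth f a)" "c \<in> bd (oth f b)" "oth f a \<noteq> oth f b"
    by (rule corner[OF v f ab])
  obtain x where x: "a = {v, x}" "x \<noteq> v" by (rule edge_ends_at[OF f ab(1,4)])
  obtain y where y: "b = {v, y}" "y \<noteq> v" by (rule edge_ends_at[OF f ab(2,5)])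
  let ?g = "oth f b" and ?h = "oth f a"
  have g: "?g \<in> F" "?g \<noteq> f" "b \<in> bd ?g" and h: "?h \<in> F" "?h \<noteq> f" "a \<in> bd ?h" using oth f ab by auto
  obtain z where z: "c = {v, z}" "z \<noteq> v" by (rule edge_ends_at[OF g(1) c(6,2)])
  have xyz: "x \<noteq> y" "y \<noteq> z" "z \<noteq> x" using x(1) y(1) z(1) ab(3) c(3,4) by metis+
  have m: "{v, x} \<in> bd f" "{v, y} \<in> bd f" "{v, y} \<in> bd ?g" "{v, z} \<in> bd ?g" "{v, z} \<in> bd ?h" "{v, x} \<in> bd ?h"
    using ab(1,2) g(3) c(5,6) h(3) by (simp_all only: x(1)[symmetric] y(1)[symmetric] z(1)[symmetric])
  obtain x1 x2 where X: "is_cycle G [v, x, x1, x2, y]" "bd f = {{v, x}, {x, x1}, {x1, x2}, {x2, y}, {y, v}}"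
    by (rule five_list_at[OF f l(1) m(1,2) xyz(1)])
  obtain y1 y2 where Y: "is_cycle G [v, y, y1, y2, z]" "bd ?g = {{v, y}, {y, y1}, {y1, y2}, {y2, z}, {z, v}}"
    by (rule five_list_at[OF g(1) l(3) m(3,4) xyz(2)])
  obtain z1 z2 where Z: "is_cycle G [v, z, z1, z2, x]" "bd ?h = {{v, z}, {z, z1}, {z1, z2}, {z2, x}, {x, v}}"
    by (rule five_list_at[OF h(1) l(2) m(5,6) xyz(3)])
  note d = cycle5D[OF X(1)] cycle5D[OF Y(1)] cycle5D[OF Z(1)]
  \<comment> \<open>A coincidence beyond \<open>y\<close>, \<open>z\<close> or \<open>x\<close>
    makes that vertex \<open>v0\<close>, so at most one occurs. The other two inequalities suffice
    for \<open>three_fives_normal\<close>, started at a suitable face.\<close>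
  have P: "y = v0" if "x2 = y1"
    using share_v0[OF f g(1) g(2)[symmetric], of "{v, y}" "{y, y1}" y] that d X Y
    by (auto simp: doubleton_eq_iff insert_commute)
  have Q: "z = v0" if "y2 = z1"
    using share_v0[OF g(1) h(1) c(7)[symmetric], of "{v, z}" "{z, z1}" z] that d Y Z
    by (auto simp: doubleton_eq_iff insert_commute)
  have R: "x = v0" if "x1 = z2"
    using share_v0[OF f h(1) h(2)[symmetric], of "{v, x}" "{x, x1}" x] that d X Z
    by (auto simp: doubleton_eq_iff insert_commute)
  show False
  proof (cases "x2 = y1")
    case True
    then have "x1 \<noteq> z2" "y2 \<noteq> z1" using P Q R xyz by auto
    then show False using three_fives_normal[OF Y(1) Z(1) X(1)] by metis
  next
    case False
    show False
    proof (cases "y2 = z1")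
      case True
      then have "x1 \<noteq> z2" using Q R xyz by auto
      then show False using three_fives_normal[OF Z(1) X(1) Y(1) _ False] by metis
    next
      case ne: False
      show False by (rule three_fives_normal[OF X(1) Y(1) Z(1) False ne])
    qed
  qed
qed

lemma is_cycle_rotate: "is_cycle G (A @ B) \<Longrightarrow> is_cycle G (B @ A)"
  using cedges_rotate[of A B] by (auto simp: is_cycle_iff)

text \<open>Otherwise configuration (1) occurs. The heavy apex lies on the neighbour through which
  such a 10-face drains, and there it saves a payment of 1/2.\<close>

lemma apex_not_three:
  assumes f: "f \<in> F" "e \<in> bd f" "len f = 10" "all_three f"
    and t: "len (oth f e) = 3" "w \<in> set (cyc (oth f e))" "w \<notin> e"
  shows "\<not> three w"
proof
  assume w3: "three w"
  let ?g = "oth f e"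
  have g: "?g \<in> F" "?g \<noteq> f" "e \<in> bd ?g" using oth f by auto
  obtain u v where e: "e = {u, v}" "u \<noteq> v" by (rule edge_ends[OF f(1,2)])
  obtain r where r: "is_cycle G (u # v # r)" "set (cyc f) = set (u # v # r)" "length (u # v # r) = len f"
    using face_list[of f u v] f e by metis
  obtain c2 c3 c4 c5 c6 c7 c8 c9 where a: "r = [c2, c3, c4, c5, c6, c7, c8, c9]"
    using r(3) f(3) by (auto simp: length_Suc_conv eval_nat_numeral)
  obtain s where s: "is_cycle G (u # v # s)" "set (cyc ?g) = set (u # v # s)" "length (u # v # s) = len ?g"
    using face_list[of ?g u v] g e by metis
  obtain w' where "s = [w']" using s(3) t(1) by (auto simp: length_Suc_conv)
  then have s': "s = [w]" using s(2) t e by auto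
  have "is_cycle G [c8, c9, u, v, c2, c3, c4, c5, c6, c7]"
    using is_cycle_rotate[of "[u, v, c2, c3, c4, c5, c6, c7]" "[c8, c9]"] r(1) a by simp
  moreover have "w \<notin> {u, v, c2, c3, c4, c5, c6, c7, c8, c9}"
    using apex_off_ten_cycle r(1) s(1) a s' by blast
  moreover have "adj G w u" "adj G w v" using cycle3D[OF s(1)[unfolded s']] by auto
  moreover have "\<forall>z \<in> {c8, c9, u, v, c2, c3, c4, c5, c6, c7, w}. vdeg G z = 3"
    using f(4) r(2) a w3 by (auto simp: three_def)
  ultimately have "config1 G" unfolding config1_def by blast
  then show False using not1 by simp
qed

lemma eight_five_not_three:
  assumes f: "f \<in> F" "e \<in> bd f" "len f = 8" "all_three f" and t: "len (oth f e) = 5"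
  shows "\<exists>w\<in>set (cyc (oth f e)). \<not> three w"
proof (rule ccontr)
  assume "\<not> ?thesis"
  then have w3: "\<forall>w\<in>set (cyc (oth f e)). three w" by blast
  let ?g = "oth f e"
  have g: "?g \<in> F" "?g \<noteq> f" "e \<in> bd ?g" using oth f by auto
  obtain v3 v4 where e: "e = {v3, v4}" "v3 \<noteq> v4" by (rule edge_ends[OF f(1,2)])
  obtain r where r: "is_cycle G (v3 # v4 # r)" "bd f = cedges (v3 # v4 # r)" "set (cyc f) = set (v3 # v4 # r)" "length (v3 # v4 # r) = len f"
    using face_list[of f v3 v4] f e by metis
  obtain v5 v6 v7 v8 v1 v2 where a: "r = [v5, v6, v7, v8, v1, v2]"
    using r(4) f(3) by (auto simp: length_Suc_conv eval_nat_numeral)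
  obtain s where s: "is_cycle G (v4 # v3 # s)" "bd ?g = cedges (v4 # v3 # s)" "set (cyc ?g) = set (v4 # v3 # s)" "length (v4 # v3 # s) = len ?g"
  proof -
    have "{v4, v3} \<in> bd ?g" using g(3) e(1) by (simp add: insert_commute)
    then show ?thesis using face_list[OF g(1)] that by metis
  qed
  obtain w1 w2 w3 where b: "s = [w1, w2, w3]" using s(4) t by (auto simp: length_Suc_conv eval_nat_numeral)
  have c1: "is_cycle G [v1, v2, v3, v4, v5, v6, v7, v8]"
    using is_cycle_rotate[of "[v3, v4, v5, v6, v7, v8]" "[v1, v2]"] r(1) a by simp
  have c2: "is_cycle G [v3, w1, w2, w3, v4]"
    using is_cycle_rotate[of "[v4]" "[v3, w1, w2, w3]"] s(1) b by simp
  note d1 = cycle8D[OF c1] and d2 = cycle5D[OF c2]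
  have bf: "bd f = {{v3, v4}, {v4, v5}, {v5, v6}, {v6, v7}, {v7, v8}, {v8, v1}, {v1, v2}, {v2, v3}}"
    unfolding r(2) a by (auto simp: cedges_eq_pedges)
  have bg: "bd ?g = {{v4, v3}, {v3, w1}, {w1, w2}, {w2, w3}, {w3, v4}}"
    unfolding s(2) b by (auto simp: cedges_eq_pedges)
  have t3: "three v3" "three v4" using f(4) r(3) by auto
  have h1: "v2 \<noteq> w1"
    using share_v0[OF f(1) g(1) g(2)[symmetric], of "{v3, v4}" "{v2, v3}" v3] bf bg d1 t3
    by (auto simp: doubleton_eq_iff insert_commute three_def)
  have h2: "v5 \<noteq> w3"
    using share_v0[OF f(1) g(1) g(2)[symmetric], of "{v3, v4}" "{v4, v5}" v4] bf bg d1 t3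
    by (auto simp: doubleton_eq_iff insert_commute three_def)
  have deg: "\<forall>z \<in> {v1, v2, v3, v4, v5, v6, v7, v8, w1, w2, w3}. vdeg G z = 3"
    using f(4) w3 r(3) s(3) a b by (auto simp: three_def)
  have "{w1, w2, w3} \<inter> {v1, v2, v3, v4, v5, v6, v7, v8} = {}"
    by (rule eight_five_disjoint[OF c1 c2 deg h1 h2])
  moreover have "distinct [w1, w2, w3]" "adj G v3 w1" "adj G w1 w2" "adj G w2 w3" "adj G w3 v4" using d2 by auto
  ultimately have "config3 G" unfolding config3_def using c1 deg by blast
  then show False using not3 by simp
qed

end

section \<open>Cyclic words\<close>

lemma sum_shift:
  fixes \<phi> :: "nat \<Rightarrow> 'b::comm_monoid_add"
  assumes "0 < n" "\<And>i. \<phi> (i + n) = \<phi> i"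
  shows "(\<Sum>i<n. \<phi> (i + k)) = (\<Sum>i<n. \<phi> i)"
proof (induction k)
  case (Suc k)
  obtain m where n: "n = Suc m" using assms(1) gr0_implies_Suc by blast
  have "(\<Sum>i<n. \<phi> (i + Suc k)) = (\<Sum>i<m. \<phi> (Suc i + k)) + \<phi> (k + n)"
    unfolding n by (simp add: add.commute)
  also have "\<dots> = \<phi> (0 + k) + (\<Sum>i<m. \<phi> (Suc i + k))"
    using assms(2)[of k] by (simp add: add.commute)
  also have "\<dots> = (\<Sum>i<n. \<phi> (i + k))"
    unfolding n by (rule sum.lessThan_Suc_shift[symmetric])
  finally show ?case using Suc by simp
qed simp

lemma periodic_mod:
  fixes \<phi> :: "nat \<Rightarrow> 'b"
  assumes "\<And>i. \<phi> (i + n) = \<phi> i"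
  shows "\<phi> (i mod n) = \<phi> i"
proof -
  have "\<phi> (j + k * n) = \<phi> j" for j k
  proof (induction k)
    case (Suc k)
    have "\<phi> (j + Suc k * n) = \<phi> (j + k * n + n)" by (simp add: algebra_simps)
    then show ?case using assms Suc by simp
  qed simp
  from this[of "i mod n" "i div n"] show ?thesis by simp
qed

text \<open>The word read off a face of length \<open>n\<close>: position \<open>i\<close> stands for an edge and for the vertex between
  the edges \<open>i\<close> and \<open>i + 1\<close>. The predicates mark vertices of degree 3 (\<open>t3\<close>) and edges on a triangle (\<open>T\<close>), on a
  5-face without heavy end (\<open>N\<close>), and those through which charge is drained (\<open>D\<close>).\<close>

locale cyclic_word =
  fixes n :: nat and t3 T N D :: "nat \<Rightarrow> bool"
  assumes n10: "10 \<le> n"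
    and per: "t3 (i + n) = t3 i" "T (i + n) = T i" "N (i + n) = N i" "D (i + n) = D i"
    and T1: "t3 i \<Longrightarrow> \<not> (T i \<and> T (i + 1))"
    and N1: "N (i + 1) \<Longrightarrow> t3 i \<and> t3 (i + 1) \<and> \<not> T i \<and> \<not> T (i + 1) \<and> \<not> T (i + 2)"
    and D1: "D (i + 2) \<Longrightarrow> \<not> t3 i \<and> \<not> t3 (i + 3) \<and> T (i + 1) \<and> T (i + 3)"
begin

definition A where "A i \<longleftrightarrow> t3 i \<and> (T i \<or> T (i + 1))"
definition B where "B i \<longleftrightarrow> t3 i \<and> \<not> T i \<and> \<not> T (i + 1)"
text \<open>The index refers to the edge \<open>i + 1\<close>, which joins the vertices
  \<open>i\<close> and \<open>i + 1\<close>. Through such edges a cubic 10-face draws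
  charge.\<close>

definition R where "R i \<longleftrightarrow> \<not> T (i + 1) \<and> A i \<and> A (i + 1)"

definition cnt :: "(nat \<Rightarrow> bool) \<Rightarrow> nat" where "cnt P = (\<Sum>i<n. of_bool (P i))"

lemma cnt_shift: "(\<And>i. P (i + n) = P i) \<Longrightarrow> cnt (\<lambda>i. P (i + k)) = cnt P"
  unfolding cnt_def by (rule sum_shift[of n "\<lambda>i. of_bool (P i)"]) (use n10 in auto)

lemma cnt_mono: "(\<And>i. P i \<Longrightarrow> Q i) \<Longrightarrow> cnt P \<le> cnt Q"
  unfolding cnt_def by (intro sum_mono) auto

lemma cnt_pos: "0 < cnt P \<Longrightarrow> \<exists>i. P i"
proof (rule ccontr)
  assume P: "0 < cnt P" "\<not> (\<exists>i. P i)"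
  then have "P = (\<lambda>_. False)" by auto
  then show False using P(1) by (simp add: cnt_def)
qed

lemma perA: "A (i + n) = A i" "B (i + n) = B i"
  using per(1,2)[of i] per(2)[of "i + 1"] by (simp_all add: A_def B_def algebra_simps)

lemma cnt_total: "cnt A + cnt B + cnt (\<lambda>i. \<not> t3 i) = n"
proof -
  have "cnt A + cnt B + cnt (\<lambda>i. \<not> t3 i) = (\<Sum>i<n. 1)"
    unfolding cnt_def sum.distrib[symmetric] by (intro sum.cong) (auto simp: A_def B_def)
  then show ?thesis by simp
qed

text \<open>The number of pairs of a triangle edge and an end of it that is not cubic.\<close>

definition tq where "tq = cnt (\<lambda>i. \<not> t3 i \<and> T i) + cnt (\<lambda>i. \<not> t3 i \<and> T (i + 1))"

text \<open>Count pairs of a triangle edge and one of its ends; by \<open>T1\<close> a cubic vertex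
  occurs in at most one pair. The resulting parity is decisive for lengths 10 and 11.\<close>

lemma cnt_T: "cnt A + tq = 2 * cnt T"
proof -
  have "cnt A + tq = cnt T + cnt (\<lambda>i. T (i + 1))"
    unfolding cnt_def tq_def sum.distrib[symmetric] add.assoc
    by (intro sum.cong) (use T1 in \<open>auto simp: A_def\<close>)
  then show ?thesis using cnt_shift[of T 1] per by simp
qed

lemma tq_le: "tq \<le> 2 * cnt (\<lambda>i. \<not> t3 i)"
  unfolding tq_def using cnt_mono[of "\<lambda>i. \<not> t3 i \<and> T i" "\<lambda>i. \<not> t3 i"]
    cnt_mono[of "\<lambda>i. \<not> t3 i \<and> T (i + 1)" "\<lambda>i. \<not> t3 i"] by simp

text \<open>The \<open>D\<close> edge \<open>i + 2\<close> uses two of the pairs counted by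
  \<open>tq\<close>: vertex \<open>i\<close> with the edge after it and vertex \<open>i + 3\<close>
  with the edge before it. The two kinds are counted separately, so no pair is used twice.\<close>

lemma cnt_D: "2 * cnt D \<le> tq"
proof -
  have "cnt D = cnt (\<lambda>i. D (i + 2))" using cnt_shift[of D 2] per by simp
  moreover have "cnt (\<lambda>i. D (i + 2)) \<le> cnt (\<lambda>i. \<not> t3 i \<and> T (i + 1))"
    by (rule cnt_mono) (use D1 in blast)
  moreover have "cnt (\<lambda>i. D (i + 2)) \<le> cnt (\<lambda>i. \<not> t3 (i + 3) \<and> T (i + 3))"
    by (rule cnt_mono) (use D1 in blast)
  moreover have "cnt (\<lambda>i. \<not> t3 (i + 3) \<and> T (i + 3)) = cnt (\<lambda>i. \<not> t3 i \<and> T i)"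
    using cnt_shift[of "\<lambda>i. \<not> t3 i \<and> T i" 3] per by simp
  ultimately show ?thesis by (simp add: tq_def)
qed

text \<open>Send an \<open>N\<close> edge to its left end; both of its ends are in \<open>B\<close>.
  In case of equality every vertex of \<open>B\<close> is followed by an \<open>N\<close> edge,
  hence by another vertex of \<open>B\<close>, and \<open>B\<close> runs around the whole
  cycle.\<close>

lemma cnt_N: "cnt N \<le> cnt B" "cnt N = cnt B \<Longrightarrow> 0 < cnt B \<Longrightarrow> cnt B = n"
proof -
  have sh: "cnt N = cnt (\<lambda>i. N (i + 1))" using cnt_shift[of N 1] per by simp
  have NB: "N (i + 1) \<Longrightarrow> B i \<and> B (i + 1)" for i using N1[of i] by (auto simp: B_def)
  show "cnt N \<le> cnt B" unfolding sh by (rule cnt_mono) (use NB in blast)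
  assume eq: "cnt N = cnt B" "0 < cnt B"
  have ptw: "N (i + 1) = B i" if "i < n" for i
  proof (rule ccontr)
    assume "N (i + 1) \<noteq> B i"
    then have "(\<Sum>i<n. of_bool (N (i + 1)) :: nat) < (\<Sum>i<n. of_bool (B i))"
      by (intro sum_strict_mono_ex1) (use that NB in \<open>auto intro!: bexI[of _ i]\<close>)
    then show False using eq(1) sh by (simp add: cnt_def)
  qed
  have NB': "N (i + 1) = B i" for i
    using ptw[of "i mod n"] n10 periodic_mod[of B n i] periodic_mod[of "\<lambda>i. N (i + 1)" n i] perA per(3)[of "_ + 1"]
    by (simp add: algebra_simps)
  obtain i where "B i" using cnt_pos[OF eq(2)] by blast
  have "B (i + k)" for k
  proof (induction k)
    case (Suc k)
    then have "N (i + k + 1)" using NB' by simp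
    then show ?case using NB[of "i + k"] by simp
  qed (use \<open>B i\<close> in simp)
  then have all: "B j" for j
  proof -
    have "B (i + ((n - i mod n) + j))" by fact
    moreover have "(i + ((n - i mod n) + j)) mod n = j mod n"
    proof -
      have "i + ((n - i mod n) + j) = j + n * Suc (i div n)"
        using n10 mult_div_mod_eq[of n i] mod_less_divisor[of n i] by (simp only: mult_Suc_right) linarith
      then show ?thesis by (simp only: mod_mult_self2)
    qed
    ultimately show ?thesis using periodic_mod[of B n] perA by metis
  qed
  then show "cnt B = n" by (simp add: cnt_def)
qed

lemma two_nonthree: "D (i + 2) \<Longrightarrow> 2 \<le> cnt (\<lambda>i. \<not> t3 i)"
proof -
  assume "D (i + 2)"
  then have d: "\<not> t3 (i mod n)" "\<not> t3 ((i + 3) mod n)" using D1 periodic_mod[of t3 n] per(1) by auto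
  have ne: "i mod n \<noteq> (i + 3) mod n"
  proof
    assume "i mod n = (i + 3) mod n"
    then have "n dvd (i + 3) - i" using mod_eq_dvd_iff_nat[of i "i + 3" n] by simp
    then show False using n10 dvd_imp_le[of n 3] by simp
  qed
  have "(\<Sum>j\<in>{i mod n, (i + 3) mod n}. of_bool (\<not> t3 j)) \<le> cnt (\<lambda>i. \<not> t3 i)"
    unfolding cnt_def by (rule sum_mono2) (use n10 in auto)
  then show ?thesis using d ne by simp
qed

lemma two_nonthree': "0 < cnt D \<Longrightarrow> 2 \<le> cnt (\<lambda>i. \<not> t3 i)"
proof -
  assume "0 < cnt D"
  moreover have "cnt D = cnt (\<lambda>i. D (i + 2))" using cnt_shift[of D 2] per by simp
  ultimately obtain i where "D (i + 2)" using cnt_pos[of "\<lambda>i. D (i + 2)"] by auto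
  then show ?thesis by (rule two_nonthree)
qed

text \<open>Edge by edge: an edge on no triangle joins two vertices of \<open>A\<close>, or has an
  end that is in \<open>B\<close> or not cubic; an \<open>N\<close> edge has both ends in
  \<open>B\<close>. Summing counts every vertex twice.\<close>

lemma cnt_R: "n + cnt N \<le> cnt T + cnt R + 2 * cnt B + 2 * cnt (\<lambda>i. \<not> t3 i)"
proof -
  have "(\<Sum>i<n. 1 + of_bool (N (i + 1)) :: nat) \<le>
    (\<Sum>i<n. of_bool (T (i + 1)) + of_bool (R i) + (of_bool (B i) + of_bool (B (i + 1)))
        + (of_bool (\<not> t3 i) + of_bool (\<not> t3 (i + 1))))"
  proof (rule sum_mono)
    fix i
    show "1 + of_bool (N (i + 1)) \<le> of_bool (T (i + 1)) + of_bool (R i) + (of_bool (B i) + of_bool (B (i + 1)))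
        + (of_bool (\<not> t3 i) + of_bool (\<not> t3 (i + 1)) :: nat)"
      using N1[of i] by (cases "N (i + 1)") (auto simp: R_def A_def B_def)
  qed
  then have "n + cnt (\<lambda>i. N (i + 1)) \<le> cnt (\<lambda>i. T (i + 1)) + cnt R + (cnt B + cnt (\<lambda>i. B (i + 1)))
     + (cnt (\<lambda>i. \<not> t3 i) + cnt (\<lambda>i. \<not> t3 (i + 1)))"
    by (simp only: sum.distrib cnt_def sum_constant card_lessThan mult_1_right of_nat_id)
  then show ?thesis
    using cnt_shift[of N 1] cnt_shift[of T 1] cnt_shift[of B 1] cnt_shift[of "\<lambda>i. \<not> t3 i" 1] per perA by simp
qed

text \<open>The face pays 1/2, 1/3 and 1/5 per vertex in \<open>A\<close>, edge in \<open>N\<close> and edge in \<open>D\<close>, out of its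
  charge \<open>n - 6\<close>; the inequalities are scaled by 30.\<close>

theorem cost_cases:
  defines "h \<equiv> cnt A" and "s \<equiv> cnt N" and "r \<equiv> cnt D" and "q \<equiv> cnt (\<lambda>i. \<not> t3 i)"
  shows "15 * h + 10 * s + 6 * r + 180 \<le> 30 * n
    \<or> n = 10 \<and> q = 0 \<and> 15 * h + 10 * s + 6 * r \<le> 120 + 6 * cnt R
    \<or> n = 10 \<and> q = 1 \<and> h = 9 \<and> s = 0 \<and> r = 0 \<and> tq = 1
    \<or> n = 10 \<and> q = 2 \<and> 0 < r"
proof -
  define b t \<rho> where "b = cnt B" and "t = cnt T" and "\<rho> = cnt R"
  have e1: "h + b + q = n" using cnt_total by (simp add: h_def b_def q_def)
  have e2: "h + tq = 2 * t" using cnt_T by (simp add: h_def t_def)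
  have e3: "tq \<le> 2 * q" "2 * r \<le> tq" using tq_le cnt_D by (auto simp: q_def r_def)
  have e5: "r = 0 \<or> 2 \<le> q" using two_nonthree' by (auto simp: r_def q_def)
  have e7: "n + s \<le> t + \<rho> + 2 * b + 2 * q" using cnt_R by (simp add: b_def s_def q_def t_def \<rho>_def)
  have e4: "s < b \<or> b = 0 \<and> s = 0 \<or> s = n \<and> b = n" 
    using cnt_N unfolding s_def b_def by (metis le_neq_implies_less le_zero_eq neq0_conv)
  have ok: ?thesis if "15 * h + 10 * s + 6 * r + 180 \<le> 30 * n" using that by blast
  have sb: "s \<le> b" using e4 by linarith
  consider "12 \<le> n" | "n = 11" | "n = 10" using n10 by linarith
  then show ?thesis
  proof cases
    case 1
    \<comment> \<open>Each position costs at most 15, and 15 n is at most 30 n - 180 from n = 12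
      on.\<close>
    then show ?thesis using e1 e3 sb by (intro ok) linarith
  next
    case 2
    consider "2 \<le> q" | "q = 1" | "q = 0" by linarith
    then show ?thesis
    proof cases
      case 1 then show ?thesis using 2 e1 e3 sb by (intro ok) linarith
    next
      case q: 2
      then have "r = 0" using e5 by simp
      then show ?thesis using 2 q e1 e4 by (intro ok) linarith
    next
      case q: 3
      then have r: "r = 0" "h = 2 * t" using e5 e2 e3 by auto
      \<comment> \<open>Eleven cubic vertices cannot be paired off along triangle edges, so one of
        them is in \<open>B\<close>, and this saves enough.\<close>
      have "b \<noteq> 0"
      proof
        assume "b = 0"
        then have "2 * t = 11" using r e1 2 q by simp
        then show False by presburger
      qed
      then show ?thesis using 2 q r e1 e4 by (intro ok) linarith
    qed
  next
    case 3
    consider "4 \<le> q" | "q = 3" | "q = 2" | "q = 1" | "q = 0" by linarith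
    then show ?thesis
    proof cases
      case 1 then show ?thesis using 3 e1 e3 sb by (intro ok) linarith
    next
      case q: 2
      show ?thesis
      proof (cases "b = 0")
        case True
        then have h: "h = 7" using e1 3 q by simp
        \<comment> \<open>Parity excludes \<open>r = 3\<close>, for which the cost 105 + 18 would
          exceed the 120 available.\<close>
        have "tq \<noteq> 6"
        proof
          assume "tq = 6"
          then have "2 * t = 13" using e2 h by simp
          then show False by presburger
        qed
        then have "r \<le> 2" using e3 q by simp
        then show ?thesis using True sb 3 h by (intro ok) simp
      next
        case False
        then have "s < b" using e4 e1 3 q by linarith
        then show ?thesis using False e1 e3 3 q by (intro ok) linarith
      qed
    next
      case q: 3
      show ?thesis
      proof (cases "r = 0")
        case True
        then show ?thesis using 3 q e1 e4 by (intro ok) linarith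
      next
        case False
        then show ?thesis using 3 q by simp
      qed
    next
      case q: 4
      then have r: "r = 0" using e5 by simp
      show ?thesis
      proof (cases "b = 0")
        case True
        then have h: "h = 9" using e1 3 q by simp
        have "tq \<noteq> 0" "tq \<noteq> 2" using e2 h by presburger+
        then have "tq = 1" using e3 q by simp
        then show ?thesis using q 3 r h True sb by simp
      next
        case False
        then show ?thesis using 3 q r e1 e4 by (intro ok) linarith
      qed
    next
      case q: 5
      then have r: "r = 0" "h = 2 * t" using e5 e2 e3 by auto
      \<comment> \<open>The tight case is \<open>b = 0\<close>: five triangle edges cost 150 instead
        of 120, and \<open>cnt_R\<close> yields five edges in \<open>R\<close>, which bring in
        exactly the missing 30.\<close>
      have "15 * h + 10 * s + 6 * r \<le> 120 + 6 * \<rho>"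
      proof (cases "b = 0")
        case True
        then show ?thesis using 3 q r e1 e7 sb by linarith
      next
        case False
        have "b \<noteq> 1" "b \<noteq> 3" using e1 3 q r by presburger+
        then consider "b = 2" | "4 \<le> b" using False by linarith
        then show ?thesis
        proof cases
          case 1
          then consider "s = 0" | "s = 1" using e4 3 by linarith
          then show ?thesis
          proof cases
            case 1 then show ?thesis using \<open>b = 2\<close> 3 q r e1 by linarith
          next
            case 2 then show ?thesis using \<open>b = 2\<close> 3 q r e1 e7 by linarith
          qed
        next
          case 2
          then show ?thesis using 3 q r e1 e4 by linarith
        qed
      qed
      then show ?thesis using q 3 by (simp add: \<rho>_def)
    qed
  qed
qed

end

section \<open>Discharging\<close>

context charged_block
begin

section \<open>The rules for moving charge\<close>

definition on_tri :: "'a \<Rightarrow> 'f \<Rightarrow> bool" where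
  "on_tri v f \<longleftrightarrow> (\<exists>e\<in>bd f. v \<in> e \<and> tri e)"

text \<open>What \<open>v\<close> sends to the face \<open>f\<close> through the edge \<open>e\<close>. A vertex of degree 4 spends exactly 1/2 per edge.
  It favours a face that touches a triangle at \<open>v\<close>, at the expense of a long face that does not. The exceptional
  vertex \<open>v0\<close>, whose degree in the block may be 2, behaves like a vertex of large degree and may go into debt.\<close>

definition gift :: "'a \<Rightarrow> 'a set \<Rightarrow> 'f \<Rightarrow> real" where
  "gift v e f = (if three v then 0
     else if len f = 3 then 1/2
     else if \<not> four v then 1/4
     else if tri e then 0
     else if on_tri v f \<and> \<not> on_tri v (oth f e) \<and> 10 \<le> len (oth f e) then 1/2
     else if on_tri v (oth f e) \<and> \<not> on_tri v f \<and> 10 \<le> len f then 0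
     else 1/4)"

text \<open>A 10-face all of whose vertices have degree 3 can meet five triangles, one more than it can afford;
  it draws 1/5 through each edge between two of them.\<close>

definition drain :: "'f \<Rightarrow> 'a set \<Rightarrow> bool" where
  "drain f e \<longleftrightarrow> len f = 10 \<and> all_three f \<and> \<not> tri e \<and> (\<forall>v\<in>e. on_tri v f)"

definition heavy :: "'f \<Rightarrow> nat" where
  "heavy f = card {v \<in> set (cyc f). \<not> three v}"

text \<open>In a triangle each pair of an edge and an end is served with 1/2, by the face across if
  the end is \<open>three\<close> and by the end itself otherwise. A 5-face lacks 1: without heavy
  vertex it has at least three long neighbours paying 1/3; with one, this vertex gives 1/4 through
  each of its two edges and at least two long neighbours pay 1/4; two or more heavy vertices give
  1/2 each and suffice alone.\<close>

definition pay :: "'f \<Rightarrow> 'a set \<Rightarrow> real" where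
  "pay f e = (let g = oth f e in
     if len g = 3 then (\<Sum>v\<in>e. if three v then 1/2 else 0)
     else if len g = 5 \<and> 8 \<le> len f then (if heavy g = 0 then 1/3 else if heavy g = 1 then 1/4 else 0)
     else if drain g e then 1/5 else 0)"

definition net :: "'f \<Rightarrow> 'a set \<Rightarrow> real" where
  "net f e = (\<Sum>v\<in>e. gift v e f) + pay (oth f e) e - pay f e"

lemma gift_nonneg: "0 \<le> gift v e f"
  by (simp add: gift_def)

lemma pay_nonneg: "0 \<le> pay f e"
  by (simp add: pay_def Let_def sum_nonneg)

lemma finite_edge: "e \<in> E \<Longrightarrow> finite e"
  using E_card2 card.infinite by fastforce

lemma faces_at_edge: "f \<in> F \<Longrightarrow> e \<in> bd f \<Longrightarrow> {f \<in> F. e \<in> bd f} = {f, oth f e}"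
  using oth oth_eqI by blast

lemma edge_face: "e \<in> E \<Longrightarrow> \<exists>f\<in>F. e \<in> bd f"
  using two_faces[of e] by (metis (mono_tags, lifting) card.empty empty_Collect_eq zero_neq_numeral)

text \<open>The largest outlay is 1/2 for a triangle and 1/4 for the face opposite. A vertex of
  degree 4 gives nothing to the latter, and on an edge without triangle its two exceptional rules
  balance: one side gains what the other loses.\<close>

lemma gift_edge_sum:
  assumes "e \<in> E" "v \<in> e"
  defines "S \<equiv> \<Sum>f\<in>{f \<in> F. e \<in> bd f}. gift v e f"
  shows "S \<le> 3/4" "four v \<Longrightarrow> S \<le> 1/2" "three v \<Longrightarrow> S = 0"
proof -
  obtain f where f: "f \<in> F" "e \<in> bd f" using edge_face assms(1) by blast
  let ?g = "oth f e"
  have g: "?g \<in> F" "?g \<noteq> f" "e \<in> bd ?g" "oth ?g e = f" using oth oth_oth f by auto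
  have S: "S = gift v e f + gift v e ?g"
    unfolding S_def faces_at_edge[OF f] using g(2) by simp
  have n: "\<not> (len f = 3 \<and> len ?g = 3)" using tri_oth[OF f] by auto
  have t: "tri e \<longleftrightarrow> len f = 3 \<or> len ?g = 3" by (rule tri_iff[OF f])
  show "three v \<Longrightarrow> S = 0" unfolding S by (simp add: gift_def)
  show four: "S \<le> 1/2" if v: "four v"
  proof -
    have "\<not> three v" using v three_not_four by blast
    show ?thesis
    proof (cases "tri e")
      case True
      then show ?thesis unfolding S using n t v \<open>\<not> three v\<close> by (auto simp: gift_def g(4))
    next
      case False
      then show ?thesis unfolding S using t v \<open>\<not> three v\<close> by (auto simp: gift_def g(4))
    qed
  qed
  show "S \<le> 3/4"
  proof (cases "three v \<or> four v")
    case True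
    then show ?thesis using four \<open>three v \<Longrightarrow> S = 0\<close> by fastforce
  next
    case False
    then show ?thesis unfolding S using n by (auto simp: gift_def)
  qed
qed

text \<open>With 3/4 spent per edge, 2d - 6 - 3d/4 is nonnegative from degree 5 on; with 1/2 per
  edge, degree 4 ends at exactly 0. For \<open>v0\<close>, whatever its degree in the block, 3/4 per
  edge leaves at least -6.\<close>

lemma vertex_charge:
  assumes v: "v \<in> \<Union>E"
  defines "c \<equiv> 2 * real (card {e \<in> E. v \<in> e}) - 6 - (\<Sum>e\<in>{e \<in> E. v \<in> e}. \<Sum>f\<in>{f \<in> F. e \<in> bd f}. gift v e f)"
  shows "v \<noteq> v0 \<Longrightarrow> 0 \<le> c" "-6 \<le> c"
proof -
  let ?D = "{e \<in> E. v \<in> e}"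
  have *: "(\<Sum>e\<in>?D. \<Sum>f\<in>{f \<in> F. e \<in> bd f}. gift v e f) \<le> real (card ?D) * k"
    if "\<And>e. e \<in> E \<Longrightarrow> v \<in> e \<Longrightarrow> (\<Sum>f\<in>{f \<in> F. e \<in> bd f}. gift v e f) \<le> k" for k
    by (rule sum_bounded_above) (use that in auto)
  have b: "(\<Sum>e\<in>?D. \<Sum>f\<in>{f \<in> F. e \<in> bd f}. gift v e f) \<le> real (card ?D) * (3/4)"
    by (rule *) (rule gift_edge_sum)
  then show "-6 \<le> c" unfolding c_def by simp
  assume nv: "v \<noteq> v0"
  have d: "card ?D = vdeg G v" "3 \<le> vdeg G v" using E_vdeg[OF v nv] deg3 V_verts[OF v] by auto
  consider "three v" | "four v" | "5 \<le> vdeg G v" using d nv unfolding three_def four_def by linarith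
  then show "0 \<le> c"
  proof cases
    case 1
    then have "(\<Sum>e\<in>?D. \<Sum>f\<in>{f \<in> F. e \<in> bd f}. gift v e f) \<le> real (card ?D) * 0"
      by (intro *) (simp add: gift_edge_sum(3))
    then show ?thesis unfolding c_def using d by simp
  next
    case 2
    then have "(\<Sum>e\<in>?D. \<Sum>f\<in>{f \<in> F. e \<in> bd f}. gift v e f) \<le> real (card ?D) * (1/2)"
      by (intro *) (rule gift_edge_sum(2))
    then show ?thesis unfolding c_def using d 2 by (simp add: four_def)
  next
    case 3
    then show ?thesis unfolding c_def using b d by simp
  qed
qed

lemma finite_V: "finite (\<Union>E)"
  using finite_E finite_edge by blast

text \<open>Gifts only move charge, and payments cancel because crossing an edge is an involution on
  the pairs of a face and an edge of it. There remains -6 times V - E + F.\<close>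

lemma total_charge:
  "(\<Sum>v\<in>\<Union>E. 2 * real (card {e \<in> E. v \<in> e}) - 6 - (\<Sum>e\<in>{e \<in> E. v \<in> e}. \<Sum>f\<in>{f \<in> F. e \<in> bd f}. gift v e f))
    + (\<Sum>f\<in>F. real (len f) - 6 + (\<Sum>e\<in>bd f. net f e)) = -12"
proof -
  let ?V = "\<Union>E"
  have V: "{v \<in> ?V. v \<in> e} = e" if "e \<in> E" for e using that by auto
  have B: "{e \<in> E. e \<in> bd f} = bd f" if "f \<in> F" for f using face_E[OF that] by auto
  have "(\<Sum>v\<in>?V. real (card {e \<in> E. v \<in> e})) = (\<Sum>v\<in>?V. \<Sum>e\<in>E. if v \<in> e then 1 else 0)"
    using finite_E by (intro sum.cong) (simp_all add: sum.inter_filter[symmetric])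
  also have "\<dots> = (\<Sum>e\<in>E. \<Sum>v\<in>?V. if v \<in> e then 1 else 0)" by (rule sum.swap)
  also have "\<dots> = (\<Sum>e\<in>E. real (card {v \<in> ?V. v \<in> e}))"
    using finite_V by (intro sum.cong) (simp_all add: sum.inter_filter[symmetric])
  also have "\<dots> = (\<Sum>e\<in>E. 2)" using V E_card2 by (intro sum.cong) simp_all
  finally have sv: "(\<Sum>v\<in>?V. real (card {e \<in> E. v \<in> e})) = 2 * card E" by simp
  have "(\<Sum>f\<in>F. real (len f)) = (\<Sum>f\<in>F. real (card {e \<in> E. e \<in> bd f}))"
    using face_props(7) B by (intro sum.cong) simp_all
  also have "\<dots> = (\<Sum>f\<in>F. \<Sum>e\<in>E. if e \<in> bd f then 1 else 0)"
    using finite_E by (intro sum.cong) (simp_all add: sum.inter_filter[symmetric])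
  also have "\<dots> = (\<Sum>e\<in>E. \<Sum>f\<in>F. if e \<in> bd f then 1 else 0)" by (rule sum.swap)
  also have "\<dots> = (\<Sum>e\<in>E. real (card {f \<in> F. e \<in> bd f}))"
    using finite_F by (intro sum.cong) (simp_all add: sum.inter_filter[symmetric])
  also have "\<dots> = (\<Sum>e\<in>E. 2)" using two_faces by (intro sum.cong) simp_all
  finally have sf: "(\<Sum>f\<in>F. real (len f)) = 2 * card E" by simp
  have "(\<Sum>v\<in>?V. \<Sum>e\<in>{e \<in> E. v \<in> e}. \<Sum>f\<in>{f \<in> F. e \<in> bd f}. gift v e f)
      = (\<Sum>v\<in>?V. \<Sum>e\<in>E. \<Sum>f\<in>F. if v \<in> e \<and> e \<in> bd f then gift v e f else 0)"
    using finite_E finite_F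
    by (simp add: sum.inter_filter if_distrib[of "sum _"] cong: if_cong)
      (intro sum.cong refl, auto intro!: sum.neutral)
  also have "\<dots> = (\<Sum>e\<in>E. \<Sum>v\<in>?V. \<Sum>f\<in>F. if v \<in> e \<and> e \<in> bd f then gift v e f else 0)" by (rule sum.swap)
  also have "\<dots> = (\<Sum>e\<in>E. \<Sum>f\<in>F. \<Sum>v\<in>?V. if v \<in> e \<and> e \<in> bd f then gift v e f else 0)"
    by (intro sum.cong refl) (rule sum.swap)
  also have "\<dots> = (\<Sum>f\<in>F. \<Sum>e\<in>E. \<Sum>v\<in>?V. if v \<in> e \<and> e \<in> bd f then gift v e f else 0)" by (rule sum.swap)
  also have "\<dots> = (\<Sum>f\<in>F. \<Sum>e\<in>bd f. \<Sum>v\<in>e. gift v e f)"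
  proof (rule sum.cong[OF refl])
    fix f assume f: "f \<in> F"
    have "(\<Sum>e\<in>E. \<Sum>v\<in>?V. if v \<in> e \<and> e \<in> bd f then gift v e f else 0)
       = (\<Sum>e\<in>E. if e \<in> bd f then (\<Sum>v\<in>?V. if v \<in> e then gift v e f else 0) else 0)"
      by (intro sum.cong) auto
    also have "\<dots> = (\<Sum>e\<in>bd f. \<Sum>v\<in>?V. if v \<in> e then gift v e f else 0)"
      using finite_E by (subst sum.inter_filter[symmetric]) (simp_all add: B[OF f])
    also have "\<dots> = (\<Sum>e\<in>bd f. \<Sum>v\<in>e. gift v e f)"
    proof (rule sum.cong[OF refl])
      fix e assume "e \<in> bd f"
      then have "e \<in> E" using face_E[OF f] by blast
      then show "(\<Sum>v\<in>?V. if v \<in> e then gift v e f else 0) = (\<Sum>v\<in>e. gift v e f)"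
        by (simp only: sum.inter_filter[OF finite_V, symmetric] V)
    qed
    finally show "(\<Sum>e\<in>E. \<Sum>v\<in>?V. if v \<in> e \<and> e \<in> bd f then gift v e f else 0) = (\<Sum>e\<in>bd f. \<Sum>v\<in>e. gift v e f)" .
  qed
  finally have sg: "(\<Sum>v\<in>?V. \<Sum>e\<in>{e \<in> E. v \<in> e}. \<Sum>f\<in>{f \<in> F. e \<in> bd f}. gift v e f)
      = (\<Sum>f\<in>F. \<Sum>e\<in>bd f. \<Sum>v\<in>e. gift v e f)" .
  have "(\<Sum>f\<in>F. \<Sum>e\<in>bd f. pay (oth f e) e) = (\<Sum>(f, e)\<in>Sigma F bd. pay (oth f e) e)"
    using finite_F by (subst sum.Sigma) auto
  also have "\<dots> = (\<Sum>(f, e)\<in>Sigma F bd. pay f e)"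
    by (rule sum.reindex_bij_witness[where i = "\<lambda>(f, e). (oth f e, e)" and j = "\<lambda>(f, e). (oth f e, e)"])
      (auto simp: oth oth_oth)
  also have "\<dots> = (\<Sum>f\<in>F. \<Sum>e\<in>bd f. pay f e)"
    using finite_F by (subst sum.Sigma) auto
  finally have sp: "(\<Sum>f\<in>F. \<Sum>e\<in>bd f. pay (oth f e) e) = (\<Sum>f\<in>F. \<Sum>e\<in>bd f. pay f e)" .
  have "(\<Sum>f\<in>F. \<Sum>e\<in>bd f. net f e) = (\<Sum>f\<in>F. \<Sum>e\<in>bd f. \<Sum>v\<in>e. gift v e f)"
    using sp by (simp add: net_def sum.distrib sum_subtractf)
  moreover have "(\<Sum>v\<in>?V. 2 * real (card {e \<in> E. v \<in> e}) - 6) = 4 * card E - 6 * real (card ?V)"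
    using sv by (simp add: sum_subtractf sum_distrib_left[symmetric])
  moreover have "(\<Sum>f\<in>F. real (len f) - 6) = 2 * card E - 6 * real (card F)"
    using sf by (simp add: sum_subtractf)
  moreover have "real (card ?V) + real (card F) = real (card E) + 2" using euler by linarith
  ultimately show ?thesis using sg by (simp add: sum.distrib sum_subtractf)
qed

text \<open>At the end \<open>x\<close>, the draining face has a triangle across its other edge
  \<open>a\<close>; the third edge \<open>c\<close> at \<open>x\<close> lies both on this triangle
  and on \<open>f\<close>. The apex \<open>y\<close> is heavy by \<open>apex_not_three\<close>, and
  the side \<open>zy\<close> is one of the two extra edges of configuration (2).\<close>

lemma drain_corner:
  assumes f: "f \<in> F" "e \<in> bd f" "drain (oth f e) e" "x \<in> e"
  obtains a c y z where "c \<in> bd f" "c \<noteq> e" "tri c" "c = {x, y}" "y \<noteq> x" "\<not> three y" "three x"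
    "a \<in> bd (oth f e)" "a \<noteq> e" "a = {x, z}" "{z, y} \<in> edges G"
proof -
  let ?g = "oth f e"
  have g: "?g \<in> F" "?g \<noteq> f" "e \<in> bd ?g" "oth ?g e = f" using oth oth_oth f by auto
  have dr: "len ?g = 10" "all_three ?g" "\<not> tri e" "on_tri x ?g"
    using f(3,4) by (auto simp: drain_def)
  have x3: "three x" using dr(2) face_vertex[OF g(3) f(4)] by blast
  obtain a where a: "a \<in> bd ?g" "x \<in> a" "tri a" using dr(4) by (auto simp: on_tri_def)
  have ae: "a \<noteq> e" using a dr by auto
  let ?t = "oth ?g a"
  have t: "?t \<in> F" "a \<in> bd ?t" "len ?t = 3" using oth[OF g(1) a(1)] tri_iff[OF g(1) a(1)] a(3) dr(1) by auto
  obtain c where c: "x \<in> c" "c \<noteq> a" "c \<noteq> e" "c \<in> bd ?t" "c \<in> bd f"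
    using corner[OF x3 g(1) a(1) g(3) ae a(2) f(4)] g(4) by metis
  have tc: "tri c" using t c by (auto simp: tri_def)
  obtain y where y: "c = {x, y}" "y \<noteq> x" by (rule edge_ends_at[OF f(1) c(5,1)])
  obtain z where z: "a = {x, z}" "z \<noteq> x" by (rule edge_ends_at[OF g(1) a(1,2)])
  have yz: "y \<noteq> z" using y z c by auto
  have "y \<in> set (cyc ?t)" using face_vertex[OF c(4)] y by auto
  moreover have "y \<notin> a" using y z yz by auto
  ultimately have "\<not> three y" using apex_not_three[OF g(1) a(1) dr(1,2) t(3)] by blast
  moreover have "{z, y} \<in> edges G"
  proof -
    have "{x, z} \<in> bd ?t" using t z by simp
    then obtain r where r: "is_cycle G (x # z # r)" "bd ?t = cedges (x # z # r)" "length (x # z # r) = len ?t"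
      using face_list[OF t(1)] by metis
    then obtain w where w: "r = [w]" using t(3) by (auto simp: length_Suc_conv)
    have "{x, y} \<in> cedges [x, z, w]" using c(4) r(2) w y by simp
    then have "y = w" using yz y(2) z by (auto simp: cedges_eq_pedges doubleton_eq_iff)
    then show ?thesis using cycle3D[OF r(1)[unfolded w]] by (simp add: adj_def)
  qed
  ultimately show ?thesis using that c a ae y z tc x3 by blast
qed

text \<open>\<open>f\<close> has a triangle edge next to \<open>e\<close> but is not a triangle
  itself, as \<open>e\<close> lies on none.\<close>

lemma drain_len: "f \<in> F \<Longrightarrow> e \<in> bd f \<Longrightarrow> drain (oth f e) e \<Longrightarrow> 10 \<le> len f"
proof -
  assume f: "f \<in> F" "e \<in> bd f" "drain (oth f e) e"
  obtain x x' where "e = {x, x'}" by (rule edge_ends[OF f(1,2)])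
  then obtain c where "c \<in> bd f" "tri c" using drain_corner[OF f, of x] by blast
  moreover have "\<not> tri e" using f(3) by (simp add: drain_def)
  then have "len f \<noteq> 3" using tri_iff[OF f(1,2)] by blast
  ultimately show ?thesis using tri_len'[OF f(1)] by blast
qed

section \<open>Final charge of faces of length 3 to 8\<close>

lemma pay_small: "f \<in> F \<Longrightarrow> e \<in> bd f \<Longrightarrow> len f < 8 \<Longrightarrow> pay f e = 0"
  using drain_len[of f e] tri_len[of f e] by (auto simp: pay_def Let_def)

lemma sum_edge_vertex:
  fixes \<phi> :: "'a \<Rightarrow> real"
  assumes f: "f \<in> F"
  shows "(\<Sum>e\<in>bd f. \<Sum>v\<in>e. \<phi> v) = 2 * (\<Sum>v\<in>set (cyc f). \<phi> v)"
proof -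
  have "(\<Sum>e\<in>bd f. \<Sum>v\<in>e. \<phi> v) = (\<Sum>e\<in>bd f. \<Sum>v\<in>set (cyc f). if v \<in> e then \<phi> v else 0)"
  proof (rule sum.cong[OF refl])
    fix e assume "e \<in> bd f"
    then have "{v \<in> set (cyc f). v \<in> e} = e" using face_vertex by blast
    then show "(\<Sum>v\<in>e. \<phi> v) = (\<Sum>v\<in>set (cyc f). if v \<in> e then \<phi> v else 0)"
      by (subst sum.inter_filter[symmetric]) simp_all
  qed
  also have "\<dots> = (\<Sum>v\<in>set (cyc f). \<Sum>e\<in>bd f. if v \<in> e then \<phi> v else 0)" by (rule sum.swap)
  also have "\<dots> = (\<Sum>v\<in>set (cyc f). 2 * \<phi> v)"
  proof (rule sum.cong[OF refl])
    fix v assume "v \<in> set (cyc f)"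
    then show "(\<Sum>e\<in>bd f. if v \<in> e then \<phi> v else 0) = 2 * \<phi> v"
      using two_at[OF f] by (subst sum.inter_filter[symmetric]) simp_all
  qed
  finally show ?thesis by (simp add: sum_distrib_left)
qed

lemma triangle_charge:
  assumes f: "f \<in> F" "len f = 3"
  shows "0 \<le> real (len f) - 6 + (\<Sum>e\<in>bd f. net f e)"
proof -
  \<comment> \<open>Both ends of the edge bring in 1/2, and the triangle pays nothing.\<close>
  have "net f e = 1" if e: "e \<in> bd f" for e
  proof -
    have "len (oth f e) \<ge> 10" by (rule tri_oth[OF f(1) e f(2)])
    then have "pay (oth f e) e = (\<Sum>v\<in>e. if three v then 1/2 else 0)"
      using oth_oth[OF f(1) e] f(2) by (simp add: pay_def)
    moreover have "(\<Sum>v\<in>e. gift v e f) = (\<Sum>v\<in>e. if three v then 0 else 1/2)"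
      using f(2) by (intro sum.cong) (auto simp: gift_def)
    moreover have "(\<Sum>v\<in>e. if three v then 0 else 1/2) + (\<Sum>v\<in>e. if three v then 1/2 else 0) = (\<Sum>v\<in>e. 1/2 :: real)"
      unfolding sum.distrib[symmetric] by (intro sum.cong) auto
    ultimately show ?thesis using pay_small[OF f(1) e] f(2) E_card2[of e] face_E[OF f(1)] e
      by (auto simp: net_def)
  qed
  then show ?thesis using f face_props(7)[OF f(1)] by simp
qed

lemma gift_short:
  assumes "f \<in> F" "e \<in> bd f" "len f \<noteq> 3" "len f < 10" "\<not> three v"
  shows "1/4 \<le> gift v e f"
  using short_face_not_tri[OF assms(1-4)] assms(3-5) by (auto simp: gift_def)

lemma six_charge:
  assumes f: "f \<in> F" "len f = 6"
  shows "0 \<le> real (len f) - 6 + (\<Sum>e\<in>bd f. net f e)"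
proof -
  have "0 \<le> net f e" if "e \<in> bd f" for e
    using pay_small[OF f(1) that] f(2) gift_nonneg pay_nonneg unfolding net_def by (simp add: sum_nonneg)
  then show ?thesis using f(2) by (simp add: sum_nonneg)
qed

text \<open>The face owns 2. If all its vertices are cubic, every 5-face across has a heavy vertex
  since configuration (3) is absent, and eight payments of at most 1/4 are affordable. Otherwise the
  two edges at a heavy vertex \<open>v\<close> cost nothing, because a 5-face there contains
  \<open>v\<close> and \<open>v\<close> refunds its 1/4; six payments of at most 1/3 remain.\<close>

lemma eight_charge:
  assumes f: "f \<in> F" "len f = 8"
  shows "0 \<le> real (len f) - 6 + (\<Sum>e\<in>bd f. net f e)"
proof -
  have pay: "pay f e = (if len (oth f e) = 5 then (if heavy (oth f e) = 0 then 1/3 else if heavy (oth f e) = 1 then 1/4 else 0) else 0)"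
    if "e \<in> bd f" for e
    using drain_len[OF f(1) that] tri_len[OF f(1) that] f(2) by (auto simp: pay_def Let_def)
  have hv: "heavy g \<noteq> 0" if "v \<in> set (cyc g)" "\<not> three v" for g v
    using that by (auto simp: heavy_def)
  show ?thesis
  proof (cases "all_three f")
    case True
    have "-1/4 \<le> net f e" if e: "e \<in> bd f" for e
    proof -
      have "pay f e \<le> 1/4"
      proof (cases "len (oth f e) = 5")
        case five: True
        then obtain w where "w \<in> set (cyc (oth f e))" "\<not> three w"
          using eight_five_not_three[OF f(1) e f(2) True] by blast
        then have "heavy (oth f e) \<noteq> 0" by (rule hv)
        then show ?thesis using pay[OF e] by auto
      qed (use pay[OF e] in auto)
      then show ?thesis using sum_nonneg[of e "\<lambda>v. gift v e f"] gift_nonneg pay_nonneg[of "oth f e" e]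
        unfolding net_def by simp
    qed
    then have "(\<Sum>e\<in>bd f. -1/4) \<le> (\<Sum>e\<in>bd f. net f e)" by (intro sum_mono)
    then show ?thesis using f face_props(7)[OF f(1)] by simp
  next
    case False
    then obtain v where v: "v \<in> set (cyc f)" "\<not> three v" by blast
    have "(if v \<in> e then 0 else -1/3) \<le> net f e" if e: "e \<in> bd f" for e
    proof (cases "v \<in> e")
      case True
      have "v \<in> set (cyc (oth f e))" using oth[OF f(1) e] face_vertex True by blast
      then have "heavy (oth f e) \<noteq> 0" using hv v(2) by blast
      then have "pay f e \<le> 1/4" using pay[OF e] by auto
      moreover have "gift v e f \<le> (\<Sum>v\<in>e. gift v e f)"
        using True finite_edge[of e] face_E[OF f(1)] e gift_nonneg by (intro member_le_sum) auto
      moreover have "1/4 \<le> gift v e f" using gift_short[OF f(1) e _ _ v(2)] f(2) by simp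
      ultimately show ?thesis using pay_nonneg[of "oth f e" e] True unfolding net_def by simp
    next
      case False
      have "pay f e \<le> 1/3" using pay[OF e] by auto
      then show ?thesis using False sum_nonneg[of e "\<lambda>v. gift v e f"] gift_nonneg pay_nonneg[of "oth f e" e]
        unfolding net_def by simp
    qed
    then have "(\<Sum>e\<in>bd f. if v \<in> e then 0 else -1/3) \<le> (\<Sum>e\<in>bd f. net f e)" by (intro sum_mono)
    moreover have "(\<Sum>e\<in>bd f. if v \<in> e then 0 else -1/3 :: real) = (\<Sum>e\<in>bd f. -1/3) + (\<Sum>e\<in>bd f. if v \<in> e then 1/3 else 0)"
      unfolding sum.distrib[symmetric] by (intro sum.cong) auto
    moreover have "(\<Sum>e\<in>bd f. if v \<in> e then 1/3 else 0 :: real) = 2/3"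
      using two_at[OF f(1) v(1)] by (subst sum.inter_filter[symmetric]) simp_all
    ultimately show ?thesis using f face_props(7)[OF f(1)] by simp
  qed
qed

text \<open>By \<open>five_six\<close> and \<open>tri_len\<close> only 5-faces and faces of length
  at least 8 lie across. By \<open>three_fives\<close>, one of the two edges at a cubic vertex leads
  to a face of the second kind, so the count of long neighbours becomes a covering problem on five
  cyclically ordered edges.\<close>

lemma five_charge:
  assumes f: "f \<in> F" "len f = 5"
  shows "0 \<le> real (len f) - 6 + (\<Sum>e\<in>bd f. net f e)"
proof -
  define w where "w = (if heavy f = 0 then 1/3 else if heavy f = 1 then 1/4 else 0 :: real)"
  have w0: "0 \<le> w" by (simp add: w_def)
  have nb: "len (oth f e) = 5 \<or> 8 \<le> len (oth f e)" if e: "e \<in> bd f" for e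
    using five_six[OF f(1) e f(2)] tri_len[OF f(1) e] f(2) face_props(2-5)[of "oth f e"] oth[OF f(1) e] by force
  have low: "(\<Sum>v\<in>e. if three v then 0 else 1/4) + (if 8 \<le> len (oth f e) then w else 0) \<le> net f e" if e: "e \<in> bd f" for e
  proof -
    have "(\<Sum>v\<in>e. if three v then 0 else 1/4) \<le> (\<Sum>v\<in>e. gift v e f)"
      by (rule sum_mono) (use gift_nonneg gift_short[OF f(1) e] f(2) in auto)
    moreover have "(if 8 \<le> len (oth f e) then w else 0) \<le> pay (oth f e) e"
    proof (cases "8 \<le> len (oth f e)")
      case True
      then show ?thesis using oth_oth[OF f(1) e] f(2) by (simp add: pay_def w_def)
    qed (simp add: pay_nonneg)
    ultimately show ?thesis using pay_small[OF f(1) e] f(2) unfolding net_def by simp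
  qed
  have "(\<Sum>e\<in>bd f. (\<Sum>v\<in>e. if three v then 0 else 1/4) + (if 8 \<le> len (oth f e) then w else 0)) \<le> (\<Sum>e\<in>bd f. net f e)"
    by (rule sum_mono) (rule low)
  moreover have "(\<Sum>e\<in>bd f. \<Sum>v\<in>e. if three v then 0 else 1/4) = heavy f / 2"
  proof -
    have "(\<Sum>v\<in>set (cyc f). if three v then 0 else 1/4 :: real) = (\<Sum>v\<in>set (cyc f). if \<not> three v then 1/4 else 0)"
      by (intro sum.cong) auto
    also have "\<dots> = heavy f / 4"
      unfolding heavy_def by (subst sum.inter_filter[symmetric]) simp_all
    finally show ?thesis using sum_edge_vertex[OF f(1), of "\<lambda>v. if three v then 0 else 1/4"] by simp
  qed
  ultimately have main: "heavy f / 2 + (\<Sum>e\<in>bd f. if 8 \<le> len (oth f e) then w else 0) \<le> (\<Sum>e\<in>bd f. net f e)"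
    by (simp add: sum.distrib)
  have co: "8 \<le> len (oth f a) \<or> 8 \<le> len (oth f b)" if "three v" "a \<in> bd f" "b \<in> bd f" "a \<noteq> b" "v \<in> a" "v \<in> b" for v a b
    using three_fives[OF that(1) f(1) that(2-6) f(2)] nb[OF that(2)] nb[OF that(3)] by blast
  have list: "\<exists>e1 e2 e3 e4 e5 v2 v3 v4 v5. bd f = {e1, e2, e3, e4, e5} \<and> distinct [e1, e2, e3, e4, e5] \<and>
     v1 \<in> e5 \<inter> e1 \<and> v2 \<in> e1 \<inter> e2 \<and> v3 \<in> e2 \<inter> e3 \<and>
         v4 \<in> e3 \<inter> e4 \<and> v5 \<in> e4 \<inter> e5 \<and> set (cyc f) = {v1, v2, v3, v4, v5} \<and>
         distinct [v1, v2, v3, v4, v5]"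
    if v1: "v1 \<in> set (cyc f)" for v1
  proof -
    have "v1 \<in> \<Union>(bd f)" using v1 by (simp only: Union_cedges)
    then obtain e where e: "e \<in> bd f" "v1 \<in> e" by (rule UnionE)
    obtain v2 where v2: "e = {v1, v2}" by (rule edge_ends_at[OF f(1) e])
    obtain r where r: "is_cycle G (v1 # v2 # r)" "bd f = cedges (v1 # v2 # r)" "set (cyc f) = set (v1 # v2 # r)" "length (v1 # v2 # r) = len f"
      using face_list[of f v1 v2] f e v2 by metis
    obtain v3 v4 v5 where l: "r = [v3, v4, v5]" using r(4) f(2) by (auto simp: length_Suc_conv eval_nat_numeral)
    have d: "distinct [v1, v2, v3, v4, v5]" using cycle5D[OF r(1)[unfolded l]] by blast
    have "bd f = {{v1, v2}, {v2, v3}, {v3, v4}, {v4, v5}, {v5, v1}}" unfolding r(2) l by (auto simp: cedges_eq_pedges)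
    moreover have "distinct [{v1, v2}, {v2, v3}, {v3, v4}, {v4, v5}, {v5, v1}]"
      using d by (auto simp: doubleton_eq_iff)
    moreover have "set (cyc f) = {v1, v2, v3, v4, v5}" using r(3) l by simp
    ultimately show ?thesis using d
      by - (rule exI[of _ "{v1, v2}"], rule exI[of _ "{v2, v3}"], rule exI[of _ "{v3, v4}"], rule exI[of _ "{v4, v5}"],
        rule exI[of _ "{v5, v1}"], rule exI[of _ v2], rule exI[of _ v3], rule exI[of _ v4], rule exI[of _ v5], simp)
  qed
  consider "heavy f = 0" | "heavy f = 1" | "2 \<le> heavy f" by linarith
  then show ?thesis
  proof cases
    case 1
    then have all3: "three v" if "v \<in> set (cyc f)" for v using that by (auto simp: heavy_def)
    have "hd (cyc f) \<in> set (cyc f)" using f(2) by (intro hd_in_set) auto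
    from list[OF this] obtain e1 e2 e3 e4 e5 v2 v3 v4 v5 where L: "bd f = {e1, e2, e3, e4, e5}" "distinct [e1, e2, e3, e4, e5]"
      "hd (cyc f) \<in> e5 \<inter> e1" "v2 \<in> e1 \<inter> e2" "v3 \<in> e2 \<inter> e3" "v4 \<in> e3 \<inter> e4" "v5 \<in> e4 \<inter> e5" "set (cyc f) = {hd (cyc f), v2, v3, v4, v5}"
        "distinct [hd (cyc f), v2, v3, v4, v5]"
      by (elim exE conjE) (rule that)
    define P where "P e \<longleftrightarrow> 8 \<le> len (oth f e)" for e
    have m: "e1 \<in> bd f" "e2 \<in> bd f" "e3 \<in> bd f" "e4 \<in> bd f" "e5 \<in> bd f" unfolding L(1) by simp_all
    have ne: "e1 \<noteq> e2" "e2 \<noteq> e3" "e3 \<noteq> e4" "e4 \<noteq> e5" "e1 \<noteq> e5" using L(2) by simp_all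
    have mv: "v2 \<in> e1" "v2 \<in> e2" "v3 \<in> e2" "v3 \<in> e3" "v4 \<in> e3" "v4 \<in> e4" "v5 \<in> e4" "v5 \<in> e5" using L(4-7) by simp_all
    have a3: "three (hd (cyc f))" "three v2" "three v3" "three v4" "three v5" by (rule all3, simp add: L(8))+
    have "P e1 \<or> P e2" "P e2 \<or> P e3" "P e3 \<or> P e4" "P e4 \<or> P e5"
      unfolding P_def
      by (rule co[OF a3(2) m(1,2) ne(1) mv(1,2)] co[OF a3(3) m(2,3) ne(2) mv(3,4)]
        co[OF a3(4) m(3,4) ne(3) mv(5,6)] co[OF a3(5) m(4,5) ne(4) mv(7,8)])+
    moreover have "P e5 \<or> P e1" unfolding P_def
      by (rule co[OF a3(1) m(5,1) ne(5)[symmetric]]) (use L(3) in simp_all)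
    moreover have "(\<Sum>e\<in>bd f. if P e then w else 0) = (if P e1 then w else 0) + (if P e2 then w else 0)
      + (if P e3 then w else 0) + (if P e4 then w else 0) + (if P e5 then w else 0)"
      unfolding L(1) using L(2) by simp
    \<comment> \<open>No two cyclically consecutive edges fail \<open>P\<close>, so at least three
      of the five satisfy it.\<close>
    ultimately have "3 * w \<le> (\<Sum>e\<in>bd f. if P e then w else 0)" using w0 by (auto split: if_splits)
    then show ?thesis using main f(2) 1 unfolding P_def by (simp add: w_def)
  next
    case 2
    then obtain v1 where v1: "{v \<in> set (cyc f). \<not> three v} = {v1}" unfolding heavy_def by (auto simp: card_1_singleton_iff)
    then have "v1 \<in> set (cyc f)" by blast
    from list[OF this] obtain e1 e2 e3 e4 e5 v2 v3 v4 v5 where L: "bd f = {e1, e2, e3, e4, e5}" "distinct [e1, e2, e3, e4, e5]"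
      "v1 \<in> e5 \<inter> e1" "v2 \<in> e1 \<inter> e2" "v3 \<in> e2 \<inter> e3" "v4 \<in> e3 \<inter> e4" "v5 \<in> e4 \<inter> e5" "set (cyc f) = {v1, v2, v3, v4, v5}" "distinct [v1, v2, v3, v4, v5]"
      by (elim exE conjE) (rule that)
    have all3: "three v2" "three v3" "three v4" "three v5"
      using v1 L(8,9) by auto
    define P where "P e \<longleftrightarrow> 8 \<le> len (oth f e)" for e
    have m: "e1 \<in> bd f" "e2 \<in> bd f" "e3 \<in> bd f" "e4 \<in> bd f" "e5 \<in> bd f" unfolding L(1) by simp_all
    have ne: "e1 \<noteq> e2" "e2 \<noteq> e3" "e3 \<noteq> e4" "e4 \<noteq> e5" "e1 \<noteq> e5" using L(2) by simp_all
    have mv: "v2 \<in> e1" "v2 \<in> e2" "v3 \<in> e2" "v3 \<in> e3" "v4 \<in> e3" "v4 \<in> e4" "v5 \<in> e4" "v5 \<in> e5" using L(4-7) by simp_all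
    have "P e1 \<or> P e2" "P e2 \<or> P e3" "P e3 \<or> P e4" "P e4 \<or> P e5"
      unfolding P_def
      by (rule co[OF all3(1) m(1,2) ne(1) mv(1,2)] co[OF all3(2) m(2,3) ne(2) mv(3,4)]
        co[OF all3(3) m(3,4) ne(3) mv(5,6)] co[OF all3(4) m(4,5) ne(4) mv(7,8)])+
    moreover have "(\<Sum>e\<in>bd f. if P e then w else 0) = (if P e1 then w else 0) + (if P e2 then w else 0)
      + (if P e3 then w else 0) + (if P e4 then w else 0) + (if P e5 then w else 0)"
      unfolding L(1) using L(2) by simp
    \<comment> \<open>The corner \<open>v1\<close> is heavy, so \<open>e5\<close> and
      \<open>e1\<close> may both fail; a row of five edges still has two that satisfy
      \<open>P\<close>.\<close>
    ultimately have "2 * w \<le> (\<Sum>e\<in>bd f. if P e then w else 0)" using w0 by (auto split: if_splits)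
    then show ?thesis using main f(2) 2 unfolding P_def by (simp add: w_def)
  next
    case 3
    have "0 \<le> (\<Sum>e\<in>bd f. if 8 \<le> len (oth f e) then w else 0)" by (intro sum_nonneg) (use w0 in auto)
    moreover have "1 \<le> real (heavy f) / 2" using 3 by simp
    ultimately show ?thesis using main f(2) by linarith
  qed
qed

end

section \<open>Long faces\<close>

context charged_block
begin

text \<open>The triangle across \<open>a\<close> has a second edge \<open>a'\<close> at
  \<open>v\<close>. Suppose the face across \<open>b\<close> had a triangle edge \<open>b'\<close>
  there. If \<open>b' = a'\<close>, three faces close up around \<open>a\<close>, \<open>b\<close>,
  \<open>a'\<close>, and the fourth edge at \<open>v\<close> finds no face. Otherwise the triangle
  at \<open>b'\<close> has \<open>a\<close> or \<open>a'\<close> as its second edge at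
  \<open>v\<close>, so it is \<open>f\<close> or borders on the first triangle, and both are
  impossible. Hence \<open>gift\<close> grants \<open>f\<close> the full 1/2 through
  \<open>b\<close>.\<close>

lemma four_corner:
  assumes v: "four v" and f: "f \<in> F" "10 \<le> len f" "10 \<le> len (oth f b)"
    and ab: "a \<in> bd f" "b \<in> bd f" "v \<in> a" "v \<in> b" and t: "tri a" "\<not> tri b"
  shows "\<not> on_tri v (oth f b)"
proof
  let ?g = "oth f b" and ?t = "oth f a"
  assume "on_tri v ?g"
  then obtain b' where b': "b' \<in> bd ?g" "v \<in> b'" "tri b'" by (auto simp: on_tri_def)
  have g: "?g \<in> F" "?g \<noteq> f" "b \<in> bd ?g" and T: "?t \<in> F" "?t \<noteq> f" "a \<in> bd ?t" using oth f ab by auto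
  have ne: "a \<noteq> b" using t by blast
  have lt: "len ?t = 3" using tri_iff[OF f(1) ab(1)] t f by simp
  then have gt: "?g \<noteq> ?t" using f(3) by auto
  obtain a' where a': "a' \<in> bd ?t" "v \<in> a'" "a' \<noteq> a" by (rule other_at[OF T(1,3) ab(3)])
  have ta': "tri a'" using a' T lt by (auto simp: tri_def)
  have n1: "a' \<noteq> b" "b' \<noteq> b" using ta' b' t by blast+
  have n2: "b' \<noteq> a" using b' g T f ab gt oth_eqI by metis
  have vE: "v \<in> \<Union>E" using face_E[OF f(1)] ab by blast
  then have c4: "card {e \<in> E. v \<in> e} = 4" using E_vdeg[OF vE] v by (simp add: four_def)
  have inE: "a \<in> E" "b \<in> E" "a' \<in> E" "b' \<in> E" using face_E f(1) g(1) T(1) ab a' b' by blast+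
  have full4: "{e \<in> E. v \<in> e} = {a, b, a', d}" if "d \<in> E" "v \<in> d" "d \<notin> {a, b, a'}" for d
  proof -
    have "a \<noteq> a'" "d \<noteq> a" "d \<noteq> b" "d \<noteq> a'" "a \<noteq> b" "b \<noteq> a'" using that(3) ne n1 a'(3) by auto
    then have "card {a, b, a', d} = 4" by simp
    moreover have "{a, b, a', d} \<subseteq> {e \<in> E. v \<in> e}" using that inE ab a' by auto
    moreover have "finite {e \<in> E. v \<in> e}" using finite_E by simp
    ultimately show ?thesis using c4 card_subset_eq[of "{e \<in> E. v \<in> e}" "{a, b, a', d}"] by simp
  qed
  show False
  proof (cases "b' = a'")
    case True
    have "\<exists>d\<in>{e \<in> E. v \<in> e}. d \<notin> {a, b, a'}"
    proof (rule ccontr)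
      assume "\<not> ?thesis"
      then have "{e \<in> E. v \<in> e} \<subseteq> {a, b, a'}" by blast
      then have "card {e \<in> E. v \<in> e} \<le> card {a, b, a'}" by (intro card_mono) auto
      also have "\<dots> \<le> 3" by (simp add: card_insert_if)
      finally show False using c4 by simp
    qed
    then obtain d where d: "d \<in> E" "v \<in> d" "d \<notin> {a, b, a'}" by blast
    obtain k where k: "k \<in> F" "d \<in> bd k" using edge_face[OF d(1)] by blast
    obtain d' where d': "d' \<in> bd k" "v \<in> d'" "d' \<noteq> d" by (rule other_at[OF k d(2)])
    have "d' \<in> {a, b, a'}" using full4[OF d] d' face_E[OF k(1)] by blast
    moreover have "k \<noteq> f" using not_three_at[OF f(1) ab(1,2) _ ab(3,4) d(2) ne] k d by blast
    moreover have "k \<noteq> ?t" using not_three_at[OF T(1,3) a'(1) _ ab(3) a'(2) d(2)] a'(3) k d by blast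
    moreover have "k \<noteq> ?g" using not_three_at[OF g(1,3) b'(1) _ ab(4) b'(2) d(2)] n1 k d True by blast
    moreover have "k = f \<or> k = ?t" if "a \<in> bd k" using that oth_eqI[OF f(1) ab(1) k(1)] by blast
    moreover have "k = f \<or> k = ?g" if "b \<in> bd k" using that oth_eqI[OF f(1) ab(2) k(1)] by blast
    moreover have "k = ?t \<or> k = ?g" if "a' \<in> bd k"
      using that oth_eqI[OF T(1) a'(1) k(1)] oth_eqI[OF T(1) a'(1) g(1) gt] b'(1) True by metis
    ultimately show False using d'(1) by blast
  next
    case False
    obtain s where s: "s \<in> F" "b' \<in> bd s" "len s = 3" using b'(3) by (auto simp: tri_def)
    obtain c where c: "c \<in> bd s" "v \<in> c" "c \<noteq> b'" by (rule other_at[OF s(1,2) b'(2)])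
    have "{e \<in> E. v \<in> e} = {a, b, a', b'}" using full4[of b'] inE(4) b'(2) n1 n2 False by simp
    then have cc: "c \<in> {a, b, a', b'}" using c face_E[OF s(1)] by blast
    have "tri c" using s c by (auto simp: tri_def)
    then have "c = a \<or> c = a'" using cc c(3) t(2) by blast
    moreover have st: "s \<noteq> ?t"
      using not_three_at[OF T(1,3) a'(1) _ ab(3) a'(2) b'(2) a'(3)[symmetric]] s(2) n2 False by blast
    ultimately show False
    proof (elim disjE)
      assume "c = a"
      then have "s = f \<or> s = ?t" using c oth_eqI[OF f(1) ab(1) s(1)] by blast
      then show False using st s(3) f(2) by auto
    next
      assume "c = a'"
      then have "oth ?t a' = s" using c oth_eqI[OF T(1) a'(1) s(1) st] by blast
      then show False using tri_oth[OF T(1) a'(1) lt] s(3) by simp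
    qed
  qed
qed

lemma not_drain_if: "f \<in> F \<Longrightarrow> e \<in> bd f \<Longrightarrow> v \<in> e \<Longrightarrow> \<not> three v \<Longrightarrow> \<not> drain (oth f e) e"
  using oth face_vertex unfolding drain_def by blast

text \<open>The cubic end \<open>x\<close> of \<open>b\<close> has its triangle at \<open>c\<close>,
  so the face across \<open>b\<close> is long; it is not paid, and it does not drain because
  \<open>b\<close> has the heavy end \<open>v\<close>. If \<open>v\<close> has degree 4,
  \<open>four_corner\<close> selects the rule of \<open>gift\<close> with value 1/2.\<close>

lemma gift_other_edge:
  assumes f: "f \<in> F" "10 \<le> len f" and v: "\<not> three v"
    and ab: "a \<in> bd f" "b \<in> bd f" "v \<in> a" "v \<in> b" and t: "tri a" "\<not> tri b"
    and x: "x \<in> b" "three x" and c: "c \<in> bd f" "x \<in> c" "tri c"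
  shows "(if four v then 1/2 else 1/4) \<le> net f b"
proof -
  have "c \<noteq> b" using c t by blast
  moreover have "len (oth f c) = 3" using tri_iff[OF f(1) c(1)] c(3) f(2) by simp
  ultimately have l: "10 \<le> len (oth f b)" using tri_corner[OF x(2) f(1) c(1) ab(2) _ c(2) x(1)] by blast
  have p: "pay f b = 0" using l not_drain_if[OF f(1) ab(2,4) v] by (simp add: pay_def Let_def)
  have "(if four v then 1/2 else 1/4) \<le> gift v b f"
  proof (cases "four v")
    case True
    have "\<not> on_tri v (oth f b)" by (rule four_corner[OF True f l ab t])
    moreover have "on_tri v f" using ab t by (auto simp: on_tri_def)
    ultimately show ?thesis using True v f(2) t l by (simp add: gift_def)
  next
    case False
    then show ?thesis using v f(2) by (simp add: gift_def)
  qed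
  also have "\<dots> \<le> (\<Sum>v\<in>b. gift v b f)"
    using ab finite_edge[of b] face_E[OF f(1)] gift_nonneg by (intro member_le_sum) auto
  also have "\<dots> \<le> net f b" using p pay_nonneg[of "oth f b" b] by (simp add: net_def)
  finally show ?thesis .
qed

definition big :: "'a \<Rightarrow> bool" where "big v \<longleftrightarrow> \<not> three v \<and> \<not> four v"

lemma gift_five:
  assumes "f \<in> F" "10 \<le> len f" "e \<in> bd f" "len (oth f e) = 5" "\<not> three v"
  shows "1/4 \<le> gift v e f"
proof -
  have "\<not> on_tri v (oth f e)"
    using short_face_not_tri[of "oth f e"] oth[OF assms(1,3)] assms(4) by (auto simp: on_tri_def)
  moreover have "\<not> tri e" using tri_iff[OF assms(1,3)] assms(2,4) by simp
  ultimately show ?thesis using assms by (simp add: gift_def)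
qed

text \<open>A 5-face across an edge with a heavy end costs nothing on balance: it receives at most
  1/4, and \<open>gift_five\<close> returns as much. The 1/4 of a \<open>big\<close> vertex through
  a triangle edge is recorded, because it has to cover a drain nearby.\<close>

lemma net_lower:
  assumes f: "f \<in> F" "10 \<le> len f" and e: "e \<in> bd f"
  shows "pay (oth f e) e + (\<Sum>v\<in>e. if tri e then (if three v then -1/2 else if big v then 1/4 else 0) else 0)
     - (if len (oth f e) = 5 \<and> (\<forall>v\<in>e. three v) then 1/3 else 0) - (if drain (oth f e) e then 1/5 else 0) \<le> net f e"
proof -
  let ?g = "oth f e"
  have t: "tri e \<longleftrightarrow> len ?g = 3" using tri_iff[OF f(1) e] f(2) by simp
  have fe: "finite e" using finite_edge face_E[OF f(1)] e by blast
  have nn: "0 \<le> (\<Sum>v\<in>e. gift v e f)" by (intro sum_nonneg gift_nonneg)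
  consider "tri e" | "len ?g = 5" | "\<not> tri e" "len ?g \<noteq> 5" by blast
  then show ?thesis
  proof cases
    case 1
    have "(\<Sum>v\<in>e. if three v then -1/2 else if big v then 1/4 else 0)
        \<le> (\<Sum>v\<in>e. gift v e f - (if three v then 1/2 else 0))"
      using gift_nonneg f(2) by (intro sum_mono) (auto simp: gift_def big_def)
    then show ?thesis using 1 t by (simp add: net_def pay_def drain_def sum_subtractf)
  next
    case 2
    then have nt: "\<not> tri e" "\<not> drain ?g e" using t by (auto simp: drain_def)
    show ?thesis
    proof (cases "\<forall>v\<in>e. three v")
      case True
      have "pay f e \<le> 1/3" using 2 by (simp add: pay_def Let_def)
      then show ?thesis using True 2 nt nn by (simp add: net_def)
    next
      case False
      then obtain v where v: "v \<in> e" "\<not> three v" by blast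
      have "v \<in> set (cyc ?g)" using oth[OF f(1) e] face_vertex v by blast
      then have "heavy ?g \<noteq> 0" using v by (auto simp: heavy_def)
      then have "pay f e \<le> 1/4" using 2 by (simp add: pay_def Let_def)
      also have "1/4 \<le> gift v e f" by (rule gift_five[OF f e 2 v(2)])
      also have "\<dots> \<le> (\<Sum>v\<in>e. gift v e f)" using v fe gift_nonneg by (intro member_le_sum) auto
      finally show ?thesis using False nt by (simp add: net_def)
    qed
  next
    case 3
    then show ?thesis using t nn by (auto simp: net_def pay_def Let_def)
  qed
qed

end

section \<open>A long face read as a cyclic word\<close>

locale long_face = charged_block G E F cyc v0
  for G :: "'a ugraph" and E :: "'a set set" and F :: "'f set" and cyc :: "'f \<Rightarrow> 'a list" and v0 :: 'a +
  fixes f :: 'f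
  assumes fF: "f \<in> F" and f10: "10 \<le> len f"
begin

abbreviation n :: nat where "n \<equiv> len f"

text \<open>The index is shifted by one, so that \<open>vv i\<close> is the vertex between
  \<open>ee i\<close> and \<open>ee (i + 1)\<close>, as in \<open>cyclic_word\<close>.\<close>

definition vv :: "nat \<Rightarrow> 'a" where "vv i = cyc f ! (Suc i mod n)"
definition ee :: "nat \<Rightarrow> 'a set" where "ee i = {cyc f ! (i mod n), cyc f ! (Suc i mod n)}"

lemma n_pos: "0 < n" using f10 by linarith

lemma ee_Suc: "ee (Suc i) = {vv i, vv (Suc i)}"
  by (simp add: ee_def vv_def)

lemma vv_ee: "vv i \<in> ee i" "vv i \<in> ee (Suc i)"
  by (simp_all add: ee_def vv_def)

lemma vv_per: "vv (i + n) = vv i" and ee_per: "ee (i + n) = ee i"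
proof -
  have "Suc (i + n) mod n = Suc i mod n" using mod_add_self2[of "Suc i" n] by simp
  then show "vv (i + n) = vv i" "ee (i + n) = ee i" by (simp_all add: vv_def ee_def)
qed

lemma ee_image: "ee ` {..<n} = bd f"
  by (auto simp: cycle_graph_def ee_def image_def)

lemma ee_mod: "ee (i mod n) = ee i"
  by (simp add: ee_def mod_Suc_eq)

lemma ee_bd: "ee i \<in> bd f"
  using ee_image ee_mod[of i] mod_less_divisor[OF n_pos, of i] by blast

lemma ee_inj: "inj_on ee {..<n}"
  using ee_image face_props(7)[OF fF] by (intro eq_card_imp_inj_on) auto

lemma ee_eq: "ee i = ee j \<Longrightarrow> i mod n = j mod n"
  using inj_onD[OF ee_inj, of "i mod n" "j mod n"] ee_mod n_pos by simp

lemma mod_neq: "0 < k \<Longrightarrow> k < n \<Longrightarrow> i mod n \<noteq> (i + k) mod n"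
proof
  assume k: "0 < k" "k < n" "i mod n = (i + k) mod n"
  then have "n dvd (i + k) - i" using mod_eq_dvd_iff_nat[of i "i + k" n] by simp
  then show False using k dvd_imp_le[of n k] by simp
qed

lemma ee_neq: "ee i \<noteq> ee (Suc i)"
  using ee_eq[of i "Suc i"] mod_neq[of 1 i] f10 by auto

lemma vv_set: "vv i \<in> set (cyc f)"
  unfolding vv_def by (rule nth_mem) (use n_pos in simp)

lemma vv_eq: "vv i = vv j \<Longrightarrow> i mod n = j mod n"
proof -
  assume "vv i = vv j"
  then have "Suc i mod n = Suc j mod n"
    unfolding vv_def using face_props(1)[OF fF] n_pos by (simp add: nth_eq_iff_index_eq)
  then have "(Suc i + (n - 1)) mod n = (Suc j + (n - 1)) mod n" by (metis mod_add_left_eq)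
  then show ?thesis using n_pos by simp
qed

lemma vv_Suc_neq: "vv i \<noteq> vv (Suc i)"
  using vv_eq[of i "Suc i"] mod_neq[of 1 i] f10 by auto

lemma vv_mod: "vv (i mod n) = vv i"
  by (rule periodic_mod) (rule vv_per)

lemma vv_surj: "v \<in> set (cyc f) \<Longrightarrow> \<exists>i. v = vv i"
proof -
  assume "v \<in> set (cyc f)"
  then obtain k where k: "k < n" "cyc f ! k = v" by (auto simp: in_set_conv_nth)
  then have "vv (k + n - 1) = v" using n_pos by (simp add: vv_def)
  then show ?thesis by metis
qed

lemma edges_at_vv: "e \<in> bd f \<Longrightarrow> vv i \<in> e \<Longrightarrow> e = ee i \<or> e = ee (Suc i)"
  using not_three_at[OF fF ee_bd ee_bd, of e] vv_ee ee_neq by metis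

definition t3 where "t3 i \<longleftrightarrow> three (vv i)"
definition T where "T i \<longleftrightarrow> tri (ee i)"
definition N where "N i \<longleftrightarrow> len (oth f (ee i)) = 5 \<and> (\<forall>v\<in>ee i. three v)"
definition D0 where "D0 i \<longleftrightarrow> drain (oth f (ee i)) (ee i)"
text \<open>For the edge \<open>i + 2\<close> the two vertices are \<open>vv i\<close> and
  \<open>vv (i + 3)\<close>, the far ends of the neighbouring triangle edges; adding
  \<open>n\<close> avoids truncated subtraction. Only these drained edges can lead to configuration
  (2), while any other one has a \<open>big\<close> vertex that covers it.\<close>

definition D where "D i \<longleftrightarrow> D0 i \<and> four (vv (i + n - 2)) \<and> four (vv (i + 1))"

lemma T_len: "T i \<longleftrightarrow> len (oth f (ee i)) = 3"
  using tri_iff[OF fF ee_bd] f10 by (auto simp: T_def)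

lemma T_corner:
  assumes "t3 i"
  shows "T i \<Longrightarrow> \<not> T (Suc i) \<and> 10 \<le> len (oth f (ee (Suc i)))"
    and "T (Suc i) \<Longrightarrow> \<not> T i \<and> 10 \<le> len (oth f (ee i))"
  using tri_corner[OF _ fF ee_bd ee_bd, of "vv i" i "Suc i"] tri_corner[OF _ fF ee_bd ee_bd, of "vv i" "Suc i" i]
    assms vv_ee[of i] ee_neq[of i] T_len by (auto simp: t3_def T_def)

lemma D0_corner:
  assumes "D0 (i + 2)"
  shows "\<not> t3 i" "\<not> t3 (i + 3)" "T (i + 1)" "T (i + 3)"
    "\<exists>a z. a \<in> bd (oth f (ee (i + 2))) \<and> a \<noteq> ee (i + 2) \<and> a = {vv (i + 1), z} \<and> {z, vv i} \<in> edges G"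
    "\<exists>a z. a \<in> bd (oth f (ee (i + 2))) \<and> a \<noteq> ee (i + 2) \<and> a = {vv (i + 2), z} \<and> {z, vv (i + 3)} \<in> edges G"
proof -
  let ?e = "ee (i + 2)"
  have dr: "drain (oth f ?e) ?e" using assms by (simp add: D0_def)
  have x: "vv (i + 1) \<in> ?e" "vv (i + 2) \<in> ?e" using vv_ee[of "i + 1"] vv_ee[of "i + 2"] by auto
  obtain a c y z where 1: "c \<in> bd f" "c \<noteq> ?e" "tri c" "c = {vv (i + 1), y}" "y \<noteq> vv (i + 1)" "\<not> three y"
    "a \<in> bd (oth f ?e)" "a \<noteq> ?e" "a = {vv (i + 1), z}" "{z, y} \<in> edges G"
    by (rule drain_corner[OF fF ee_bd dr x(1)])
  have c: "c = ee (i + 1)" using edges_at_vv[OF 1(1), of "i + 1"] 1(2,4) by auto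
  then have "y = vv i" using ee_Suc[of i] vv_Suc_neq[of i] 1(4,5) by (auto simp: doubleton_eq_iff)
  then show "\<not> t3 i" "T (i + 1)"
    "\<exists>a z. a \<in> bd (oth f ?e) \<and> a \<noteq> ?e \<and> a = {vv (i + 1), z} \<and> {z, vv i} \<in> edges G"
    using 1 c by (auto simp: t3_def T_def)
  obtain a c y z where 2: "c \<in> bd f" "c \<noteq> ?e" "tri c" "c = {vv (i + 2), y}" "y \<noteq> vv (i + 2)" "\<not> three y"
    "a \<in> bd (oth f ?e)" "a \<noteq> ?e" "a = {vv (i + 2), z}" "{z, y} \<in> edges G"
    by (rule drain_corner[OF fF ee_bd dr x(2)])
  have c: "c = ee (i + 3)" using edges_at_vv[OF 2(1), of "i + 2"] 2(2,4) by (auto simp: numeral_3_eq_3)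
  then have "y = vv (i + 3)" using ee_Suc[of "i + 2"] vv_Suc_neq[of "i + 2"] 2(4,5)
    by (auto simp: doubleton_eq_iff numeral_3_eq_3)
  then show "\<not> t3 (i + 3)" "T (i + 3)"
    "\<exists>a z. a \<in> bd (oth f ?e) \<and> a \<noteq> ?e \<and> a = {vv (i + 2), z} \<and> {z, vv (i + 3)} \<in> edges G"
    using 2 c by (auto simp: t3_def T_def)
qed

lemma pers: "t3 (i + n) = t3 i" "T (i + n) = T i" "N (i + n) = N i" "D0 (i + n) = D0 i" "D (i + n) = D i"
proof -
  show "t3 (i + n) = t3 i" "T (i + n) = T i" "N (i + n) = N i" and d: "D0 (i + n) = D0 i"
    by (simp_all add: t3_def T_def N_def D0_def vv_per ee_per)
  have "vv (i + n + n - 2) = vv (i + n - 2)" using vv_per[of "i + n - 2"] f10 by (simp add: algebra_simps)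
  moreover have "vv (i + n + 1) = vv (i + 1)" using vv_per[of "i + 1"] by (simp add: algebra_simps)
  ultimately show "D (i + n) = D i" by (simp add: D_def d)
qed

lemma N_corner:
  assumes "N (i + 1)"
  shows "t3 i \<and> t3 (i + 1) \<and> \<not> T i \<and> \<not> T (i + 1) \<and> \<not> T (i + 2)"
proof -
  have l: "len (oth f (ee (i + 1))) = 5" and t: "t3 i" "t3 (i + 1)"
    using assms ee_Suc[of i] by (auto simp: N_def t3_def)
  have "\<not> T (i + 1)" using l T_len by simp
  moreover have "\<not> T i" using T_corner(1)[OF t(1)] l by auto
  moreover have "\<not> T (i + 2)" using T_corner(2)[OF t(2)] l by auto
  ultimately show ?thesis using t by simp
qed

sublocale W: cyclic_word n t3 T N D
proof
  fix i
  show "10 \<le> n" by (rule f10)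
  show "t3 (i + n) = t3 i" "T (i + n) = T i" "N (i + n) = N i" "D (i + n) = D i" by (rule pers)+
  show "t3 i \<Longrightarrow> \<not> (T i \<and> T (i + 1))" using T_corner(1)[of i] by simp
  show "N (i + 1) \<Longrightarrow> t3 i \<and> t3 (i + 1) \<and> \<not> T i \<and> \<not> T (i + 1) \<and> \<not> T (i + 2)" by (rule N_corner)
  show "D (i + 2) \<Longrightarrow> \<not> t3 i \<and> \<not> t3 (i + 3) \<and> T (i + 1) \<and> T (i + 3)"
    using D0_corner(1-4)[of i] unfolding D_def by blast
qed

text \<open>The cost is computed with \<open>D\<close>. The word with all drained edges serves to
  show that a face with a single heavy vertex is not drained at all.\<close>

sublocale W0: cyclic_word n t3 T N D0
proof
  fix i
  show "10 \<le> n" by (rule f10)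
  show "t3 (i + n) = t3 i" "T (i + n) = T i" "N (i + n) = N i" "D0 (i + n) = D0 i" by (rule pers)+
  show "t3 i \<Longrightarrow> \<not> (T i \<and> T (i + 1))" using T_corner(1)[of i] by simp
  show "N (i + 1) \<Longrightarrow> t3 i \<and> t3 (i + 1) \<and> \<not> T i \<and> \<not> T (i + 1) \<and> \<not> T (i + 2)" by (rule N_corner)
  show "D0 (i + 2) \<Longrightarrow> \<not> t3 i \<and> \<not> t3 (i + 3) \<and> T (i + 1) \<and> T (i + 3)"
    using D0_corner(1-4)[of i] by blast
qed

lemma sum_bd: "(\<Sum>e\<in>bd f. \<phi> e) = (\<Sum>i<n. \<phi> (ee (i + 1)))" for \<phi> :: "'a set \<Rightarrow> real"
proof -
  have "(\<Sum>e\<in>bd f. \<phi> e) = (\<Sum>i<n. \<phi> (ee i))"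
    unfolding ee_image[symmetric] by (rule sum.reindex_cong[OF ee_inj]) auto
  also have "\<dots> = (\<Sum>i<n. \<phi> (ee (i + 1)))"
    by (rule sum_shift[symmetric]) (use n_pos ee_per in auto)
  finally show ?thesis .
qed

definition bigT where "bigT = W.cnt (\<lambda>i. T (i + 1) \<and> big (vv i)) + W.cnt (\<lambda>i. T i \<and> big (vv i))"

text \<open>A drained edge outside \<open>D\<close> has a \<open>big\<close> vertex at the far end
  of a neighbouring triangle edge, and the 1/4 given through that edge exceeds the drain of 1/5. Far
  ends to the left and to the right are counted by different summands of
  \<open>bigT\<close>.\<close>

lemma cnt_D0: "W.cnt D0 \<le> W.cnt D + bigT"
proof -
  have "W.cnt (\<lambda>i. D0 (i + 2)) \<le> W.cnt (\<lambda>i. D (i + 2)) + W.cnt (\<lambda>i. T (i + 1) \<and> big (vv i))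
      + W.cnt (\<lambda>i. T (i + 3) \<and> big (vv (i + 3)))"
    unfolding W.cnt_def sum.distrib[symmetric]
  proof (rule sum_mono)
    fix i
    have "vv (i + 2 + n - 2) = vv i" using vv_per[of i] by simp
    then have "D (i + 2) \<longleftrightarrow> D0 (i + 2) \<and> four (vv i) \<and> four (vv (i + 3))"
      unfolding D_def by (simp add: numeral_3_eq_3)
    then show "of_bool (D0 (i + 2)) \<le> of_bool (D (i + 2)) + of_bool (T (i + 1) \<and> big (vv i))
        + (of_bool (T (i + 3) \<and> big (vv (i + 3))) :: nat)"
      using D0_corner[of i] by (auto simp: big_def t3_def)
  qed
  then show ?thesis
    using W.cnt_shift[of D0 2] W.cnt_shift[of D 2] W.cnt_shift[of "\<lambda>i. T i \<and> big (vv i)" 3] pers vv_per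
    by (simp add: bigT_def)
qed

definition bonus :: real where
  "bonus = (if n = 10 \<and> all_three f then W.cnt W.R / 5 else 0)"

text \<open>The bound of \<open>net_lower\<close> for the edge \<open>i + 1\<close>, with the
  payment received replaced by what a cubic 10-face drains through that edge.\<close>

definition low :: "nat \<Rightarrow> real" where
  "low i = (if n = 10 \<and> all_three f \<and> W.R i then 1/5 else 0)
     + (if T (i + 1) then (if t3 i then -1/2 else if big (vv i) then 1/4 else 0)
         + (if t3 (i + 1) then -1/2 else if big (vv (i + 1)) then 1/4 else 0) else 0)
     - (if N (i + 1) then 1/3 else 0) - (if D0 (i + 1) then 1/5 else 0)"

lemma low_le: "low i \<le> net f (ee (i + 1))"
proof -
  let ?e = "ee (i + 1)"
  have e: "?e = {vv i, vv (i + 1)}" "vv i \<noteq> vv (i + 1)" using ee_Suc[of i] vv_Suc_neq[of i] by auto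
  have "(if n = 10 \<and> all_three f \<and> W.R i then 1/5 else 0) \<le> pay (oth f ?e) ?e"
  proof (cases "n = 10 \<and> all_three f \<and> W.R i")
    case True
    have "on_tri (vv i) f" "on_tri (vv (i + 1)) f"
      using True ee_bd vv_ee[of i] vv_ee[of "i + 1"] unfolding W.R_def W.A_def on_tri_def T_def by auto
    then have "drain f ?e" using True e unfolding drain_def W.R_def T_def by auto
    then show ?thesis using True oth_oth[OF fF ee_bd] by (simp add: pay_def)
  next
    case False
    then have "\<not> (n = 10 \<and> all_three f \<and> W.R i)" .
    then show ?thesis by (simp only: if_False pay_nonneg)
  qed
  moreover have "(\<Sum>v\<in>?e. if tri ?e then (if three v then -1/2 else if big v then 1/4 else 0) else 0)
      = (if T (i + 1) then (if t3 i then -1/2 else if big (vv i) then 1/4 else 0)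
         + (if t3 (i + 1) then -1/2 else if big (vv (i + 1)) then 1/4 else 0) else (0::real))"
  proof -
    have "(\<Sum>v\<in>?e. \<phi> v) = \<phi> (vv i) + \<phi> (vv (i + 1))" for \<phi> :: "'a \<Rightarrow> real"
      using e by simp
    then show ?thesis by (simp only: T_def t3_def) simp
  qed
  ultimately show ?thesis using net_lower[OF fF f10 ee_bd[of "i + 1"]]
    unfolding low_def N_def D0_def by simp
qed

lemma sum_low: "bonus - W.cnt W.A / 2 - W.cnt N / 3 - W.cnt D0 / 5 + bigT / 4 = (\<Sum>i<n. low i)"
proof -
  let ?c = "\<lambda>P. \<Sum>i<n. of_bool (P i) :: real"
  have c: "real (W.cnt P) = ?c P" for P by (simp add: W.cnt_def)
  have "(\<Sum>i<n. low i) = (if n = 10 \<and> all_three f then ?c W.R / 5 else 0)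
     - (?c (\<lambda>i. T (i + 1) \<and> t3 i) + ?c (\<lambda>i. T (i + 1) \<and> t3 (i + 1))) / 2
     + (?c (\<lambda>i. T (i + 1) \<and> big (vv i)) + ?c (\<lambda>i. T (i + 1) \<and> big (vv (i + 1)))) / 4
     - ?c (\<lambda>i. N (i + 1)) / 3 - ?c (\<lambda>i. D0 (i + 1)) / 5"
  proof -
    have "low i = (if n = 10 \<and> all_three f then of_bool (W.R i) / 5 else 0)
     - (of_bool (T (i + 1) \<and> t3 i) + of_bool (T (i + 1) \<and> t3 (i + 1))) / 2
     + (of_bool (T (i + 1) \<and> big (vv i)) + of_bool (T (i + 1) \<and> big (vv (i + 1)))) / 4
     - of_bool (N (i + 1)) / 3 - of_bool (D0 (i + 1)) / 5" for i
      by (auto simp: low_def big_def t3_def)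
    then have "(\<Sum>i<n. low i) = (\<Sum>i<n. (if n = 10 \<and> all_three f then of_bool (W.R i) / 5 else 0))
      - (?c (\<lambda>i. T (i + 1) \<and> t3 i) + ?c (\<lambda>i. T (i + 1) \<and> t3 (i + 1))) / 2
      + (?c (\<lambda>i. T (i + 1) \<and> big (vv i)) + ?c (\<lambda>i. T (i + 1) \<and> big (vv (i + 1)))) / 4
      - ?c (\<lambda>i. N (i + 1)) / 3 - ?c (\<lambda>i. D0 (i + 1)) / 5"
      by (simp only: sum.distrib sum_subtractf sum_divide_distrib[symmetric])
    also have "(\<Sum>i<n. (if n = 10 \<and> all_three f then of_bool (W.R i) / 5 else 0))
       = (if n = 10 \<and> all_three f then ?c W.R / 5 else 0)"
    proof -
      have "(\<Sum>i<m. if K then \<phi> i else 0) = (if K then \<Sum>i<m. \<phi> i else 0)" for K m and \<phi> :: "nat \<Rightarrow> real"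
        by (cases K) simp_all
      then show ?thesis by (simp only: sum_divide_distrib)
    qed
    finally show ?thesis .
  qed
  moreover have "?c (\<lambda>i. T (i + 1) \<and> t3 i) + ?c (\<lambda>i. T (i + 1) \<and> t3 (i + 1)) = W.cnt W.A"
  proof -
    have "?c (\<lambda>i. T (i + 1) \<and> t3 (i + 1)) = ?c (\<lambda>i. T i \<and> t3 i)"
      using W.cnt_shift[of "\<lambda>i. T i \<and> t3 i" 1] pers unfolding c[symmetric] by simp
    moreover have "?c (\<lambda>i. T (i + 1) \<and> t3 i) + ?c (\<lambda>i. T i \<and> t3 i) = ?c W.A"
      unfolding sum.distrib[symmetric]
    proof (rule sum.cong[OF refl])
      fix i
      show "of_bool (T (i + 1) \<and> t3 i) + of_bool (T i \<and> t3 i) = (of_bool (W.A i) :: real)"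
        using W.T1[of i] by (cases "T i"; cases "T (i + 1)"; cases "t3 i") (simp_all add: W.A_def)
    qed
    ultimately show ?thesis unfolding c by simp
  qed
  moreover have "?c (\<lambda>i. T (i + 1) \<and> big (vv i)) + ?c (\<lambda>i. T (i + 1) \<and> big (vv (i + 1))) = bigT"
    using W.cnt_shift[of "\<lambda>i. T i \<and> big (vv i)" 1] pers vv_per unfolding bigT_def c[symmetric] by simp
  moreover have "?c (\<lambda>i. N (i + 1)) = W.cnt N" "?c (\<lambda>i. D0 (i + 1)) = W.cnt D0"
    using W.cnt_shift[of N 1] W.cnt_shift[of D0 1] pers unfolding c[symmetric] by simp_all
  moreover have "bonus = (if n = 10 \<and> all_three f then ?c W.R / 5 else 0)"
    by (simp only: bonus_def c)
  ultimately show ?thesis by argo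
qed

lemma cnt_card: "W.cnt P = card {i. i < n \<and> P i}"
  by (simp add: W.cnt_def Int_def)

lemma all_three_iff: "W.cnt (\<lambda>i. \<not> t3 i) = 0 \<longleftrightarrow> all_three f"
proof -
  have "W.cnt (\<lambda>i. \<not> t3 i) = 0 \<longleftrightarrow> (\<forall>i<n. t3 i)" by (auto simp: cnt_card)
  also have "\<dots> \<longleftrightarrow> all_three f"
    using vv_surj vv_set vv_mod n_pos unfolding t3_def by (metis mod_less_divisor)
  finally show ?thesis .
qed

lemma nonthree_only:
  assumes "W.cnt (\<lambda>i. \<not> t3 i) \<le> card (K :: nat set)" "finite K" "\<And>k. k \<in> K \<Longrightarrow> k < n \<and> \<not> t3 k" "j mod n \<notin> K"
  shows "t3 j"
proof (rule ccontr)
  assume "\<not> t3 j"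
  then have "\<not> t3 (j mod n)" using vv_mod by (simp add: t3_def)
  then have "insert (j mod n) K \<subseteq> {i. i < n \<and> \<not> t3 i}" using assms(3) n_pos by auto
  then have "card (insert (j mod n) K) \<le> card {i. i < n \<and> \<not> t3 i}" by (intro card_mono) auto
  then show False using assms(1,2,4) by (simp add: cnt_card)
qed

text \<open>In configuration (2) the draining face is the cycle of the \<open>x\<close>, with
  \<open>vv (i + 2)\<close> and \<open>vv (i + 1)\<close> as first two vertices, and
  \<open>f\<close> is the cycle of the \<open>y\<close>, with \<open>vv i\<close> as
  \<open>y3\<close> and \<open>vv (i + 3)\<close> as \<open>y10\<close>. These two are the only
  heavy vertices of \<open>f\<close>, and the third sides of the two triangles are the extra
  edges.\<close>

lemma not_config2:
  assumes "n = 10" "W.cnt (\<lambda>i. \<not> t3 i) = 2"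
  shows "\<not> D (i + 2)"
proof
  assume d: "D (i + 2)"
  have d0: "D0 (i + 2)" "four (vv i)" "four (vv (i + 3))"
    using d vv_per[of i] by (auto simp: D_def numeral_3_eq_3)
  let ?e = "ee (i + 2)" let ?g = "oth f ?e"
  have g: "?g \<in> F" "?g \<noteq> f" "?e \<in> bd ?g" using oth[OF fF ee_bd] by auto
  have dr: "len ?g = 10" "all_three ?g" using d0(1) by (auto simp: D0_def drain_def)
  have e: "?e = {vv (i + 2), vv (i + 1)}" using ee_Suc[of "i + 1"] by (auto simp: insert_commute)
  obtain r where r: "is_cycle G (vv (i + 2) # vv (i + 1) # r)" "bd ?g = cedges (vv (i + 2) # vv (i + 1) # r)"
    "set (cyc ?g) = set (vv (i + 2) # vv (i + 1) # r)" "length (vv (i + 2) # vv (i + 1) # r) = len ?g"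
    using face_list[of ?g "vv (i + 2)" "vv (i + 1)"] g e by metis
  obtain x3 x4 x5 x6 x7 x8 x9 x10 where x: "r = [x3, x4, x5, x6, x7, x8, x9, x10]"
    using r(4) dr(1) by (auto simp: length_Suc_conv eval_nat_numeral)
  note c1 = r(1)[unfolded x]
  have r1: "rotate (i + 2) (cyc f) = map (\<lambda>k. vv (i + 1 + k)) [0..<10]"
  proof (rule nth_equalityI)
    fix k assume "k < length (rotate (i + 2) (cyc f))"
    then have k: "k < 10" using assms(1) by simp
    have "rotate (i + 2) (cyc f) ! k = cyc f ! ((i + 2 + k) mod n)"
      using k assms(1) by (subst nth_rotate) simp_all
    also have "\<dots> = vv (i + 1 + k)" by (simp add: vv_def)
    finally show "rotate (i + 2) (cyc f) ! k = map (\<lambda>k. vv (i + 1 + k)) [0..<10] ! k" using k by simp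
  qed (use assms in simp)
  have r2: "[0..<10] = [0, 1, 2, 3, 4, 5, 6, 7, 8, 9 :: nat]" by code_simp
  have r3: "map (\<lambda>k. vv (i + 1 + k)) [0, 1, 2, 3, 4, 5, 6, 7, 8, 9]
      = [vv (i + 1), vv (i + 2), vv (i + 3), vv (i + 4), vv (i + 5), vv (i + 6), vv (i + 7), vv (i + 8), vv (i + 9), vv (i + 10)]"
    by (simp add: numeral_eq_Suc)
  have "rotate (i + 2) (cyc f)
      = [vv (i + 1), vv (i + 2), vv (i + 3), vv (i + 4), vv (i + 5), vv (i + 6), vv (i + 7), vv (i + 8), vv (i + 9), vv (i + 10)]"
    by (rule trans[OF r1]) (simp only: r2 r3)
  moreover have "is_cycle G (rotate (i + 2) (cyc f))"
    unfolding rotate_drop_take by (rule is_cycle_rotate) (simp add: face_cycle[OF fF])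
  moreover have "vv (i + 10) = vv i" using vv_per[of i] assms(1) by simp
  ultimately have c2: "is_cycle G [vv (i + 1), vv (i + 2), vv (i + 3), vv (i + 4), vv (i + 5), vv (i + 6), vv (i + 7), vv (i + 8), vv (i + 9), vv i]"
    by simp
  note d1 = cycle10D[OF c1]
  have bg: "bd ?g = {{vv (i + 2), vv (i + 1)}, {vv (i + 1), x3}, {x3, x4}, {x4, x5}, {x5, x6}, {x6, x7}, {x7, x8}, {x8, x9}, {x9, x10}, {x10, vv (i + 2)}}"
    unfolding r(2) x by (auto simp: cedges_eq_pedges)
  obtain z where z: "{vv (i + 1), z} \<in> bd ?g" "{vv (i + 1), z} \<noteq> ?e" "{z, vv i} \<in> edges G"
    using D0_corner(5)[OF d0(1)] by blast
  have "z = x3" using z(1)[unfolded bg] z(2)[unfolded e] d1 by (auto simp: doubleton_eq_iff)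
  then have a3: "adj G x3 (vv i)" using z by (simp add: adj_def)
  obtain z' where z': "{vv (i + 2), z'} \<in> bd ?g" "{vv (i + 2), z'} \<noteq> ?e" "{z', vv (i + 3)} \<in> edges G"
    using D0_corner(6)[OF d0(1)] by blast
  have "z' = x10" using z'(1)[unfolded bg] z'(2)[unfolded e] d1 by (auto simp: doubleton_eq_iff)
  then have a10: "adj G x10 (vv (i + 3))" using z' by (simp add: adj_def)
  have others: "t3 (i + k)" if k: "3 < k" "k < 10" for k
  proof (rule nonthree_only[of "{i mod n, (i + 3) mod n}"])
    have "i mod n \<noteq> (i + 3) mod n" using mod_neq[of 3 i] assms(1) by simp
    then show "W.cnt (\<lambda>i. \<not> t3 i) \<le> card {i mod n, (i + 3) mod n}" using assms(2) by simp
    show "\<And>k. k \<in> {i mod n, (i + 3) mod n} \<Longrightarrow> k < n \<and> \<not> t3 k"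
      using D0_corner(1,2)[OF d0(1)] n_pos vv_mod by (auto simp: t3_def)
    have "i mod n \<noteq> (i + k) mod n" by (rule mod_neq) (use k assms(1) in linarith)+
    moreover have "(i + 3) mod n \<noteq> (i + 3 + (k - 3)) mod n" by (rule mod_neq) (use k assms(1) in linarith)+
    moreover have "i + 3 + (k - 3) = i + k" using k by simp
    ultimately show "(i + k) mod n \<notin> {i mod n, (i + 3) mod n}" by (metis insertE singletonD)
  qed simp
  have y3: "three (vv (i + 4))" "three (vv (i + 5))" "three (vv (i + 6))" "three (vv (i + 7))" "three (vv (i + 8))" "three (vv (i + 9))"
    using others[of 4] others[of 5] others[of 6] others[of 7] others[of 8] others[of 9] by (auto simp: t3_def)
  have deg: "\<forall>z \<in> {vv (i + 2), vv (i + 1), x3, x4, x5, x6, x7, x8, x9, x10, vv (i + 9), vv (i + 8), vv (i + 7), vv (i + 6), vv (i + 5), vv (i + 4)}. vdeg G z = 3"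
    using dr(2) r(3) x y3 by (auto simp: three_def)
  have "{vv i, vv (i + 9), vv (i + 8), vv (i + 7), vv (i + 6), vv (i + 5), vv (i + 4), vv (i + 3)}
      \<inter> {vv (i + 2), vv (i + 1), x3, x4, x5, x6, x7, x8, x9, x10} = {}"
    by (rule two_tens_disjoint[OF c1 c2 a3 a10])
  moreover have "vdeg G (vv i) = 4" "vdeg G (vv (i + 3)) = 4" using d0 by (auto simp: four_def)
  ultimately have "config2 G" unfolding config2_def using c1 c2 deg a3 a10 by blast
  then show False using not2 by simp
qed

lemma low_zero:
  assumes "\<not> T (j + 1)" "\<not> t3 j \<or> \<not> t3 (j + 1)"
  shows "low j = 0"
proof -
  have "\<not> N (j + 1)" using N_corner[of j] assms(2) by blast
  moreover have "\<not> D0 (j + 1)"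
    using assms(2) not_drain_if[OF fF ee_bd, of _ "j + 1"] ee_Suc[of j] by (auto simp: D0_def t3_def)
  moreover have "\<not> all_three f" using assms(2) vv_set by (auto simp: t3_def)
  ultimately show ?thesis using assms(1) by (simp add: low_def)
qed

lemma long_face_charge: "0 \<le> real n - 6 + (\<Sum>e\<in>bd f. net f e)"
proof -
  have le: "(\<Sum>i<n. low i) \<le> (\<Sum>i<n. net f (ee (i + 1)))" by (intro sum_mono low_le)
  have main: "bonus - W.cnt W.A / 2 - W.cnt N / 3 - W.cnt D / 5 \<le> (\<Sum>e\<in>bd f. net f e)"
    using le cnt_D0 unfolding sum_bd sum_low[symmetric] by linarith
  have bonus: "0 \<le> bonus" by (simp add: bonus_def)
  consider "15 * W.cnt W.A + 10 * W.cnt N + 6 * W.cnt D + 180 \<le> 30 * n"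
    | "n = 10" "W.cnt (\<lambda>i. \<not> t3 i) = 0" "15 * W.cnt W.A + 10 * W.cnt N + 6 * W.cnt D \<le> 120 + 6 * W.cnt W.R"
    | "n = 10" "W.cnt (\<lambda>i. \<not> t3 i) = 1" "W.cnt W.A = 9" "W.cnt N = 0" "W.cnt D = 0" "W.tq = 1"
    | "n = 10" "W.cnt (\<lambda>i. \<not> t3 i) = 2" "0 < W.cnt D"
    using W.cost_cases by (elim disjE conjE) (rule that, assumption+)+
  then show ?thesis
  proof cases
    case 1
    then have "15 * real (W.cnt W.A) + 10 * real (W.cnt N) + 6 * real (W.cnt D) + 180 \<le> 30 * real n" by linarith
    then show ?thesis using main bonus by linarith
  next
    case 2
    then have "15 * real (W.cnt W.A) + 10 * real (W.cnt N) + 6 * real (W.cnt D) \<le> 120 + 6 * real (W.cnt W.R)" by linarith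
    moreover have "bonus = W.cnt W.R / 5" using 2 all_three_iff by (simp add: bonus_def)
    ultimately show ?thesis using main 2(1) by linarith
  next
    case 4
    have "0 < W.cnt (\<lambda>i. D (i + 2))" using 4(3) W.cnt_shift[of D 2] pers by simp
    then show ?thesis using W.cnt_pos not_config2[OF 4(1,2)] by blast
  next
    case 3
    have D00: "W.cnt D0 = 0" using W0.two_nonthree' 3(2) by force
    have "0 < W.cnt (\<lambda>i. \<not> t3 i)" using 3 by simp
    then have "{i. i < n \<and> \<not> t3 i} \<noteq> {}" unfolding cnt_card by (metis card.empty less_irrefl)
    then obtain i where i: "i < n" "\<not> t3 i" by auto
    have only: "t3 j" if "j mod n \<noteq> i" for j
      by (rule nonthree_only[of "{i}"]) (use 3(2) i that in auto)
    have "W.cnt W.B = 0" using W.cnt_total 3 by simp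
    then have "\<not> W.B (j mod n)" for j using n_pos by (auto simp: cnt_card)
    then have noB: "\<not> W.B j" for j using periodic_mod[of W.B n j] W.perA by simp
    have tqi: "W.tq = of_bool (T i) + of_bool (T (i + 1))"
    proof -
      have "(\<Sum>j<n. of_bool (\<not> t3 j \<and> P j) :: nat) = (\<Sum>j<n. if j = i then of_bool (P i) else 0)" for P
        by (intro sum.cong) (use only i in auto)
      then show ?thesis using i by (simp add: W.tq_def W.cnt_def del: sum_of_bool_eq)
    qed
    have G: "bigT = (if big (vv i) then 1 else 0)"
    proof -
      have "(\<Sum>j<n. of_bool (P j \<and> big (vv j)) :: nat) = (\<Sum>j<n. if j = i then of_bool (P i \<and> big (vv i)) else 0)" for P
        by (intro sum.cong) (use only in \<open>auto simp: big_def t3_def\<close>)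
      then show ?thesis using i 3(6) unfolding tqi by (auto simp: bigT_def W.cnt_def simp del: sum_of_bool_eq split: if_splits)
    qed
    \<comment> \<open>Nine cubic vertices on triangle edges cost 9/2, and the charge is 4. The
      missing 1/2 comes from the heavy vertex \<open>vv i\<close>: exactly one of its two edges is
      on a triangle, and the other one has a cubic end with a triangle edge since \<open>B\<close>
      is empty, so \<open>gift_other_edge\<close> applies to it. A \<open>big\<close> vertex gives
      1/4 there and another 1/4 through its triangle edge.\<close>
    have x: "\<exists>j. (if four (vv i) then 1/2 else 1/4) \<le> net f (ee (j + 1)) - low j"
    proof (cases "T i")
      case True
      then have nT: "\<not> T (i + 1)" using 3(6) tqi by auto
      have "(i + 1) mod n \<noteq> i" using mod_neq[of 1 i] f10 i(1) by simp
      then have t1: "t3 (i + 1)" by (rule only)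
      then have T2: "T (i + 2)" using noB[of "i + 1"] nT by (simp add: W.B_def)
      have "(if four (vv i) then 1/2 else 1/4) \<le> net f (ee (i + 1))"
      proof (rule gift_other_edge[OF fF f10 _ ee_bd ee_bd])
        show "\<not> three (vv i)" "three (vv (i + 1))" using i t1 by (auto simp: t3_def)
        show "tri (ee i)" "\<not> tri (ee (i + 1))" "tri (ee (i + 2))" using True nT T2 by (auto simp: T_def)
        show "vv i \<in> ee i" "vv i \<in> ee (i + 1)" "vv (i + 1) \<in> ee (i + 1)" "vv (i + 1) \<in> ee (i + 2)"
          using vv_ee[of i] vv_ee[of "i + 1"] by simp_all
      qed (rule ee_bd)
      then show ?thesis using low_zero[of i] nT i(2) by (intro exI[of _ i]) simp
    next
      case False
      then have T1: "T (i + 1)" using 3(6) tqi by (cases "T (i + 1)") auto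
      \<comment> \<open>Position \<open>k + 2\<close> is \<open>i\<close> one turn later, which
        reaches the positions before \<open>i\<close> without truncated subtraction. The bound for
        the edge \<open>k + 2\<close> is \<open>low (k + 1)\<close>.\<close>
      define k where "k = i + n - 2"
      have k: "k + 2 = i + n" using f10 by (simp add: k_def)
      have pv: "vv (k + 2) = vv i" "ee (k + 2) = ee i" "T (k + 2) = T i" "t3 (k + 2) = t3 i" "T (k + 3) = T (i + 1)"
        "ee (k + 3) = ee (i + 1)"
        using k vv_per[of i] ee_per[of i] ee_per[of "i + 1"] pers[of i] pers[of "i + 1"] by (simp_all add: numeral_3_eq_3)
      have "(k + 1) mod n \<noteq> (k + 2) mod n" using mod_neq[of 1 "k + 1"] f10 by simp
      then have "(k + 1) mod n \<noteq> i" using k i(1) by simp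
      then have t1: "t3 (k + 1)" by (rule only)
      then have T2: "T (k + 1)" using noB[of "k + 1"] pv False by (simp add: W.B_def)
      have "(if four (vv i) then 1/2 else 1/4) \<le> net f (ee (k + 2))"
      proof (rule gift_other_edge[OF fF f10 _ ee_bd ee_bd])
        show "\<not> three (vv i)" "three (vv (k + 1))" using i t1 by (auto simp: t3_def)
        show "tri (ee (k + 3))" "\<not> tri (ee (k + 2))" "tri (ee (k + 1))" using False T1 T2 pv by (auto simp: T_def)
        show "vv i \<in> ee (k + 3)" "vv i \<in> ee (k + 2)" "vv (k + 1) \<in> ee (k + 2)" "vv (k + 1) \<in> ee (k + 1)"
          using vv_ee[of i] vv_ee[of "k + 1"] pv by simp_all
      qed (rule ee_bd)
      then show ?thesis using low_zero[of "k + 1"] pv False i(2) by (intro exI[of _ "k + 1"]) simp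
    qed
    then obtain j where j: "(if four (vv i) then 1/2 else 1/4) \<le> net f (ee (j + 1)) - low j" by blast
    \<comment> \<open>The surplus over the bound is nonnegative at every position, so one position
      with a large surplus suffices; \<open>j\<close> may be \<open>n\<close> or more and is reduced
      modulo \<open>n\<close>.\<close>
    define \<psi> where "\<psi> j = net f (ee (j + 1)) - low j" for j
    have per: "\<psi> (j + n) = \<psi> j" for j
    proof -
      have "j + n + 1 = j + 1 + n" "j + n + 1 + 1 = j + 1 + 1 + n" by simp_all
      then show ?thesis
        unfolding \<psi>_def low_def W.R_def W.A_def by (simp only: vv_per ee_per pers)
    qed
    have "\<psi> (j mod n) \<le> (\<Sum>i<n. \<psi> i)"
      using n_pos low_le by (intro member_le_sum) (auto simp: \<psi>_def)
    then have "(if four (vv i) then 1/2 else 1/4) \<le> (\<Sum>e\<in>bd f. net f e) - (\<Sum>i<n. low i)"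
      using j periodic_mod[of \<psi> n j] per unfolding sum_bd by (simp add: \<psi>_def sum_subtractf)
    then have "(if four (vv i) then 1/2 else 1/4) + bonus - 9/2 + bigT / 4 \<le> (\<Sum>e\<in>bd f. net f e)"
      unfolding sum_low[symmetric] using 3 D00 by simp
    moreover have "1/2 \<le> (if four (vv i) then 1/2 else 1/4) + real bigT / 4"
      using i(2) unfolding G by (simp add: big_def t3_def)
    ultimately show ?thesis using 3(1) bonus by linarith
  qed
qed

end

lemma (in charged_block) no_charged_block: False
proof -
  let ?c = "\<lambda>v. 2 * real (card {e \<in> E. v \<in> e}) - 6 - (\<Sum>e\<in>{e \<in> E. v \<in> e}. \<Sum>f\<in>{f \<in> F. e \<in> bd f}. gift v e f)"
  have "0 \<le> real (len f) - 6 + (\<Sum>e\<in>bd f. net f e)" if f: "f \<in> F" for f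
  proof -
    have "len f = 3 \<or> len f = 5 \<or> len f = 6 \<or> len f = 8 \<or> 10 \<le> len f"
      using face_props(2-5)[OF f] by linarith
    moreover have "0 \<le> real (len f) - 6 + (\<Sum>e\<in>bd f. net f e)" if "10 \<le> len f"
    proof -
      interpret long_face G E F cyc v0 f
        by unfold_locales (rule f, rule that)
      show ?thesis by (rule long_face_charge)
    qed
    ultimately show ?thesis
      using triangle_charge[OF f] five_charge[OF f] six_charge[OF f] eight_charge[OF f] by blast
  qed
  then have "0 \<le> (\<Sum>f\<in>F. real (len f) - 6 + (\<Sum>e\<in>bd f. net f e))" by (rule sum_nonneg)
  moreover have "(\<Sum>v\<in>\<Union>E. if v = v0 then -6 else 0) \<le> (\<Sum>v\<in>\<Union>E. ?c v)"
  proof (rule sum_mono)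
    fix v assume v: "v \<in> \<Union>E"
    show "(if v = v0 then -6 else 0) \<le> ?c v" using vertex_charge[OF v] by (cases "v = v0") simp_all
  qed
  moreover have "-6 \<le> (\<Sum>v\<in>\<Union>E. if v = v0 then -6 else 0 :: real)"
    using finite_V by simp
  ultimately show False using total_charge by linarith
qed

theorem theorem1p3:
  fixes G :: "'a ugraph"
    and p :: "'a \<Rightarrow> complex"
    and g :: "'a set \<Rightarrow> real \<Rightarrow> complex"
  assumes "plane_graph G p g"
    and "\<not> has_cycle_of_length G 4"
    and "\<not> has_cycle_of_length G 7"
    and "\<not> has_cycle_of_length G 9"
    and "\<not> (\<exists>c d. is_cycle G c \<and> length c = 5 \<and> is_cycle G d \<and> length d = 3 \<and>
               normally_adjacent c d)"
  shows "min_degree G \<le> 2 \<or> (config1 G \<or> config2 G \<or> config3 G)"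
proof (rule ccontr)
  assume neg: "\<not> ?thesis"
  interpret plane_drawing G p g by unfold_locales (rule assms(1))
  \<comment> \<open>The null graph has minimum degree 0 by convention, so it cannot be a
    counterexample.\<close>
  have ne: "verts G \<noteq> {}" using neg by (auto simp: min_degree_def)
  have deg: "3 \<le> vdeg G v" if "v \<in> verts G" for v
  proof -
    have "min_degree G \<le> vdeg G v"
      using that finite_verts ne by (simp add: min_degree_def)
    then show ?thesis using neg by linarith
  qed
  have "\<exists>E F cyc v0. face_struct E F cyc \<and> E \<noteq> {} \<and> (\<forall>v\<in>\<Union>E. v \<noteq> v0 \<longrightarrow> {e \<in> edges G. v \<in> e} \<subseteq> E)"
    by (rule end_block[OF ne]) (rule deg)
  then obtain E F cyc v0 where fs: "face_struct E F cyc"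
    and full: "\<forall>v\<in>\<Union>E. v \<noteq> v0 \<longrightarrow> {e \<in> edges G. v \<in> e} \<subseteq> E"
    by (elim exE conjE) (rule that)
  have E: "E \<subseteq> edges G" "finite F"
    and cyc: "\<And>R. R \<in> F \<Longrightarrow> is_cycle G (cyc R) \<and> cedges (cyc R) \<subseteq> E \<and> frontier R = draw (cedges (cyc R))"
    and two: "\<And>e. e \<in> E \<Longrightarrow> card {R \<in> F. e \<in> cedges (cyc R)} = 2"
    and euler: "card (\<Union>E) + card F = card E + 2"
    using fs unfolding face_struct_def by - (elim conjE, (assumption | (erule bspec, assumption)))+
  have "charged_block G E F cyc v0"
  proof
    show "simple_graph G" by (rule simple)
    show "\<not> has_cycle_of_length G 4" "\<not> has_cycle_of_length G 7" "\<not> has_cycle_of_length G 9"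
      "\<not> (\<exists>c d. is_cycle G c \<and> length c = 5 \<and> is_cycle G d \<and> length d = 3 \<and> normally_adjacent c d)"
      by (rule assms)+
    show "E \<subseteq> edges G" "finite F" "card (\<Union>E) + card F = card E + 2" by (rule E euler)+
    show "\<not> config1 G" "\<not> config2 G" "\<not> config3 G" using neg by simp_all
    show "is_cycle G (cyc f)" "cedges (cyc f) \<subseteq> E" if "f \<in> F" for f using cyc[OF that] by simp_all
    show "card {f \<in> F. e \<in> cedges (cyc f)} = 2" if "e \<in> E" for e by (rule two[OF that])
    show "{e \<in> edges G. v \<in> e} \<subseteq> E" if "v \<in> \<Union>E" "v \<noteq> v0" for v
      by (rule full[THEN bspec, THEN mp]) (rule that)+
    show "3 \<le> vdeg G v" if "v \<in> verts G" for v by (rule deg[OF that])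
    show "card {e \<in> E. v \<in> e} = 2"
      if "f \<in> F" "f' \<in> F" "f \<noteq> f'" "e1 \<noteq> e2" "v \<in> e1" "v \<in> e2" "e1 \<in> cedges (cyc f)" "e1 \<in> cedges (cyc f')"
        "e2 \<in> cedges (cyc f)" "e2 \<in> cedges (cyc f')" for f f' e1 e2 v
      using fs that unfolding face_struct_def by (elim conjE) blast
  qed
  then show False by (rule charged_block.no_charged_block)
qed

end
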